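(* The unital associahedra $K^u_n$, $n\geq 0$, form a topological operad $\mathtt{uA}_\infty$, with $\mathtt{uA}_\infty(n)=K^u_n$, with the composition laws $\circ_j\colon K^u_p\times K^u_q\to K^u_{p+q-1}$, $1\leq j\leq p$, $q\geq 0$, induced by grafting labelled binary trees and labelling the newly created inner edge by $1$ (as defined in the context), and with unit $u=\bullet\in H_{|}\subset K_1^u$.
   Context: **Operads.** A topological operad (non-symmetric) $\mathtt O$ is a sequence of spaces $\mathtt O(n)$, $n\geq0$, with continuous composition laws $\circ_i\colon\mathtt O(m)\times\mathtt O(n)\to\mathtt O(m+n-1)$, $1\leq i\leq m$, $n\geq 0$, and an element $u\in\mathtt O(1)$ such that: (1) $(a\circ_ib)\circ_jc=(a\circ_jc)\circ_{i+n-1}b$ if $1\leq j<i$ and $c\in\mathtt O(n)$; (2) $(a\circ_ib)\circ_jc=a\circ_i(b\circ_{j-i+1}c)$ if $b\in\mathtt O(m)$ and $i\leq j<m+i$; (3) $u\circ_1a=a$; (4) $a\circ_iu=a$. **Trees.** A planted tree with leaves is a finite contractible 1-dimensional simplicial complex $T$ with at least one edge, a distinguished degree-one vertex (the root) and a set of distinguished degree-one vertices different from the root (the leaves). The remaining degree-one vertices are called corks. It is planar if its vertex set carries a total order $\preceq$ (path order) such that: if $v\neq w$ lies on the shortest path from the root to $w$ then $v\prec w$; otherwise, if neither lies on the path to the other, the paths to $v$ and $w$ agree up to level $n$ (level = distance to the root), and $v',w'$ are the level $n+1$ vertices on these paths, then $v'\prec w'$ implies $v\prec w$. "Tree" means planted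 planar tree with leaves, up to isomorphism preserving root, leaves and path order. Leaves are numbered by the path order; edges are ordered by their top vertices (the vertex farther from the root). A vertex is inner if it is neither the root nor a leaf; an edge is inner if both its vertices are inner; a non-inner edge is called the root edge (resp. a leaf edge) if it contains the root (resp. a leaf). The tree $|$ has one edge, joining the root to a single leaf. The tree $C_0$ has one edge, joining the root to a single cork. For an inner edge $e$, $T/e$ is the tree obtained by contracting $e$. If $T$ has $p$ leaves and $1\leq i\leq p$, the grafting $T\circ_iT'$ is obtained by identifying the root edge of $T'$ with the $i$-th leaf edge of $T$ (so the two edges become one; $|$ is a unit), the vertices of $T'$ other than its root being inserted in the path order in place of the $i$-th leaf vertex. A tree is binary if all vertices have degree 1 or 3. A binary tree different from $|$ with $n$ leaves and $m$ corks has $2m+n-2$ inner edges. If $T$ is binary and $e=\{u\prec v\}$ is an edge with $u$ of degree 3 and $v$ of degree 1, $T\backslash e$ is the binary tree obtained by removing $v$ and $e$ and deleting $u$, so that the other two edges at $u$ are joined into one edge. **Cubes.** $\partial_i^-,\partial_i^+\colon[0,1]^{n-1}\to[0,1]^n$ insert $0$, resp. $1$, as the new $i$-th coordinate. For $1\leq i\leq s+1$, $\sigma_i\colon[0,1]^s\times[0,1]^t\to[0,1]^{s+t}$ is $(x_1,\dots,x_s,y_1,\dots,y_t)\mapsto(x_1,\dots,x_{i-1},y_1,\dots,y_t,x_i,\dots,x_s)$. **Unital associahedra.** For a binary tree $T$ with $n$ leaves and $m$ corks let $H_T=[0,1]^{2m+n-2}$ (with $H_|=\bullet$ a point); a point $(x_1,x_2,\dots)\in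 H_T$ is regarded as the labelling of the $i$-th inner edge of $T$ by $x_i$ for all $i$. The unital associahedron $K^u_n$ is the quotient of $\coprod_T H_T$ ($T$ running over all binary trees with $n$ leaves and any number of corks) by the equivalence relation generated by: (R1) If $T,T'$ are binary trees with $n$ leaves and $m$ corks, the $i$-th inner edge $e_i$ of $T$ and the $j$-th inner edge $e'_j$ of $T'$ do not contain corks, and $T/e_i=T'/e'_j$, then $\partial_i^-(x)\in H_T$ is identified with $\partial_j^-(x)\in H_{T'}$ for all $x\in[0,1]^{2m+n-3}$. (R2) If the $i$-th inner edge $e_i$ of $T$ contains a cork, then $\partial_i^-(x)\in H_T$ is identified with $\varepsilon(x)\in H_{T\backslash e_i}$ for all $x\in[0,1]^{2m+n-3}$, where $\varepsilon$ is the following map. Let $u$ be the degree 3 vertex of $e_i$ and let $e',e''$ be the other two edges at $u$, which become a single edge $\bar e$ of $T\backslash e_i$. The point $x$ gives labels to all inner edges of $T$ other than $e_i$; $\varepsilon(x)$ keeps the labels of all inner edges different from $e',e''$. If $e'$ and $e''$ are both inner with labels $a,b$, then $\bar e$ is inner and gets the label $\max(a,b)$; if exactly one of $e',e''$ is inner, then $\bar e$ is not inner and that label is forgotten; if neither is inner, then $T\backslash e_i=|$ and $\varepsilon(x)=\bullet\in H_|$. **Composition laws.** For binary trees $T$, $T'$ with $p\geq1$ and $q$ leaves, both different from $|$, with $\alpha$ and $\beta$ inner edges respectively, if the edge of $T\circ_jT'$ obtained by identifying the root edge of $T'$ with the $j$-th leaf edge of $T$ is the $k$-th inner edge, then $\circ_j$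 is given on $H_T\times H_{T'}$ by $\partial_k^+\sigma_k\colon[0,1]^\alpha\times[0,1]^\beta\to[0,1]^{\alpha+\beta+1}=H_{T\circ_jT'}$. If $T=|$ or $T'=|$, then $\circ_j$ is the identity on the other cube. *)

theory Defs
  imports "HOL-Analysis.Analysis" "HOL-Library.List_Lexorder"
begin

section \<open>Topological operads\<close>

text \<open>
  The composition law of arities \<open>m\<close> and \<open>n\<close> at the input \<open>i\<close> (counted from 1) is
  \<open>circ m n i\<close>. All spaces \<open>P n\<close> live on one type and are given as abstract topologies.
\<close>

locale topological_operad =
  fixes P :: "nat \<Rightarrow> 'a topology"
    and circ :: "nat \<Rightarrow> nat \<Rightarrow> nat \<Rightarrow> 'a \<Rightarrow> 'a \<Rightarrow> 'a"
    and u :: 'a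
  assumes continuous_circ:
      "\<And>m n i. \<lbrakk>1 \<le> i; i \<le> m\<rbrakk> \<Longrightarrow>
        continuous_map (prod_topology (P m) (P n)) (P (m + n - 1)) (\<lambda>(a, b). circ m n i a b)"
    and unit_in: "u \<in> topspace (P 1)"
    and circ_parallel:
      "\<And>l m n i j a b c.
        \<lbrakk>a \<in> topspace (P l); b \<in> topspace (P m); c \<in> topspace (P n); 1 \<le> j; j < i; i \<le> l\<rbrakk> \<Longrightarrow>
        circ (l + m - 1) n j (circ l m i a b) c
          = circ (l + n - 1) m (i + n - 1) (circ l n j a c) b"
    and circ_sequential:
      "\<And>l m n i j a b c.
        \<lbrakk>a \<in> topspace (P l); b \<in> topspace (P m); c \<in> topspace (P n);
          1 \<le> i; i \<le> l; i \<le> j; j < m + i\<rbrakk> \<Longrightarrow>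
        circ (l + m - 1) n j (circ l m i a b) c
          = circ l (m + n - 1) i a (circ m n (j - i + 1) b c)"
    and unit_circ: "\<And>n a. a \<in> topspace (P n) \<Longrightarrow> circ 1 n 1 u a = a"
    and circ_unit: "\<And>m i a. \<lbrakk>a \<in> topspace (P m); 1 \<le> i; i \<le> m\<rbrakk> \<Longrightarrow> circ m 1 i a u = a"


section \<open>Planted planar trees with leaves\<close>

text \<open>
  An isomorphism class of planted planar trees with leaves is encoded by what lies above the
  root, that is, by the top vertex \<open>v\<close> of the root edge: \<open>v\<close> is a leaf, or it is an inner vertex
  with the (possibly empty) list, in path order, of the planted trees whose root edges are the
  edges going up from \<open>v\<close>. Thus \<open>Leaf\<close> is the tree \<open>|\<close>, \<open>Node []\<close> is the tree \<open>C\<^sub>0\<close>, and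
  corks are the occurrences of \<open>Node []\<close>.

  A vertex other than the root is addressed by the list of child numbers (from 0) leading to it
  from the top vertex of the root edge, which itself has address \<open>[]\<close>. The path order is then
  the lexicographic order of the addresses (prefixes come first), which is the order on lists
  provided by \<open>List_Lexorder\<close>. An edge is denoted by the address of its top vertex.
\<close>

datatype ptree = Leaf | Node "ptree list"

fun subtree_at :: "ptree \<Rightarrow> nat list \<Rightarrow> ptree option" where
  "subtree_at t [] = Some t"
| "subtree_at Leaf (k # p) = None"
| "subtree_at (Node ts) (k # p) = (if k < length ts then subtree_at (ts ! k) p else None)"

fun replace_at :: "ptree \<Rightarrow> nat list \<Rightarrow> ptree \<Rightarrow> ptree" where
  "replace_at t [] s = s"
| "replace_at Leaf (k # p) s = Leaf"
| "replace_at (Node ts) (k # p) s =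
     (if k < length ts then Node (ts[k := replace_at (ts ! k) p s]) else Node ts)"

fun children :: "ptree \<Rightarrow> ptree list" where
  "children Leaf = []"
| "children (Node ts) = ts"

definition leaves :: "ptree \<Rightarrow> nat list set" where
  "leaves t = {p. subtree_at t p = Some Leaf}"

definition corks :: "ptree \<Rightarrow> nat list set" where
  "corks t = {p. subtree_at t p = Some (Node [])}"

text \<open>The bottom vertex of the edge \<open>p\<close> is the root iff \<open>p = []\<close>; otherwise it is an inner vertex.\<close>

definition inner_edges :: "ptree \<Rightarrow> nat list set" where
  "inner_edges t = {p. p \<noteq> [] \<and> (\<exists>ts. subtree_at t p = Some (Node ts))}"

text \<open>\<open>Suc (length ts)\<close> is the degree of the vertex in question; the root always has degree 1.\<close>

definition binary :: "ptree \<Rightarrow> bool" where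
  "binary t \<longleftrightarrow> (\<forall>p ts. subtree_at t p = Some (Node ts) \<longrightarrow> Suc (length ts) \<in> {1, 3})"

text \<open>Both directions of the numbering, from 1, of a finite ordered set:
  the \<open>i\<close>-th element, and the number of an element.\<close>

definition nth_of :: "'a::linorder set \<Rightarrow> nat \<Rightarrow> 'a" where
  "nth_of S i = sorted_list_of_set S ! (i - 1)"

definition number_in :: "'a::linorder set \<Rightarrow> 'a \<Rightarrow> nat" where
  "number_in S a = card {b \<in> S. b \<le> a}"

text \<open>The tree \<open>T / e\<close>, for an inner edge \<open>e\<close>: the top vertex of \<open>e\<close> is replaced, among the
  children of the bottom vertex of \<open>e\<close>, by its own children.\<close>

definition contract :: "ptree \<Rightarrow> nat list \<Rightarrow> ptree" where
  "contract t e =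
    (let q = butlast e; k = last e; ts = children (the (subtree_at t q))
     in replace_at t q (Node (take k ts @ children (ts ! k) @ drop (Suc k) ts)))"

text \<open>For a binary tree, a degree three vertex \<open>u = butlast e\<close> and one of its two children \<open>e\<close>,
  the other child is \<open>sibling e\<close>.\<close>

definition sibling :: "nat list \<Rightarrow> nat list" where
  "sibling e = butlast e @ [1 - last e]"

text \<open>The tree \<open>T \ e\<close>, for \<open>T\<close> binary and \<open>e\<close> an edge containing a cork and a vertex of degree 3.\<close>

definition prune :: "ptree \<Rightarrow> nat list \<Rightarrow> ptree" where
  "prune t e = replace_at t (butlast e) (the (subtree_at t (sibling e)))"

definition graft :: "ptree \<Rightarrow> nat \<Rightarrow> ptree \<Rightarrow> ptree" where
  "graft t j t' = replace_at t (nth_of (leaves t) j) t'"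


section \<open>Cubes\<close>

text \<open>The cube \<open>[0,1]\<^sup>n\<close>, with coordinates numbered from 1; its points are functions that are
  \<open>undefined\<close> outside \<open>{1..n}\<close>.\<close>

definition cube :: "nat \<Rightarrow> (nat \<Rightarrow> real) topology" where
  "cube n = product_topology (\<lambda>_. top_of_set {0..1}) {1..n}"

text \<open>The map \<open>\<partial>\<^sub>i : [0,1]\<^sup>n\<^sup>-\<^sup>1 \<rightarrow> [0,1]\<^sup>n\<close> inserting \<open>c\<close>, where \<open>c\<close> is 0 or 1, as the new
  \<open>i\<close>-th coordinate.\<close>

definition face :: "real \<Rightarrow> nat \<Rightarrow> nat \<Rightarrow> (nat \<Rightarrow> real) \<Rightarrow> nat \<Rightarrow> real" where
  "face c n i x = (\<lambda>l\<in>{1..n}. if l < i then x l else if l = i then c else x (l - 1))"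

text \<open>The map \<open>\<sigma>\<^sub>i : [0,1]\<^sup>s \<times> [0,1]\<^sup>t \<rightarrow> [0,1]\<^sup>s\<^sup>+\<^sup>t\<close>.\<close>

definition insert_cube ::
    "nat \<Rightarrow> nat \<Rightarrow> nat \<Rightarrow> (nat \<Rightarrow> real) \<Rightarrow> (nat \<Rightarrow> real) \<Rightarrow> nat \<Rightarrow> real" where
  "insert_cube s t i x y =
    (\<lambda>l\<in>{1..s + t}. if l < i then x l else if l < i + t then y (l - i + 1) else x (l - t))"


section \<open>Unital associahedra\<close>

text \<open>The dimension \<open>2m + n - 2\<close> of \<open>H\<^sub>T\<close>. For \<open>T = |\<close> the truncated subtraction gives 0,
  as it should.\<close>

definition dim_cell :: "ptree \<Rightarrow> nat" where
  "dim_cell t = 2 * card (corks t) + card (leaves t) - 2"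

text \<open>The disjoint union of the \<open>H\<^sub>T\<close>; its points are the pairs \<open>(T, x)\<close> with \<open>x \<in> H\<^sub>T\<close>.\<close>

definition cells :: "nat \<Rightarrow> (ptree \<times> (nat \<Rightarrow> real)) topology" where
  "cells n = sum_topology (\<lambda>t. cube (dim_cell t)) {t. binary t \<and> card (leaves t) = n}"

text \<open>The label of the inner edge \<open>f\<close> in the labelled tree \<open>(T, x)\<close>.\<close>

definition label :: "ptree \<Rightarrow> (nat \<Rightarrow> real) \<Rightarrow> nat list \<Rightarrow> real" where
  "label t x f = x (number_in (inner_edges t) f)"

text \<open>
  The labels of \<open>\<epsilon>(x) \<in> H\<^bsub>T \ e\<^esub>\<close>, where \<open>y\<close> is \<open>x\<close> with an arbitrary label for \<open>e\<close> inserted.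
  Let \<open>q = butlast e\<close> be the degree three vertex of \<open>e\<close>. The other two edges at this vertex
  are \<open>q\<close> and \<open>sibling e\<close>; they merge into the edge \<open>q\<close> of \<open>T \ e\<close>, which is inner iff both are.
  The edges \<open>q @ r\<close> with \<open>r \<noteq> []\<close> come from the edges \<open>sibling e @ r\<close> of \<open>T\<close>.
  The remaining edges have the same address in both trees.
\<close>

definition prune_label :: "ptree \<Rightarrow> nat list \<Rightarrow> (nat \<Rightarrow> real) \<Rightarrow> nat list \<Rightarrow> real" where
  "prune_label t e y f =
    (let q = butlast e in
     if f = q then max (label t y q) (label t y (sibling e))
     else if take (length q) f = q then label t y (sibling e @ drop (length q) f)
     else label t y f)"

definition prune_point :: "ptree \<Rightarrow> nat list \<Rightarrow> (nat \<Rightarrow> real) \<Rightarrow> nat \<Rightarrow> real" where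
  "prune_point t e y =
    (\<lambda>l\<in>{1..dim_cell (prune t e)}. prune_label t e y (nth_of (inner_edges (prune t e)) l))"

inductive identified :: "ptree \<times> (nat \<Rightarrow> real) \<Rightarrow> ptree \<times> (nat \<Rightarrow> real) \<Rightarrow> bool" where
  R1: "\<lbrakk>binary t; binary t'; card (leaves t) = card (leaves t'); card (corks t) = card (corks t');
        e \<in> inner_edges t; e \<notin> corks t; e' \<in> inner_edges t'; e' \<notin> corks t';
        contract t e = contract t' e';
        i = number_in (inner_edges t) e; j = number_in (inner_edges t') e';
        x \<in> topspace (cube (dim_cell t - 1))\<rbrakk>
      \<Longrightarrow> identified (t, face 0 (dim_cell t) i x) (t', face 0 (dim_cell t') j x)"
| R2: "\<lbrakk>binary t; e \<in> inner_edges t; e \<in> corks t; i = number_in (inner_edges t) e;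
        x \<in> topspace (cube (dim_cell t - 1));
        y = face 0 (dim_cell t) i x\<rbrakk>
      \<Longrightarrow> identified (t, y) (prune t e, prune_point t e y)"

definition cell_rel :: "nat \<Rightarrow> ((ptree \<times> (nat \<Rightarrow> real)) \<times> (ptree \<times> (nat \<Rightarrow> real))) set" where
  "cell_rel n =
    {(a, b). a \<in> topspace (cells n) \<and> b \<in> topspace (cells n) \<and> equivclp identified a b}"

definition quotient_topology :: "'a topology \<Rightarrow> ('a \<times> 'a) set \<Rightarrow> 'a set topology" where
  "quotient_topology X r =
    topology (\<lambda>U. U \<subseteq> topspace X // r \<and> openin X {x \<in> topspace X. r `` {x} \<in> U})"

lemma openin_quotient_topology:
  "openin (quotient_topology X r) U \<longleftrightarrow>
    U \<subseteq> topspace X // r \<and> openin X {x \<in> topspace X. r `` {x} \<in> U}"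
proof -
  let ?L = "\<lambda>U. U \<subseteq> topspace X // r \<and> openin X {x \<in> topspace X. r `` {x} \<in> U}"
  have "?L (S \<inter> T)" if "?L S" "?L T" for S T
  proof -
    have "{x \<in> topspace X. r `` {x} \<in> S \<inter> T}
        = {x \<in> topspace X. r `` {x} \<in> S} \<inter> {x \<in> topspace X. r `` {x} \<in> T}"
      by auto
    with that show ?thesis
      by (auto simp: openin_Int)
  qed
  moreover have "?L (\<Union>\<K>)" if "\<forall>K\<in>\<K>. ?L K" for \<K>
  proof -
    have "{x \<in> topspace X. r `` {x} \<in> \<Union>\<K>} = (\<Union>K\<in>\<K>. {x \<in> topspace X. r `` {x} \<in> K})"
      by auto
    with that show ?thesis
      by auto
  qed
  ultimately have "istopology ?L"
    unfolding istopology_def by blast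
  then show ?thesis
    unfolding quotient_topology_def by (simp add: topology_inverse')
qed

lemma topspace_quotient_topology: "topspace (quotient_topology X r) = topspace X // r"
proof
  show "topspace (quotient_topology X r) \<subseteq> topspace X // r"
    using openin_topspace[of "quotient_topology X r"] unfolding openin_quotient_topology by blast
  have "{x \<in> topspace X. r `` {x} \<in> topspace X // r} = topspace X"
    by (auto simp: quotient_def)
  then have "openin (quotient_topology X r) (topspace X // r)"
    by (simp add: openin_quotient_topology)
  then show "topspace X // r \<subseteq> topspace (quotient_topology X r)"
    by (rule openin_subset)
qed

lemma quotient_map_quotient_topology:
  "quotient_map X (quotient_topology X r) (\<lambda>x. r `` {x})"
  unfolding quotient_map_def topspace_quotient_topology openin_quotient_topology
  by (auto simp: quotient_def)

text \<open>The class in \<open>K\<^sup>u\<^sub>n\<close> of a point of the disjoint union, and the space \<open>K\<^sup>u\<^sub>n\<close>.\<close>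

definition cell_class ::
    "nat \<Rightarrow> ptree \<times> (nat \<Rightarrow> real) \<Rightarrow> (ptree \<times> (nat \<Rightarrow> real)) set" where
  "cell_class n a = cell_rel n `` {a}"

definition unital_associahedron :: "nat \<Rightarrow> (ptree \<times> (nat \<Rightarrow> real)) set topology" where
  "unital_associahedron n = quotient_topology (cells n) (cell_rel n)"


section \<open>Composition laws\<close>

text \<open>The edge of \<open>T \<circ>\<^sub>j T'\<close> at which the trees are glued has the address of the \<open>j\<close>-th leaf
  of \<open>T\<close>.\<close>

fun graft_point ::
    "nat \<Rightarrow> ptree \<times> (nat \<Rightarrow> real) \<Rightarrow> ptree \<times> (nat \<Rightarrow> real) \<Rightarrow> ptree \<times> (nat \<Rightarrow> real)" where
  "graft_point j (t, x) (t', y) =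
    (if t = Leaf then (t', y)
     else if t' = Leaf then (t, x)
     else let k = number_in (inner_edges (graft t j t')) (nth_of (leaves t) j);
              \<alpha> = dim_cell t; \<beta> = dim_cell t'
          in (graft t j t', face 1 (\<alpha> + \<beta> + 1) k (insert_cube \<alpha> \<beta> k x y)))"

text \<open>The law induced on classes by \<open>graft_point\<close>. The union is over representatives; it is the
  common class of all their composites provided that \<open>graft_point\<close> respects the relations.\<close>

definition uA_circ ::
    "nat \<Rightarrow> nat \<Rightarrow> nat \<Rightarrow> (ptree \<times> (nat \<Rightarrow> real)) set \<Rightarrow> (ptree \<times> (nat \<Rightarrow> real)) set
      \<Rightarrow> (ptree \<times> (nat \<Rightarrow> real)) set" where
  "uA_circ p q j A B = (\<Union>a\<in>A. \<Union>b\<in>B. cell_class (p + q - 1) (graft_point j a b))"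

text \<open>The only point of \<open>H\<^sub>|\<close> is the function that is \<open>undefined\<close> everywhere.\<close>

definition uA_unit :: "(ptree \<times> (nat \<Rightarrow> real)) set" where
  "uA_unit = cell_class 1 (Leaf, \<lambda>_. undefined)"

end

theory Submission
  imports Defs
begin

text \<open>
  The algebra is transparent once a point \<open>(T, x)\<close> is read as a tree whose edges carry their
  labels. Give the root edge the label 1 (\<open>encode\<close>); grafting is then substitution for a leaf,
  with no case distinction for the unit \<open>|\<close> and no separate instruction to label the new edge
  by 1, since that edge is the root edge of the upper tree
  (\<open>encode_graft_point\<close>). Substitution satisfies the operad identities on the nose
  (\<open>lgraft_parallel\<close>, \<open>lgraft_sequential\<close>), and \<open>encode\<close> is injective, so already
  \<open>graft_point\<close> satisfies them before any identification.

  The generating relations become local rewriting moves at an address: (R1) is the rotation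
  \<open>(x y) z \<leadsto> x (y z)\<close> across an edge labelled 0, because two binary trees with a common
  contraction differ by at most one rotation, and (R2) deletes a cork on an edge labelled 0 and
  replaces the two labels next to it by their maximum
  (\<open>moves_if_identified\<close>, \<open>identified_if_move\<close>). The convention for the root also absorbs
  the case distinction of (R2), because \<open>max 1 a = 1\<close>. Moves are
  compatible with substitution in either argument, hence the laws descend to classes
  (\<open>equivclp_graft\<close>, \<open>uA_circ_cell_class\<close>).

  Continuity is the delicate point. On cells the law is visibly continuous
  (\<open>continuous_map_graft_point\<close>), but a product of two quotient maps need not be a quotient
  map, and local compactness, the usual remedy, is no help: infinitely many cells of
  \<open>K\<^sup>u\<^sub>1\<close> are attached to the point of \<open>H\<^sub>|\<close>. What saves the day is that \<open>K\<^sup>u\<^sub>n\<close> is the increasing union of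
  the images of finitely many cells, those with at most \<open>m\<close> corks. For increasing unions of
  compact spaces modulo closed equivalence relations, a saturated open set of the product
  contains, around each of its points, a box of saturated open sets, obtained as an increasing
  union of closed boxes by repeated use of the tube lemma
  (\<open>quotient_map_prod_exhausted\<close>).

  It remains to see that the relation generated on finitely many cells is closed. Its steps form
  a compact relation \<open>E\<close>, so all powers of \<open>E\<close> are compact, and it suffices that they
  stabilise. Moves only compare labels with 0 and take maxima, so they commute with applying a
  monotone function fixing 0 and 1 to all labels. Whether two points are linked by \<open>k\<close>
  steps therefore depends only on their trees and on the relative order of 0, 1 and their
  labels, and there are only finitely many such patterns
  (\<open>same_pattern_relabel\<close>, \<open>closedin_trancl_linked_in\<close>).
\<close>

section \<open>Products of quotients of increasing unions of compact spaces\<close>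

text \<open>
  The relation on the whole space is the union of the \<open>S m\<close>; it need not be closed, and its
  restriction to a piece \<open>F m\<close> may be larger than \<open>S m\<close>. The pieces increase because the
  \<open>S m\<close> do and are reflexive on them.
\<close>

locale exhausted_quotient =
  fixes X :: "'a topology" and F :: "nat \<Rightarrow> 'a set" and S :: "nat \<Rightarrow> ('a \<times> 'a) set"
  assumes Hausdorff: "Hausdorff_space X"
    and open_piece: "openin X (F m)"
    and compact_piece: "compactin X (F m)"
    and pieces_cover: "(\<Union>m. F m) = topspace X"
    and equiv_piece: "equiv (F m) (S m)"
    and closed_piece: "closedin (prod_topology X X) (S m)"
    and mono_piece: "S m \<subseteq> S (Suc m)"
begin

abbreviation R :: "('a \<times> 'a) set" where "R \<equiv> (\<Union>m. S m)"

lemma S_mono: "m \<le> n \<Longrightarrow> S m \<subseteq> S n"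
  using lift_Suc_mono_le[of S] mono_piece by blast

lemma F_mono: "m \<le> n \<Longrightarrow> F m \<subseteq> F n"
proof
  fix x assume "m \<le> n" "x \<in> F m"
  then have "(x, x) \<in> S n"
    using S_mono equiv_piece by (meson equiv_class_self equiv_def in_mono refl_onD)
  then show "x \<in> F n"
    using equiv_piece equiv_type by fastforce
qed

lemma S_subset: "S m \<subseteq> F m \<times> F m"
  using equiv_piece by (rule equiv_type)

lemma equiv_R: "equiv (topspace X) R"
proof (rule equivI)
  show "R \<subseteq> topspace X \<times> topspace X"
    using S_subset pieces_cover by fastforce
  show "refl_on (topspace X) R"
    unfolding refl_on_def
    using pieces_cover equiv_piece by (metis UN_E UN_I UNIV_I equiv_def refl_on_def)
  show "sym R"
    using equiv_piece by (fastforce simp: sym_def equiv_def)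
  show "trans R"
  proof (rule transI)
    fix x y z assume "(x, y) \<in> R" "(y, z) \<in> R"
    then obtain m n where "(x, y) \<in> S m" "(y, z) \<in> S n"
      by auto
    then have "(x, y) \<in> S (max m n)" "(y, z) \<in> S (max m n)"
      using S_mono by (meson in_mono max.cobounded1 max.cobounded2)+
    then show "(x, z) \<in> R"
      using equiv_piece[of "max m n"] by (auto simp: equiv_def dest: transD)
  qed
qed

lemma closed_saturation:
  assumes "closedin X C" "C \<subseteq> F m"
  shows "closedin X (S m `` C)"
proof -
  have C: "compactin X C"
    using assms compact_piece closed_compactin by blast
  have eq: "S m `` C = snd ` (S m \<inter> (C \<times> F m))"
    using S_subset by (force simp: image_iff)
  have "compactin (prod_topology X X) (C \<times> F m)"
    using C compact_piece by (simp add: compactin_Times)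
  then have "compactin (prod_topology X X) (S m \<inter> (C \<times> F m))"
    by (metis closed_piece compact_Int_closedin inf_commute)
  then have "compactin X (S m `` C)"
    unfolding eq by (rule image_compactin) (rule continuous_map_snd)
  then show ?thesis
    by (rule compactin_imp_closedin[OF Hausdorff])
qed

text \<open>
  One step of the construction of saturated open neighbourhoods. The sets \<open>C\<close> and \<open>F m - U\<close>
  are disjoint and compact, so they have disjoint open neighbourhoods \<open>P\<close> and \<open>Q\<close>; then
  \<open>F m - Q\<close> is a closed neighbourhood of \<open>C\<close> in \<open>F m\<close>, and its saturation one stage up is
  still closed. It may leave \<open>U\<close>, but it stays in the saturation of \<open>U\<close>.
\<close>

lemma enlarge:
  assumes C: "closedin X C" "C \<subseteq> F m" and U: "openin X U" "C \<subseteq> U"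
  shows "\<exists>A C'. openin X A \<and> C \<subseteq> A \<and> A \<subseteq> C' \<and> closedin X C' \<and> C' \<subseteq> F (Suc m) \<and>
           S (Suc m) `` C' \<subseteq> C' \<and> C' \<subseteq> R `` U"
proof -
  have "compactin X C"
    using C compact_piece closed_compactin by blast
  moreover have "compactin X (F m - U)"
    using compact_piece U closed_compactin Hausdorff
    by (metis Diff_subset closedin_diff compactin_imp_closedin)
  moreover have "disjnt C (F m - U)"
    using U by (auto simp: disjnt_def)
  ultimately obtain P Q where PQ: "openin X P" "openin X Q" "C \<subseteq> P" "F m - U \<subseteq> Q" "disjnt P Q"
    using Hausdorff unfolding Hausdorff_space_compact_sets by meson
  define C1 where "C1 = F m - Q"
  define C' where "C' = S (Suc m) `` C1"
  have C1: "closedin X C1"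
    unfolding C1_def using compactin_imp_closedin[OF Hausdorff compact_piece] PQ(2) by blast
  have C1F: "C1 \<subseteq> F (Suc m)"
    using F_mono[of m "Suc m"] by (auto simp: C1_def)
  have eqv: "equiv (F (Suc m)) (S (Suc m))"
    by (rule equiv_piece)
  have "C1 \<subseteq> C'"
    using C1F eqv unfolding C'_def by (auto simp: equiv_def refl_on_def)
  moreover have "P \<inter> F m \<subseteq> C1"
    using PQ by (auto simp: C1_def disjnt_iff)
  moreover have "S (Suc m) `` C' \<subseteq> C'"
    using eqv unfolding C'_def by (auto simp: equiv_def dest: transD)
  moreover have "C' \<subseteq> R `` U"
    using PQ by (auto simp: C'_def C1_def)
  moreover have "closedin X C'"
    unfolding C'_def using closed_saturation C1 C1F by blast
  moreover have "C' \<subseteq> F (Suc m)"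
    using S_subset[of "Suc m"] by (auto simp: C'_def)
  moreover have "openin X (P \<inter> F m)"
    using PQ open_piece by blast
  ultimately show ?thesis
    using PQ C by (intro exI[of _ "P \<inter> F m"] exI[of _ C']) auto
qed

text \<open>
  Each \<open>C n\<close> needs to be saturated only for the relation of its own stage, as any two related
  points are related at some finite stage.
\<close>

lemma saturated_UN:
  assumes C: "\<And>n. C n \<subseteq> C (Suc n)" and S: "\<And>n. S (N + n) `` C n \<subseteq> C n"
  shows "R `` (\<Union>n. C n) \<subseteq> (\<Union>n. C n)"
proof
  fix y assume "y \<in> R `` (\<Union>n. C n)"
  then obtain k n x where k: "(x, y) \<in> S k" "x \<in> C n"
    by auto
  have "C n \<subseteq> C (n + k)"
    using lift_Suc_mono_le[of C n "n + k"] C by simp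
  moreover have "S k \<subseteq> S (N + (n + k))"
    by (rule S_mono) simp
  ultimately have "y \<in> S (N + (n + k)) `` C (n + k)"
    using k by blast
  then show "y \<in> (\<Union>n. C n)"
    using S by blast
qed

lemma openin_quotient_image:
  assumes "openin X A" "R `` A \<subseteq> A"
  shows "openin (quotient_topology X R) ((\<lambda>x. R `` {x}) ` A)"
proof -
  have "A \<subseteq> topspace X"
    using assms(1) by (rule openin_subset)
  moreover have "{x \<in> topspace X. R `` {x} \<in> (\<lambda>x. R `` {x}) ` A} = A"
  proof (safe)
    fix x y assume "x \<in> topspace X" "R `` {x} = R `` {y}" "y \<in> A"
    then have "(y, x) \<in> R"
      using equiv_R by (metis \<open>A \<subseteq> topspace X\<close> eq_equiv_class_iff in_mono)
    then show "x \<in> A"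
      using assms(2) \<open>y \<in> A\<close> by blast
  qed (use \<open>A \<subseteq> topspace X\<close> in auto)
  ultimately show ?thesis
    using assms(1) by (auto simp: openin_quotient_topology intro: quotientI)
qed

end

text \<open>
  Only openness is at stake. Given a point of a saturated open set \<open>W\<close> of the product, start
  with the box of the two classes at a stage containing the point, and enlarge it forever inside
  \<open>W\<close>, keeping both sides closed and saturated at the current stage. Each box contains a
  neighbourhood of the previous one, so the unions of the sides are open, and they are saturated
  for the whole relation.
\<close>

theorem quotient_map_prod_exhausted:
  assumes X: "exhausted_quotient X F S" and Y: "exhausted_quotient Y G T"
  defines "P \<equiv> (\<Union>m. S m)" and "Q \<equiv> (\<Union>m. T m)"
  shows "quotient_map (prod_topology X Y)
           (prod_topology (quotient_topology X P) (quotient_topology Y Q))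
           (\<lambda>(x, y). (P `` {x}, Q `` {y}))"
proof -
  interpret X: exhausted_quotient X F S by (rule X)
  interpret Y: exhausted_quotient Y G T by (rule Y)
  let ?f = "\<lambda>(x, y). (P `` {x}, Q `` {y})"
  let ?K = "prod_topology (quotient_topology X P) (quotient_topology Y Q)"
  have P: "equiv (topspace X) P" and Q: "equiv (topspace Y) Q"
    unfolding P_def Q_def by (rule X.equiv_R Y.equiv_R)+
  have cont: "continuous_map (prod_topology X Y) ?K ?f"
    using quotient_imp_continuous_map[OF quotient_map_quotient_topology, of X P]
      quotient_imp_continuous_map[OF quotient_map_quotient_topology, of Y Q]
    by (simp add: continuous_map_prod_top)
  have onto: "?f ` topspace (prod_topology X Y) = topspace ?K"
    by (auto simp: topspace_quotient_topology quotient_def image_iff)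
  have op: "openin ?K V"
    if V: "V \<subseteq> topspace ?K" and W: "openin (prod_topology X Y) {z \<in> topspace (prod_topology X Y). ?f z \<in> V}"
    for V
  proof -
    define W where "W = {z \<in> topspace (prod_topology X Y). ?f z \<in> V}"
    have sat: "P `` U \<times> Q `` U' \<subseteq> W" if "U \<times> U' \<subseteq> W" for U U'
    proof (clarify)
      fix x y x' y' assume xy: "x \<in> U" "(x, x') \<in> P" "y \<in> U'" "(y, y') \<in> Q"
      then have "(x, y) \<in> W"
        using that by blast
      moreover have "P `` {x} = P `` {x'}" "Q `` {y} = Q `` {y'}"
        using P Q xy by (meson equiv_class_eq)+
      moreover have "x' \<in> topspace X" "y' \<in> topspace Y"
        using P Q xy by (meson equiv_class_eq_iff)+
      ultimately show "(x', y') \<in> W"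
        by (simp add: W_def)
    qed
    have "\<exists>A B. openin (quotient_topology X P) A \<and> openin (quotient_topology Y Q) B \<and>
                a \<in> A \<and> b \<in> B \<and> A \<times> B \<subseteq> V" if ab: "(a, b) \<in> V" for a b
    proof -
      have "(a, b) \<in> topspace ?K"
        using ab V by blast
      then obtain x0 y0 where x0: "x0 \<in> topspace X" "a = P `` {x0}"
        and y0: "y0 \<in> topspace Y" "b = Q `` {y0}"
        by (auto simp: topspace_quotient_topology quotient_def)
      obtain m m' where "x0 \<in> F m" "y0 \<in> G m'"
        using X.pieces_cover Y.pieces_cover x0 y0 by blast
      define N where "N = max m m'"
      have N: "x0 \<in> F N" "y0 \<in> G N"
        using X.F_mono[of m N] Y.F_mono[of m' N] \<open>x0 \<in> F m\<close> \<open>y0 \<in> G m'\<close> by (auto simp: N_def)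
      (* The state at stage N + n: a closed, stage-saturated box around (x0, y0) inside W. *)
      define inv where "inv n CD \<longleftrightarrow>
          closedin X (fst CD) \<and> fst CD \<subseteq> F (N + n) \<and> S (N + n) `` fst CD \<subseteq> fst CD \<and>
          closedin Y (snd CD) \<and> snd CD \<subseteq> G (N + n) \<and> T (N + n) `` snd CD \<subseteq> snd CD \<and>
          x0 \<in> fst CD \<and> y0 \<in> snd CD \<and> fst CD \<times> snd CD \<subseteq> W" for n CD
      define grows where "grows CD CD' \<longleftrightarrow>
          (\<exists>A B. openin X A \<and> fst CD \<subseteq> A \<and> A \<subseteq> fst CD' \<and>
                 openin Y B \<and> snd CD \<subseteq> B \<and> B \<subseteq> snd CD')" for CD CD'
      have "\<exists>f. \<forall>n. inv n (f n) \<and> grows (f n) (f (Suc n))"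
      proof (rule dependent_nat_choice)
        let ?C = "S N `` {x0}" and ?D = "T N `` {y0}"
        have W0: "(x0, y0) \<in> W"
          using x0 y0 ab by (simp add: W_def)
        have "?C \<subseteq> P `` {x0}" "?D \<subseteq> Q `` {y0}"
          by (auto simp: P_def Q_def)
        then have "?C \<times> ?D \<subseteq> W"
          using sat[of "{x0}" "{y0}"] W0 by blast
        moreover have "closedin X {x0}" "closedin Y {y0}"
          using x0 y0 X.Hausdorff Y.Hausdorff by (simp_all add: closedin_Hausdorff_singleton)
        then have "closedin X ?C" "closedin Y ?D"
          using N X.closed_saturation Y.closed_saturation by auto
        moreover have "x0 \<in> ?C" "y0 \<in> ?D"
          using N X.equiv_piece Y.equiv_piece by (simp_all add: equiv_def refl_on_def)
        moreover have "S N `` ?C \<subseteq> ?C" "T N `` ?D \<subseteq> ?D"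
          using X.equiv_piece[of N] Y.equiv_piece[of N] by (auto simp: equiv_def dest: transD)
        moreover have "?C \<subseteq> F N" "?D \<subseteq> G N"
          using X.S_subset Y.S_subset by auto
        ultimately show "\<exists>CD. inv 0 CD"
          by (intro exI[of _ "(?C, ?D)"]) (auto simp: inv_def)
      next
        fix CD n assume inv: "inv n CD"
        obtain C D where CD: "CD = (C, D)" by (cases CD)
        have "compactin X C" "compactin Y D"
          using inv CD closed_compactin[OF X.compact_piece] closed_compactin[OF Y.compact_piece]
          by (auto simp: inv_def)
        moreover have "C \<times> D \<subseteq> W"
          using inv CD by (simp add: inv_def)
        (* Tube lemma: a box of compact sets inside an open set W has an open box around it inside W. *)
        ultimately obtain U U' where U: "openin X U" "openin Y U'" "C \<subseteq> U" "D \<subseteq> U'" "U \<times> U' \<subseteq> W"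
          using Wallace_theorem_prod_topology[of X C Y D W] W unfolding W_def[symmetric] by blast
        obtain A C' where A: "openin X A" "C \<subseteq> A" "A \<subseteq> C'" "closedin X C'" "C' \<subseteq> F (Suc (N + n))"
            "S (Suc (N + n)) `` C' \<subseteq> C'" "C' \<subseteq> P `` U"
          using X.enlarge[of C "N + n" U] U inv CD unfolding P_def by (auto simp: inv_def)
        obtain B D' where B: "openin Y B" "D \<subseteq> B" "B \<subseteq> D'" "closedin Y D'" "D' \<subseteq> G (Suc (N + n))"
            "T (Suc (N + n)) `` D' \<subseteq> D'" "D' \<subseteq> Q `` U'"
          using Y.enlarge[of D "N + n" U'] U inv CD unfolding Q_def by (auto simp: inv_def)
        have "C' \<times> D' \<subseteq> W"
          using sat[OF U(5)] A B by blast
        moreover have "x0 \<in> C'" "y0 \<in> D'"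
          using inv CD A B by (auto simp: inv_def)
        ultimately have "inv (Suc n) (C', D') \<and> grows CD (C', D')"
          using A B CD by (auto simp: inv_def grows_def)
        then show "\<exists>CD'. inv (Suc n) CD' \<and> grows CD CD'" ..
      qed
      then obtain f where f: "\<And>n. inv n (f n)" "\<And>n. grows (f n) (f (Suc n))"
        by blast
      define C where "C n = fst (f n)" for n
      define D where "D n = snd (f n)" for n
      obtain A B where AB: "\<And>n. openin X (A n) \<and> C n \<subseteq> A n \<and> A n \<subseteq> C (Suc n) \<and>
                 openin Y (B n) \<and> D n \<subseteq> B n \<and> B n \<subseteq> D (Suc n)"
        using f(2) unfolding grows_def C_def D_def by metis
      have C: "C n \<subseteq> C (Suc n)" and D: "D n \<subseteq> D (Suc n)" for n
        using AB by blast+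
      have "(\<Union>n. C n) = (\<Union>n. A n)" "(\<Union>n. D n) = (\<Union>n. B n)"
        using AB by blast+
      moreover have "openin X (\<Union>n. A n)" "openin Y (\<Union>n. B n)"
        using AB by blast+
      ultimately have "openin X (\<Union>n. C n)" "openin Y (\<Union>n. D n)"
        by simp_all
      moreover have "P `` (\<Union>n. C n) \<subseteq> (\<Union>n. C n)"
        unfolding P_def using f(1) C by (intro X.saturated_UN[where N = N]) (auto simp: inv_def C_def)
      moreover have "Q `` (\<Union>n. D n) \<subseteq> (\<Union>n. D n)"
        unfolding Q_def using f(1) D by (intro Y.saturated_UN[where N = N]) (auto simp: inv_def D_def)
      ultimately have "openin (quotient_topology X P) ((\<lambda>x. P `` {x}) ` (\<Union>n. C n))"
          "openin (quotient_topology Y Q) ((\<lambda>y. Q `` {y}) ` (\<Union>n. D n))"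
        unfolding P_def Q_def by (intro X.openin_quotient_image Y.openin_quotient_image; simp)+
      moreover have "x0 \<in> (\<Union>n. C n)" "y0 \<in> (\<Union>n. D n)"
        using f(1)[of 0] by (auto simp: inv_def C_def D_def)
      moreover have "(\<Union>n. C n) \<times> (\<Union>n. D n) \<subseteq> W"
      proof clarify
        fix x y i j assume "x \<in> C i" "y \<in> D j"
        moreover have "C i \<subseteq> C (i + j)" "D j \<subseteq> D (i + j)"
          using lift_Suc_mono_le[of C i "i + j"] lift_Suc_mono_le[of D j "i + j"] C D by simp_all
        ultimately show "(x, y) \<in> W"
          using f(1)[of "i + j"] by (auto simp: inv_def C_def D_def)
      qed
      then have "(\<lambda>x. P `` {x}) ` (\<Union>n. C n) \<times> (\<lambda>y. Q `` {y}) ` (\<Union>n. D n) \<subseteq> V"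
        by (force simp: W_def)
      ultimately show ?thesis
        using x0 y0 by blast
    qed
    then show ?thesis
      unfolding openin_prod_topology_alt by blast
  qed
  show ?thesis
    unfolding quotient_map_def
  proof (intro conjI allI impI iffI)
    fix V assume "V \<subseteq> topspace ?K" "openin ?K V"
    then show "openin (prod_topology X Y) {z \<in> topspace (prod_topology X Y). ?f z \<in> V}"
      using cont openin_continuous_map_preimage by blast
  qed (use onto op in auto)
qed

section \<open>Binary trees and the preorder numbering\<close>

lemma binary_Leaf [simp]: "binary Leaf"
proof -
  have "subtree_at Leaf p \<noteq> Some (Node ts)" for p ts
    by (cases p) auto
  then show ?thesis
    by (simp add: binary_def)
qed

text \<open>
  This turns the description of binary trees by addresses into one by recursion; everything below
  is proved by the resulting induction.
\<close>

lemma binary_Node: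
  "binary (Node ts) \<longleftrightarrow> length ts \<in> {0, 2} \<and> (\<forall>k<length ts. binary (ts ! k))"
proof
  assume b: "binary (Node ts)"
  have "binary (ts ! k)" if "k < length ts" for k
    unfolding binary_def
  proof (intro allI impI)
    fix p us assume "subtree_at (ts ! k) p = Some (Node us)"
    then have "subtree_at (Node ts) (k # p) = Some (Node us)"
      using that by simp
    then show "Suc (length us) \<in> {1, 3}"
      using b unfolding binary_def by blast
  qed
  moreover have "subtree_at (Node ts) [] = Some (Node ts)"
    by simp
  then have "Suc (length ts) \<in> {1, 3}"
    using b unfolding binary_def by blast
  ultimately show "length ts \<in> {0, 2} \<and> (\<forall>k<length ts. binary (ts ! k))"
    by auto
next
  assume b: "length ts \<in> {0, 2} \<and> (\<forall>k<length ts. binary (ts ! k))"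
  show "binary (Node ts)"
    unfolding binary_def
  proof (intro allI impI)
    fix p us assume p: "subtree_at (Node ts) p = Some (Node us)"
    show "Suc (length us) \<in> {1, 3}"
    proof (cases p)
      case Nil
      then show ?thesis
        using p b by auto
    next
      case (Cons k p')
      then have "k < length ts" "subtree_at (ts ! k) p' = Some (Node us)"
        using p by (auto split: if_splits)
      then show ?thesis
        using b unfolding binary_def by blast
    qed
  qed
qed

lemma binary_cork [simp]: "binary (Node [])"
  by (simp add: binary_Node)

lemma binary_fork [simp]: "binary (Node [l, r]) \<longleftrightarrow> binary l \<and> binary r"
  by (auto simp: binary_Node nth_Cons' less_Suc_eq)

lemma binary_cases:
  assumes "binary t"
  obtains (Leaf) "t = Leaf" | (cork) "t = Node []"
    | (fork) l r where "t = Node [l, r]" "binary l" "binary r"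
proof (cases t)
  case (Node ts)
  then consider "ts = []" | "length ts = 2"
    using assms by (auto simp: binary_Node)
  then show thesis
  proof cases
    case 2
    then obtain l r where "ts = [l, r]"
      by (metis (no_types, opaque_lifting) One_nat_def Suc_1 Suc_length_conv length_0_conv)
    then show thesis
      using Node assms fork by auto
  qed (use Node cork in auto)
qed (use that in auto)

lemma binary_induct [consumes 1, case_names Leaf cork fork]:
  assumes "binary t" and "P Leaf" and "P (Node [])"
    and "\<And>l r. \<lbrakk>binary l; binary r; P l; P r\<rbrakk> \<Longrightarrow> P (Node [l, r])"
  shows "P t"
  using assms(1)
proof (induction t)
  case (Node ts)
  from Node.prems show ?case
  proof (cases rule: binary_cases)
    case (fork l r)
    then show ?thesis
      using Node.IH assms(4) by auto
  qed (use assms in auto)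
qed (use assms in auto)

lemma subtree_at_fork [simp]:
  "subtree_at (Node [l, r]) (k # p) =
     (if k = 0 then subtree_at l p else if k = 1 then subtree_at r p else None)"
  by (auto simp: nth_Cons' less_Suc_eq)

lemma subtree_at_cork [simp]: "subtree_at (Node []) (k # p) = None"
  by simp

text \<open>
  For binary trees the two equations above are preferable: the general one leaves list indexing
  behind.
\<close>

declare subtree_at.simps(3) [simp del]

lemma replace_at_fork [simp]:
  "replace_at (Node [l, r]) (0 # p) s = Node [replace_at l p s, r]"
  "replace_at (Node [l, r]) (Suc 0 # p) s = Node [l, replace_at r p s]"
  by auto

lemma subtree_at_append:
  "subtree_at t p = Some s \<Longrightarrow> subtree_at t (p @ q) = subtree_at s q"
  by (induction t p rule: subtree_at.induct) (auto simp: subtree_at.simps split: if_splits)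

lemma binary_subtree_at:
  assumes "binary t" and "subtree_at t p = Some s"
  shows "binary s"
  unfolding binary_def using assms subtree_at_append unfolding binary_def by metis

lemma binary_replace_at:
  assumes "binary t" and "binary s" and "subtree_at t p \<noteq> None"
  shows "binary (replace_at t p s)"
  using assms(1,3)
proof (induction t arbitrary: p rule: binary_induct)
  case Leaf
  then show ?case using assms(2) by (cases p) auto
next
  case cork
  then show ?case using assms(2) by (cases p) auto
next
  case (fork l r)
  then show ?case using assms(2) by (cases p) (auto split: if_splits)
qed

definition nodes :: "ptree \<Rightarrow> nat list set" where
  "nodes t = {p. \<exists>ts. subtree_at t p = Some (Node ts)}"

lemma inner_edges_eq: "inner_edges t = nodes t - {[]}"
  by (auto simp: inner_edges_def nodes_def)

lemma nodes_Leaf [simp]: "nodes Leaf = {}"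
  and nodes_cork [simp]: "nodes (Node []) = {[]}"
  and leaves_Leaf [simp]: "leaves Leaf = {[]}"
  and leaves_cork [simp]: "leaves (Node []) = {}"
  and corks_Leaf [simp]: "corks Leaf = {}"
  and corks_cork [simp]: "corks (Node []) = {[]}"
proof -
  have "subtree_at Leaf p = Some s \<longleftrightarrow> p = [] \<and> s = Leaf"
       "subtree_at (Node []) p = Some s \<longleftrightarrow> p = [] \<and> s = Node []" for p s
    by (cases p; auto)+
  then show "nodes Leaf = {}" "nodes (Node []) = {[]}" "leaves Leaf = {[]}" "leaves (Node []) = {}"
    "corks Leaf = {}" "corks (Node []) = {[]}"
    by (simp_all add: nodes_def leaves_def corks_def)
qed

lemma nodes_fork [simp]:
  "nodes (Node [l, r]) = insert [] ((#) 0 ` nodes l \<union> (#) 1 ` nodes r)"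
  and leaves_fork [simp]:
  "leaves (Node [l, r]) = (#) 0 ` leaves l \<union> (#) 1 ` leaves r"
  and corks_fork [simp]:
  "corks (Node [l, r]) = (#) 0 ` corks l \<union> (#) 1 ` corks r"
proof -
  have eq: "p \<in> (#) k ` A \<longleftrightarrow> (\<exists>q. p = k # q \<and> q \<in> A)" for p k and A :: "nat list set"
    by auto
  show "nodes (Node [l, r]) = insert [] ((#) 0 ` nodes l \<union> (#) 1 ` nodes r)"
    by (rule set_eqI, rename_tac p, case_tac p) (auto simp: nodes_def eq split: if_splits)
  show "leaves (Node [l, r]) = (#) 0 ` leaves l \<union> (#) 1 ` leaves r"
    by (rule set_eqI, rename_tac p, case_tac p) (auto simp: leaves_def eq split: if_splits)
  show "corks (Node [l, r]) = (#) 0 ` corks l \<union> (#) 1 ` corks r"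
    by (rule set_eqI, rename_tac p, case_tac p) (auto simp: corks_def eq split: if_splits)
qed

lemma finite_nodes [simp]: "binary t \<Longrightarrow> finite (nodes t)"
  and finite_leaves [simp]: "binary t \<Longrightarrow> finite (leaves t)"
  and finite_corks [simp]: "binary t \<Longrightarrow> finite (corks t)"
  by (induction t rule: binary_induct; simp)+

definition size_nodes :: "ptree \<Rightarrow> nat" where
  "size_nodes t = card (nodes t)"

lemma card_Un_Cons:
  assumes "finite A" "finite B"
  shows "card ((#) (0::nat) ` A \<union> (#) (Suc 0) ` B) = card A + card B"
  using assms by (subst card_Un_disjoint) (auto simp: card_image)

lemma size_nodes_simps [simp]:
  "size_nodes Leaf = 0"
  "size_nodes (Node []) = 1"
  "\<lbrakk>binary l; binary r\<rbrakk> \<Longrightarrow> size_nodes (Node [l, r]) = Suc (size_nodes l + size_nodes r)"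
  by (auto simp: size_nodes_def card_Un_Cons card_insert_if)

lemma card_leaves_fork [simp]:
  "\<lbrakk>binary l; binary r\<rbrakk> \<Longrightarrow> card (leaves (Node [l, r])) = card (leaves l) + card (leaves r)"
  and card_corks_fork [simp]:
  "\<lbrakk>binary l; binary r\<rbrakk> \<Longrightarrow> card (corks (Node [l, r])) = card (corks l) + card (corks r)"
  by (auto simp: card_Un_Cons)

text \<open>
  The Euler characteristic count that makes \<open>2m + n - 2\<close> the number of inner edges.
\<close>

lemma size_nodes_corks_leaves:
  "binary t \<Longrightarrow> 2 * card (corks t) + card (leaves t) = Suc (size_nodes t)"
  by (induction t rule: binary_induct) (simp_all del: leaves_fork corks_fork)

lemma dim_cell_eq: "binary t \<Longrightarrow> dim_cell t = size_nodes t - 1"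
  using size_nodes_corks_leaves[of t] by (simp add: dim_cell_def)

text \<open>
  The position, from 0, of an address in the preorder traversal of the inner vertices. As the
  path order is the preorder, this is the number of an inner edge; the top vertex of the root edge
  takes the number 0. Addresses outside the tree get the arbitrary value 0.
\<close>

fun pos :: "ptree \<Rightarrow> nat list \<Rightarrow> nat" where
  "pos (Node [l, r]) (k # p) =
     (if k = 0 then Suc (pos l p) else Suc (size_nodes l + pos r p))"
| "pos _ _ = 0"

lemma pos_Nil [simp]: "pos t [] = 0"
  by (cases "(t, []::nat list)" rule: pos.cases) auto

text \<open>
  The link between counting in the path order and the recursion over the tree.
\<close>

lemma pos_eq_card:
  "\<lbrakk>binary t; subtree_at t p \<noteq> None\<rbrakk> \<Longrightarrow> pos t p = card {b \<in> nodes t. b < p}"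
proof (induction t arbitrary: p rule: binary_induct)
  case Leaf
  then show ?case by (cases p) auto
next
  case cork
  then show ?case by (cases p) auto
next
  case (fork l r)
  show ?case
  proof (cases p)
    case (Cons k p')
    from fork.prems Cons consider "k = 0" "subtree_at l p' \<noteq> None" | "k = 1" "subtree_at r p' \<noteq> None"
      by (auto split: if_splits)
    then show ?thesis
    proof cases
      case 1
      have "{b \<in> nodes (Node [l, r]). b < p} = insert [] ((#) 0 ` {b \<in> nodes l. b < p'})"
        using Cons 1 by auto
      then show ?thesis
        using fork Cons 1 by (simp add: card_insert_if card_image image_iff)
    next
      case 2
      have "{b \<in> nodes (Node [l, r]). b < p} =
              insert [] ((#) 0 ` nodes l \<union> (#) 1 ` {b \<in> nodes r. b < p'})"
        using Cons 2 by auto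
      then show ?thesis
        using fork Cons 2 by (simp add: card_insert_if image_iff card_Un_Cons size_nodes_def)
    qed
  qed auto
qed

lemma nodes_nonempty: "nodes t \<noteq> {} \<Longrightarrow> [] \<in> nodes t"
  by (cases t) (simp_all add: nodes_Leaf, simp add: nodes_def)

lemma number_in_inner_edges:
  assumes "binary t" and "p \<in> inner_edges t"
  shows "number_in (inner_edges t) p = pos t p"
proof -
  have p: "p \<in> nodes t" "p \<noteq> []" and ne: "[] \<in> nodes t"
    using assms nodes_nonempty by (auto simp: inner_edges_eq)
  have "{b \<in> inner_edges t. b \<le> p} = insert p ({b \<in> nodes t. b < p} - {[]})"
    using p by (auto simp: inner_edges_eq)
  then have "number_in (inner_edges t) p = Suc (card ({b \<in> nodes t. b < p} - {[]}))"
    using assms(1) by (simp add: number_in_def card_insert_if)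
  also have "\<dots> = card {b \<in> nodes t. b < p}"
  proof (rule card_Suc_Diff1)
    show "[] \<in> {b \<in> nodes t. b < p}"
      using ne p by (cases p) auto
  qed (use assms(1) in simp)
  also have "\<dots> = pos t p"
    using assms(1) p by (subst pos_eq_card) (auto simp: nodes_def)
  finally show ?thesis .
qed

lemma pos_subtree_le:
  "\<lbrakk>binary t; subtree_at t p = Some s\<rbrakk> \<Longrightarrow> pos t p + size_nodes s \<le> size_nodes t"
proof (induction t arbitrary: p rule: binary_induct)
  case (fork l r)
  then show ?case
    by (cases p) (fastforce split: if_splits)+
next
  case Leaf
  then show ?case by (cases p) auto
next
  case cork
  then show ?case by (cases p) auto
qed

lemma pos_less: "\<lbrakk>binary t; p \<in> nodes t\<rbrakk> \<Longrightarrow> pos t p < size_nodes t"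
  unfolding nodes_def using pos_subtree_le binary_subtree_at
  by (fastforce elim: binary_cases)

lemma pos_positive: "\<lbrakk>binary t; p \<in> inner_edges t\<rbrakk> \<Longrightarrow> 0 < pos t p"
  by (erule binary_cases; cases p) (auto simp: inner_edges_eq)

lemma card_inner_edges: "binary t \<Longrightarrow> card (inner_edges t) = dim_cell t"
  using nodes_nonempty[of t]
  by (cases "nodes t = {}") (simp_all add: dim_cell_eq inner_edges_eq size_nodes_def)

lemma nth_of_number_in:
  fixes A :: "'a::linorder set"
  assumes "finite A" "a \<in> A"
  shows "nth_of A (number_in A a) = a" "number_in A a \<in> {1..card A}"
proof -
  let ?xs = "sorted_list_of_set A"
  obtain i where i: "i < length ?xs" "?xs ! i = a"
    using assms by (metis in_set_conv_nth set_sorted_list_of_set)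
  have d: "distinct ?xs" "sorted_wrt (<) ?xs"
    by simp_all
  have "{b \<in> A. b \<le> a} = (\<lambda>k. ?xs ! k) ` {..i}"
  proof (intro equalityI subsetI)
    fix b assume "b \<in> {b \<in> A. b \<le> a}"
    then obtain k where k: "k < length ?xs" "?xs ! k = b" "b \<le> a"
      using assms(1) by (metis (no_types, lifting) in_set_conv_nth mem_Collect_eq set_sorted_list_of_set)
    then have "k \<le> i"
      using i d(2) sorted_wrt_nth_less[OF d(2), of i k] by (metis leD leI)
    then show "b \<in> (\<lambda>k. ?xs ! k) ` {..i}"
      using k by auto
  next
    fix b assume "b \<in> (\<lambda>k. ?xs ! k) ` {..i}"
    then obtain k where k: "k \<le> i" "b = ?xs ! k"
      by auto
    then have "b \<in> set ?xs" "b \<le> a"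
      using i sorted_nth_mono[OF sorted_sorted_list_of_set, of k i A] by auto
    then show "b \<in> {b \<in> A. b \<le> a}"
      using assms(1) by simp
  qed
  moreover have "inj_on (\<lambda>k. ?xs ! k) {..i}"
    using i d(1) by (auto intro!: inj_onI simp: nth_eq_iff_index_eq)
  ultimately have n: "number_in A a = Suc i"
    by (simp add: number_in_def card_image)
  show "nth_of A (number_in A a) = a"
    using i n by (simp add: nth_of_def)
  show "number_in A a \<in> {1..card A}"
    using i n assms by simp
qed

section \<open>The leaves in path order and grafting\<close>

lemma sorted_leaves_fork:
  assumes "binary l" "binary r"
  shows "sorted_list_of_set (leaves (Node [l, r])) =
    map ((#) 0) (sorted_list_of_set (leaves l)) @ map ((#) 1) (sorted_list_of_set (leaves r))"
    (is "_ = ?xs")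
proof -
  have "sorted (map ((#) k) (sorted_list_of_set A))" for k and A :: "nat list set"
    by (simp add: sorted_map)
  then have "sorted ?xs"
    using assms by (auto simp: sorted_append)
  moreover have "distinct ?xs"
    using assms by (auto simp: distinct_map)
  moreover have "set ?xs = leaves (Node [l, r])"
    using assms by simp
  ultimately show ?thesis
    by (metis sorted_list_of_set.idem_if_sorted_distinct)
qed

lemma nth_leaf_fork:
  assumes "binary l" "binary r" "1 \<le> j" "j \<le> card (leaves l) + card (leaves r)"
  shows "nth_of (leaves (Node [l, r])) j =
    (if j \<le> card (leaves l) then 0 # nth_of (leaves l) j
     else Suc 0 # nth_of (leaves r) (j - card (leaves l)))"
  unfolding nth_of_def sorted_leaves_fork[OF assms(1,2)]
  using assms by (auto simp: nth_append)

lemma nth_leaf_Leaf [simp]: "nth_of {[]} (Suc 0) = []"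
  by (simp add: nth_of_def)

lemma nth_leaf_in_leaves:
  assumes "binary t" "1 \<le> j" "j \<le> card (leaves t)"
  shows "nth_of (leaves t) j \<in> leaves t"
  using assms nth_mem[of "j - 1" "sorted_list_of_set (leaves t)"] by (simp add: nth_of_def)

lemma graft_Leaf [simp]: "graft Leaf (Suc 0) s = s"
  by (simp add: graft_def)

lemma graft_fork:
  assumes "binary l" "binary r" "1 \<le> j" "j \<le> card (leaves l) + card (leaves r)"
  shows "graft (Node [l, r]) j s =
    (if j \<le> card (leaves l) then Node [graft l j s, r]
     else Node [l, graft r (j - card (leaves l)) s])"
  unfolding graft_def nth_leaf_fork[OF assms] by simp

text \<open>
  The new edge of the grafting has the address of the leaf, and its preorder position is the one
  that the leaf had, because nothing is inserted before it.
\<close>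

lemma graft_props:
  assumes "binary t" "binary s" "1 \<le> j" "j \<le> card (leaves t)"
  shows "binary (graft t j s)" (is ?A)
    and "card (leaves (graft t j s)) = card (leaves t) + card (leaves s) - 1" (is ?B)
    and "size_nodes (graft t j s) = size_nodes t + size_nodes s" (is ?C)
    and "pos (graft t j s) (nth_of (leaves t) j) = pos t (nth_of (leaves t) j)" (is ?D)
    and "nth_of (leaves t) j \<in> nodes (graft t j s) \<longleftrightarrow> s \<noteq> Leaf" (is ?E)
proof -
  have "?A \<and> ?B \<and> ?C \<and> ?D \<and> ?E"
    using assms(1,3,4)
  proof (induction t arbitrary: j rule: binary_induct)
    case Leaf
    then have "j = Suc 0" by simp
    moreover have "s \<noteq> Leaf \<Longrightarrow> [] \<in> nodes s"
      by (cases s) (auto simp: nodes_def)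
    ultimately show ?case using assms(2) by auto
  next
    case cork
    then show ?case by simp
  next
    case (fork l r)
    have j: "1 \<le> j" "j \<le> card (leaves l) + card (leaves r)"
      using fork.prems fork.hyps by (simp_all del: leaves_fork)
    show ?case
    proof (cases "j \<le> card (leaves l)")
      case True
      then show ?thesis
        using fork.IH(1)[of j] fork.hyps j
        by (auto simp: graft_fork nth_leaf_fork simp del: leaves_fork)
    next
      case False
      then have j': "1 \<le> j - card (leaves l)" "j - card (leaves l) \<le> card (leaves r)"
        using j by auto
      with False show ?thesis
        using fork.IH(2)[OF j'] fork.hyps j
        by (auto simp: graft_fork nth_leaf_fork add.assoc simp del: leaves_fork)
    qed
  qed
  then show ?A ?B ?C ?D ?E by blast+
qed

section \<open>Labelled trees\<close>

text \<open>
  A binary tree with a label on every edge whose top vertex is inner; the label sits at that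
  vertex. This includes the root edge, but no leaf edge.
\<close>

datatype 'a ltree = LLeaf | LCork 'a | LFork 'a "'a ltree" "'a ltree"

fun labelled :: "ptree \<Rightarrow> (nat list \<Rightarrow> 'a) \<Rightarrow> 'a ltree" where
  "labelled Leaf F = LLeaf"
| "labelled (Node [l, r]) F =
     LFork (F []) (labelled l (\<lambda>p. F (0 # p))) (labelled r (\<lambda>p. F (1 # p)))"
| "labelled (Node _) F = LCork (F [])"

text \<open>
  The labels are read off from a sequence in preorder, starting at \<open>k\<close>. In this form inserting
  coordinates into a cube becomes a shift of indices, which suits faces, rotations and grafting,
  whereas \<open>labelled\<close> suits the removal of corks, whose effect is given by addresses.
\<close>

fun numbered :: "ptree \<Rightarrow> (nat \<Rightarrow> 'a) \<Rightarrow> nat \<Rightarrow> 'a ltree" where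
  "numbered Leaf x k = LLeaf"
| "numbered (Node [l, r]) x k =
     LFork (x k) (numbered l x (Suc k)) (numbered r x (Suc (k + size_nodes l)))"
| "numbered (Node _) x k = LCork (x k)"

text \<open>
  The value 1 on the root edge is what makes grafting a substitution and the merging of labels at
  the root a maximum.
\<close>

fun encode :: "ptree \<times> (nat \<Rightarrow> real) \<Rightarrow> real ltree" where
  "encode (t, x) = labelled t (\<lambda>p. if p = [] then 1 else label t x p)"

declare encode.simps [simp del]

fun leaf_count :: "'a ltree \<Rightarrow> nat" where
  "leaf_count LLeaf = 1"
| "leaf_count (LCork a) = 0"
| "leaf_count (LFork a l r) = leaf_count l + leaf_count r"

fun lgraft :: "'a ltree \<Rightarrow> nat \<Rightarrow> 'a ltree \<Rightarrow> 'a ltree" where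
  "lgraft LLeaf j s = s"
| "lgraft (LCork a) j s = LCork a"
| "lgraft (LFork a l r) j s =
     (if j \<le> leaf_count l then LFork a (lgraft l j s) r
      else LFork a l (lgraft r (j - leaf_count l) s))"

lemma size_nodes_pos: "\<lbrakk>binary t; t \<noteq> Leaf\<rbrakk> \<Longrightarrow> 0 < size_nodes t"
  by (erule binary_cases) simp_all

lemma labelled_cong:
  "\<lbrakk>binary t; \<And>p. p \<in> nodes t \<Longrightarrow> F p = G p\<rbrakk> \<Longrightarrow> labelled t F = labelled t G"
proof (induction t arbitrary: F G rule: binary_induct)
  case (fork l r)
  have "labelled l (\<lambda>p. F (0 # p)) = labelled l (\<lambda>p. G (0 # p))"
       "labelled r (\<lambda>p. F (1 # p)) = labelled r (\<lambda>p. G (1 # p))"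
    by (intro fork.IH fork.prems; simp)+
  then show ?case
    using fork.prems[of "[]"] by simp
qed auto

lemma numbered_cong:
  "\<lbrakk>binary t; \<And>i. \<lbrakk>k \<le> i; i < k + size_nodes t\<rbrakk> \<Longrightarrow> x i = y i\<rbrakk> \<Longrightarrow> numbered t x k = numbered t y k"
  by (induction t arbitrary: k rule: binary_induct) simp_all

text \<open>
  Hence a point of a cell can be recovered from its labelled tree.
\<close>

lemma numbered_inj:
  "\<lbrakk>binary t; binary s; numbered t x k = numbered s y k\<rbrakk>
     \<Longrightarrow> t = s \<and> (\<forall>i. k \<le> i \<and> i < k + size_nodes t \<longrightarrow> x i = y i)"
proof (induction t arbitrary: s k rule: binary_induct)
  case Leaf
  from Leaf(1) show ?case
    using Leaf(2) by (cases rule: binary_cases) auto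
next
  case cork
  from cork(1) show ?case
    using cork(2) by (cases rule: binary_cases) (auto simp: less_Suc_eq)
next
  case (fork l r)
  from fork.prems(1) show ?case
  proof (cases rule: binary_cases)
    case s: (fork l' r')
    have l: "l = l' \<and> (\<forall>i. Suc k \<le> i \<and> i < Suc k + size_nodes l \<longrightarrow> x i = y i)"
      using fork.prems s by (intro fork.IH) auto
    then have r: "r = r' \<and> (\<forall>i. Suc (k + size_nodes l) \<le> i \<and>
                 i < Suc (k + size_nodes l) + size_nodes r \<longrightarrow> x i = y i)"
      using fork.prems s by (intro fork.IH) auto
    have "x i = y i" if i: "k \<le> i" "i < k + size_nodes (Node [l, r])" for i
    proof -
      consider "i = k" | "Suc k \<le> i" "i < Suc k + size_nodes l"
        | "Suc (k + size_nodes l) \<le> i" "i < Suc (k + size_nodes l) + size_nodes r"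
        using i unfolding size_nodes_simps(3)[OF fork.hyps] by linarith
      then show ?thesis
        using l r fork.prems(2) s(1) by cases auto
    qed
    then show ?thesis
      using l r s by simp
  qed (use fork.prems in auto)
qed

lemma labelled_pos:
  "binary t \<Longrightarrow> labelled t (\<lambda>p. x (k + pos t p)) = numbered t x k"
proof (induction t arbitrary: k rule: binary_induct)
  case (fork l r)
  then show ?case
    using fork.IH(1)[of "Suc k"] fork.IH(2)[of "Suc (k + size_nodes l)"] by (simp add: add.assoc)
qed simp_all

lemma numbered_shift:
  "binary t \<Longrightarrow> numbered t x (k + b) = numbered t (\<lambda>i. x (i + b)) k"
proof (induction t arbitrary: k rule: binary_induct)
  case (fork l r)
  then show ?case
    using fork.IH(1)[of "Suc k"] fork.IH(2)[of "Suc (k + size_nodes l)"] by (simp add: add_ac)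
qed simp_all

lemma label_eq: "\<lbrakk>binary t; p \<in> inner_edges t\<rbrakk> \<Longrightarrow> label t x p = x (pos t p)"
  by (simp add: label_def number_in_inner_edges)

lemma encode_numbered:
  assumes "binary t"
  shows "encode (t, x) = numbered t (x(0 := 1)) 0"
proof -
  have "encode (t, x) = labelled t (\<lambda>p. (x(0 := 1)) (0 + pos t p))"
    unfolding encode.simps
  proof (rule labelled_cong[OF assms])
    fix p assume "p \<in> nodes t"
    then show "(if p = [] then 1 else label t x p) = (x(0 := 1)) (0 + pos t p)"
      using pos_positive[OF assms, of p] label_eq[OF assms, of p x] by (auto simp: inner_edges_eq)
  qed
  then show ?thesis
    using labelled_pos[OF assms] by metis
qed

text \<open>
  The union of all \<open>cells n\<close>, convenient where the number of leaves does not matter.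
\<close>

definition cell_points :: "(ptree \<times> (nat \<Rightarrow> real)) set" where
  "cell_points = {(t, x). binary t \<and> x \<in> topspace (cube (dim_cell t))}"

lemma topspace_cube: "topspace (cube n) = ({1..n} \<rightarrow>\<^sub>E {0..1})"
  by (simp add: cube_def)

lemma topspace_cells: "topspace (cells n) = {(t, x) \<in> cell_points. card (leaves t) = n}"
  by (auto simp: cells_def cell_points_def)

lemma encode_inj:
  assumes "(t, x) \<in> cell_points" "(s, y) \<in> cell_points" "encode (t, x) = encode (s, y)"
  shows "(t, x) = (s, y)"
proof -
  have t: "binary t" "binary s" and x: "x \<in> {1..dim_cell t} \<rightarrow>\<^sub>E {0..1}" "y \<in> {1..dim_cell s} \<rightarrow>\<^sub>E {0..1}"
    using assms by (auto simp: cell_points_def topspace_cube)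
  have eq: "t = s" and xy: "\<And>i. i < size_nodes t \<Longrightarrow> (x(0 := 1)) i = (y(0 := 1)) i"
    using numbered_inj[OF t, of "x(0 := 1)" 0 "y(0 := 1)"] assms(3)
    unfolding encode_numbered[OF t(1)] encode_numbered[OF t(2)] by auto
  have "x i = y i" if "i \<in> {1..dim_cell t}" for i
    using xy[of i] that t by (auto simp: dim_cell_eq split: if_splits)
  then have "x = y"
    using PiE_ext[OF x(1), of y] x(2) eq by blast
  with eq show ?thesis by simp
qed

lemma leaf_count_numbered: "binary t \<Longrightarrow> leaf_count (numbered t x k) = card (leaves t)"
  by (induction t arbitrary: k rule: binary_induct) (simp_all del: leaves_fork)

lemma leaf_count_encode: "binary t \<Longrightarrow> leaf_count (encode (t, x)) = card (leaves t)"
  by (simp add: encode_numbered leaf_count_numbered)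

lemma set_labelled: "binary t \<Longrightarrow> set_ltree (labelled t F) = F ` nodes t"
  by (induction t arbitrary: F rule: binary_induct) (auto simp: image_image)

lemma encode_unit_interval:
  assumes "a \<in> cell_points"
  shows "set_ltree (encode a) \<subseteq> {0..1}"
proof -
  obtain t x where a: "a = (t, x)" by (cases a)
  have t: "binary t" and x: "x \<in> {1..dim_cell t} \<rightarrow>\<^sub>E {0..1}"
    using assms a by (auto simp: cell_points_def topspace_cube)
  have "label t x p \<in> {0..1}" if "p \<in> nodes t" "p \<noteq> []" for p
  proof -
    have "pos t p \<in> {1..dim_cell t}"
      using that pos_positive[OF t, of p] pos_less[OF t, of p] t by (auto simp: inner_edges_eq dim_cell_eq)
    then show ?thesis
      using that t x by (auto simp: label_eq inner_edges_eq PiE_iff)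
  qed
  then show ?thesis
    using a t by (auto simp: set_labelled encode.simps)
qed

section \<open>Grafting of labelled trees\<close>

text \<open>
  What grafting needs of the upper tree: its root edge becomes the new edge, to be labelled 1.
\<close>

definition rooted :: "real ltree \<Rightarrow> bool" where
  "rooted u \<longleftrightarrow> (case u of LLeaf \<Rightarrow> True | LCork a \<Rightarrow> a = 1 | LFork a l r \<Rightarrow> a = 1)"

lemma rooted_encode: "binary t \<Longrightarrow> rooted (encode (t, x))"
  by (erule binary_cases) (auto simp: rooted_def encode.simps)

text \<open>
  In preorder, the labels of a grafting are those of the lower tree with a block inserted at the
  position \<open>m\<close> of the leaf. The block starts with the root label of the upper tree, that is,
  with the label of the new edge.
\<close>

lemma numbered_graft:
  assumes "binary s"
  shows "\<lbrakk>binary t; 1 \<le> j; j \<le> card (leaves t); m = k + pos t (nth_of (leaves t) j)\<rbrakk> \<Longrightarrow>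
    numbered (graft t j s) z k =
      lgraft (numbered t (\<lambda>i. if i < m then z i else z (i + size_nodes s)) k) j (numbered s z m)"
proof (induction t arbitrary: j k rule: binary_induct)
  case Leaf
  then have "j = Suc 0" by simp
  then show ?case using Leaf by simp
next
  case cork
  then show ?case by simp
next
  case (fork l r)
  let ?x = "\<lambda>i. if i < m then z i else z (i + size_nodes s)"
  have j: "1 \<le> j" "j \<le> card (leaves l) + card (leaves r)"
    using fork.prems fork.hyps by (simp_all del: leaves_fork)
  have leaf: "nth_of (leaves t) j \<in> leaves t" if "binary t" "1 \<le> j" "j \<le> card (leaves t)" for t j
    using that by (rule nth_leaf_in_leaves)
  show ?case
  proof (cases "j \<le> card (leaves l)")
    case True
    have m: "m = Suc k + pos l (nth_of (leaves l) j)"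
      using fork j True by (simp add: nth_leaf_fork del: leaves_fork)
    have "pos l (nth_of (leaves l) j) + size_nodes Leaf \<le> size_nodes l"
      using leaf[of l j] True j fork.hyps by (intro pos_subtree_le) (auto simp: leaves_def)
    then have "numbered r ?x (Suc (k + size_nodes l)) =
        numbered r z (Suc (k + size_nodes l) + size_nodes s)"
      unfolding numbered_shift[OF fork.hyps(2)] using m fork.hyps by (intro numbered_cong) auto
    then show ?thesis
      using fork.IH(1)[of j "Suc k"] fork.hyps j True m assms
      by (simp add: graft_fork graft_props leaf_count_numbered add_ac del: leaves_fork)
  next
    case False
    then have j': "1 \<le> j - card (leaves l)" "j - card (leaves l) \<le> card (leaves r)"
      using j by auto
    have m: "m = Suc (k + size_nodes l) + pos r (nth_of (leaves r) (j - card (leaves l)))"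
      using fork j False by (simp add: nth_leaf_fork del: leaves_fork)
    have "numbered l ?x (Suc k) = numbered l z (Suc k)"
      using m fork.hyps by (intro numbered_cong) auto
    then show ?thesis
      using fork.IH(2)[OF j' m] fork.hyps j False m assms
      by (simp add: graft_fork leaf_count_numbered del: leaves_fork)
  qed
qed

lemma lgraft_LLeaf: "lgraft u j LLeaf = u"
  by (induction u arbitrary: j) auto

text \<open>
  In the sequence of labels of the grafting, position \<open>k\<close> holds the 1 of the new edge, which the
  encoding of the upper tree expects at its root; the \<open>\<beta>\<close> labels after it are those of the
  upper tree.
\<close>

lemma encode_graft_point:
  assumes "a \<in> cell_points" "b \<in> cell_points" "1 \<le> j" "j \<le> card (leaves (fst a))"
  shows "graft_point j a b \<in> cell_points" (is ?A)
    and "encode (graft_point j a b) = lgraft (encode a) j (encode b)" (is ?B)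
    and "card (leaves (fst (graft_point j a b))) = card (leaves (fst a)) + card (leaves (fst b)) - 1" (is ?C)
proof -
  obtain t x s y where ab: "a = (t, x)" "b = (s, y)"
    by (cases a, cases b)
  have t: "binary t" "binary s"
    and xy: "x \<in> {1..dim_cell t} \<rightarrow>\<^sub>E {0..1}" "y \<in> {1..dim_cell s} \<rightarrow>\<^sub>E {0..1}"
    using assms ab by (auto simp: cell_points_def topspace_cube)
  have j: "1 \<le> j" "j \<le> card (leaves t)"
    using assms ab by auto
  consider "t = Leaf" | "t \<noteq> Leaf" "s = Leaf" | "t \<noteq> Leaf" "s \<noteq> Leaf"
    by blast
  then have "?A \<and> ?B \<and> ?C"
  proof cases
    case 1
    then show ?thesis
      using assms ab by (simp add: encode.simps[of Leaf])
  next
    case 2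
    then show ?thesis
      using assms ab by (simp add: lgraft_LLeaf encode.simps[of Leaf])
  next
    case 3
    let ?e = "nth_of (leaves t) j"
    let ?k = "pos t ?e"
    let ?\<alpha> = "dim_cell t"
    let ?\<beta> = "dim_cell s"
    let ?g = "graft t j s"
    let ?z = "face 1 (?\<alpha> + ?\<beta> + 1) ?k (insert_cube ?\<alpha> ?\<beta> ?k x y)"
    note g = graft_props[OF t j]
    have e: "?e \<in> leaves t"
      using t j by (intro nth_leaf_in_leaves)
    have pos: "size_nodes t > 0" "size_nodes s > 0"
      using 3 t by (simp_all add: size_nodes_pos)
    have ek: "?e \<noteq> []"
      using e 3 by (auto simp: leaves_def)
    then have inner: "?e \<in> inner_edges ?g"
      using g 3 by (auto simp: inner_edges_eq)
    then have k: "number_in (inner_edges ?g) ?e = ?k" "0 < ?k"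
      using g number_in_inner_edges[OF g(1)] pos_positive[OF g(1)] by metis+
    have kle: "?k \<le> size_nodes t"
      using pos_subtree_le[OF t(1), of ?e Leaf] e by (auto simp: leaves_def)
    have dim: "dim_cell ?g = ?\<alpha> + ?\<beta> + 1" "?k \<le> ?\<alpha> + 1"
      using g pos kle t by (auto simp: dim_cell_eq)
    have gp: "graft_point j a b = (?g, ?z)"
      using 3 ab k by (simp add: Let_def)
    have xin: "x i \<in> {0..1}" if "1 \<le> i" "i \<le> ?\<alpha>" for i
      using xy that by (auto simp: PiE_iff)
    have yin: "y i \<in> {0..1}" if "1 \<le> i" "i \<le> ?\<beta>" for i
      using xy that by (auto simp: PiE_iff)
    have z: "?z l = (if l < ?k then x l else if l = ?k then 1 else if l \<le> ?k + ?\<beta> then y (l - ?k)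
        else x (l - ?\<beta> - 1))" if "l \<in> {1..?\<alpha> + ?\<beta> + 1}" for l
    proof -
      have l: "1 \<le> l" "l \<le> ?\<alpha> + ?\<beta> + 1"
        using that by auto
      consider "l < ?k" | "l = ?k" | "?k < l" "l \<le> ?k + ?\<beta>" | "?k + ?\<beta> < l"
        by linarith
      then show ?thesis
        using l dim(2) k(2)
        by cases (auto simp: face_def insert_cube_def Suc_diff_Suc)
    qed
    (* Z is the composite point; its coordinates split into those before, at, inside and after the block. *)
    define Z where "Z = ?z"
    have Z: "Z l = (if l < ?k then x l else if l = ?k then 1 else if l \<le> ?k + ?\<beta> then y (l - ?k)
        else x (l - ?\<beta> - 1))" if "1 \<le> l" "l \<le> ?\<alpha> + ?\<beta> + 1" for l
      using z[of l] that by (simp add: Z_def)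
    have "Z \<in> {1..dim_cell ?g} \<rightarrow>\<^sub>E {0..1}"
    proof (rule PiE_I)
      fix l assume "l \<in> {1..dim_cell ?g}"
      then have l: "1 \<le> l" "l \<le> ?\<alpha> + ?\<beta> + 1"
        by (auto simp: dim)
      consider "l < ?k" | "l = ?k" | "?k < l" "l \<le> ?k + ?\<beta>" | "?k + ?\<beta> < l"
        by linarith
      then show "Z l \<in> {0..1}"
        unfolding Z[OF l]
        using l k(2) dim(2) xin[of l] xin[of "l - ?\<beta> - 1"] yin[of "l - ?k"] by cases simp_all
    next
      fix l assume "l \<notin> {1..dim_cell ?g}"
      then show "Z l = undefined"
        by (auto simp: Z_def face_def dim)
    qed
    then have A: ?A
      unfolding gp Z_def[symmetric] using g(1) by (simp add: cell_points_def topspace_cube)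
    have dt: "size_nodes t = ?\<alpha> + 1" "size_nodes s = ?\<beta> + 1"
      using t pos by (simp_all add: dim_cell_eq)
    let ?X = "\<lambda>i. if i < ?k then (Z(0 := 1)) i else (Z(0 := 1)) (i + size_nodes s)"
    have "encode (graft_point j a b) = numbered ?g (Z(0 := 1)) 0"
      unfolding gp Z_def by (rule encode_numbered[OF g(1)])
    also have "\<dots> = lgraft (numbered t ?X 0) j (numbered s (Z(0 := 1)) ?k)"
      by (rule numbered_graft[OF t(2,1) j]) simp
    also have "numbered t ?X 0 = numbered t (x(0 := 1)) 0"
    proof (rule numbered_cong[OF t(1)])
      fix i assume "0 \<le> i" "i < 0 + size_nodes t"
      then have i: "i \<le> ?\<alpha>"
        by (simp add: dt)
      consider "i = 0" | "0 < i" "i < ?k" | "0 < i" "?k \<le> i"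
        by linarith
      then show "?X i = (x(0 := 1)) i"
        using i k(2) Z[of i] Z[of "i + size_nodes s"] dt by cases simp_all
    qed
    also have "numbered s (Z(0 := 1)) ?k = numbered s (\<lambda>i. (Z(0 := 1)) (i + ?k)) 0"
      using numbered_shift[OF t(2), of "Z(0 := 1)" 0 ?k] by (simp only: add_0)
    also have "\<dots> = numbered s (y(0 := 1)) 0"
    proof (rule numbered_cong[OF t(2)])
      fix i assume "0 \<le> i" "i < 0 + size_nodes s"
      then have i: "i \<le> ?\<beta>"
        by (simp add: dt)
      then show "(Z(0 := 1)) (i + ?k) = (y(0 := 1)) i"
        using k(2) Z[of "i + ?k"] dim(2) by (cases "i = 0") simp_all
    qed
    finally have B: ?B
      unfolding ab encode_numbered[OF t(1)] encode_numbered[OF t(2)] .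
    have C: ?C
      using g(2) unfolding gp fst_conv unfolding ab fst_conv .
    show ?thesis
      using A B C by blast
  qed
  then show ?A ?B ?C by blast+
qed

section \<open>The operad identities for labelled trees\<close>

lemma leaf_count_lgraft:
  "\<lbrakk>1 \<le> j; j \<le> leaf_count u\<rbrakk> \<Longrightarrow> leaf_count (lgraft u j v) = leaf_count u + leaf_count v - 1"
proof (induction u arbitrary: j)
  case (LFork a l r)
  show ?case
  proof (cases "j \<le> leaf_count l")
    case True
    then show ?thesis using LFork by simp
  next
    case False
    then have "1 \<le> j - leaf_count l" "j - leaf_count l \<le> leaf_count r"
      using LFork.prems by auto
    with False show ?thesis using LFork.IH(2) by simp
  qed
qed auto

lemma lgraft_parallel:
  "\<lbrakk>1 \<le> j; j < i; i \<le> leaf_count u\<rbrakk> \<Longrightarrow>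
    lgraft (lgraft u i v) j w = lgraft (lgraft u j w) (i + leaf_count w - 1) v"
proof (induction u arbitrary: i j)
  case (LFork a l r)
  consider "i \<le> leaf_count l" | "j \<le> leaf_count l" "leaf_count l < i" | "leaf_count l < j"
    by linarith
  then show ?case
  proof cases
    case 1
    then show ?thesis
      using LFork by (auto simp: leaf_count_lgraft)
  next
    case 2
    then show ?thesis
      using LFork.prems
      by (auto simp: leaf_count_lgraft intro!: arg_cong[where f = "\<lambda>n. lgraft r n v"])
  next
    case 3
    then have "lgraft (lgraft r (i - leaf_count l) v) (j - leaf_count l) w =
        lgraft (lgraft r (j - leaf_count l) w) (i - leaf_count l + leaf_count w - 1) v"
      using LFork.prems by (intro LFork.IH(2)) auto
    moreover have "i - leaf_count l + leaf_count w - 1 = i + leaf_count w - 1 - leaf_count l"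
      using 3 LFork.prems by auto
    ultimately show ?thesis
      using 3 LFork.prems by auto
  qed
qed auto

lemma lgraft_sequential:
  "\<lbrakk>1 \<le> i; i \<le> leaf_count u; i \<le> j; j < leaf_count v + i\<rbrakk> \<Longrightarrow>
    lgraft (lgraft u i v) j w = lgraft u i (lgraft v (j - i + 1) w)"
proof (induction u arbitrary: i j)
  case (LFork a l r)
  show ?case
  proof (cases "i \<le> leaf_count l")
    case True
    then show ?thesis
      using LFork by (auto simp: leaf_count_lgraft)
  next
    case False
    then have "lgraft (lgraft r (i - leaf_count l) v) (j - leaf_count l) w =
        lgraft r (i - leaf_count l) (lgraft v (j - leaf_count l - (i - leaf_count l) + 1) w)"
      using LFork.prems by (intro LFork.IH(2)) auto
    then show ?thesis
      using False LFork.prems by auto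
  qed
qed auto

section \<open>Moves\<close>

text \<open>
  The address is kept as an index because, given the rule and the address, a move has only one
  result.
\<close>

inductive move_at :: "('a ltree \<Rightarrow> 'a ltree \<Rightarrow> bool) \<Rightarrow> nat list \<Rightarrow> 'a ltree \<Rightarrow> 'a ltree \<Rightarrow> bool"
  for \<rho> where
  here: "\<rho> u v \<Longrightarrow> move_at \<rho> [] u v"
| left: "move_at \<rho> q l l' \<Longrightarrow> move_at \<rho> (0 # q) (LFork a l r) (LFork a l' r)"
| right: "move_at \<rho> q r r' \<Longrightarrow> move_at \<rho> (Suc 0 # q) (LFork a l r) (LFork a l r')"

text \<open>
  The two sides are the two binary trees with the same contraction of the edge labelled 0; the
  label \<open>a\<close> belongs to the edge below.
\<close>

inductive rotation :: "real ltree \<Rightarrow> real ltree \<Rightarrow> bool" where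
  "rotation (LFork a (LFork 0 x y) z) (LFork a x (LFork 0 y z))"

text \<open>
  Merging an edge labelled \<open>a\<close> with the root edge of the tree above it. A leaf edge has no
  label, so there \<open>a\<close> is forgotten.
\<close>

fun raise_root :: "real \<Rightarrow> real ltree \<Rightarrow> real ltree" where
  "raise_root a LLeaf = LLeaf"
| "raise_root a (LCork b) = LCork (max a b)"
| "raise_root a (LFork b l r) = LFork (max a b) l r"

inductive cork_removal :: "nat \<Rightarrow> real ltree \<Rightarrow> real ltree \<Rightarrow> bool" where
  "cork_removal 0 (LFork a (LCork 0) z) (raise_root a z)"
| "cork_removal (Suc 0) (LFork a z (LCork 0)) (raise_root a z)"

lemma move_at_Nil: "move_at \<rho> [] u v \<longleftrightarrow> \<rho> u v"
  by (auto elim: move_at.cases intro: here)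

lemma move_at_Cons:
  "move_at \<rho> (k # q) u v \<longleftrightarrow>
     (\<exists>a l r. u = LFork a l r \<and>
        (k = 0 \<and> (\<exists>l'. v = LFork a l' r \<and> move_at \<rho> q l l') \<or>
         k = 1 \<and> (\<exists>r'. v = LFork a l r' \<and> move_at \<rho> q r r')))"
  by (subst move_at.simps) (auto simp: One_nat_def)

text \<open>
  Together with the injectivity of \<open>encode\<close>, this identifies the target of a move once its
  address and rule are known.
\<close>

lemma move_at_unique:
  assumes "\<And>u v w. \<rho> u v \<Longrightarrow> \<rho> u w \<Longrightarrow> v = w"
  shows "\<lbrakk>move_at \<rho> q u v; move_at \<rho> q u w\<rbrakk> \<Longrightarrow> v = w"
  by (induction q arbitrary: u v w) (use assms in \<open>auto simp: move_at_Nil move_at_Cons\<close>)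

lemma rotation_unique: "rotation u v \<Longrightarrow> rotation u w \<Longrightarrow> v = w"
  by (auto elim!: rotation.cases)

lemma cork_removal_unique: "cork_removal d u v \<Longrightarrow> cork_removal d u w \<Longrightarrow> v = w"
  by (auto elim!: cork_removal.cases)

inductive move_kind :: "(real ltree \<Rightarrow> real ltree \<Rightarrow> bool) \<Rightarrow> bool" where
  "move_kind rotation"
| "move_kind (cork_removal d)"

lemma leaf_count_raise_root [simp]: "leaf_count (raise_root a z) = leaf_count z"
  by (cases z) auto

lemma move_leaf_count:
  assumes "move_kind \<rho>" "\<rho> u v"
  shows "leaf_count v = leaf_count u"
  using assms by (auto elim!: move_kind.cases rotation.cases cork_removal.cases)

lemma move_at_leaf_count:
  assumes "move_kind \<rho>"
  shows "move_at \<rho> q u v \<Longrightarrow> leaf_count v = leaf_count u"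
  by (induction rule: move_at.induct) (use move_leaf_count[OF assms] in auto)

lemma set_raise_root: "\<lbrakk>set_ltree z \<subseteq> {0..1}; a \<in> {0..1}\<rbrakk> \<Longrightarrow> set_ltree (raise_root a z) \<subseteq> {0..1}"
  by (cases z) auto

lemma move_at_unit_interval:
  assumes "move_kind \<rho>"
  shows "move_at \<rho> q u v \<Longrightarrow> set_ltree u \<subseteq> {0..1} \<Longrightarrow> set_ltree v \<subseteq> {0..1}"
proof (induction rule: move_at.induct)
  case (here u v)
  from assms show ?case
  proof cases
    case 1
    then show ?thesis
      using here by (auto elim!: rotation.cases)
  next
    case (2 d)
    then have "cork_removal d u v"
      using here by simp
    then show ?thesis
      using here(2) by cases (simp_all add: set_raise_root)
  qed
qed auto

lemma map_raise_root:
  assumes "mono g"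
  shows "map_ltree g (raise_root a z) = raise_root (g a) (map_ltree g z)"
  using assms by (cases z) (auto simp: max_of_mono)

text \<open>
  The reason why links between points depend only on the order of the labels: moves involve no
  operation on labels except \<open>max\<close>, and no condition except being 0.
\<close>

lemma move_at_map:
  assumes "move_kind \<rho>" "mono g" "g 0 = 0"
  shows "move_at \<rho> q u v \<Longrightarrow> move_at \<rho> q (map_ltree g u) (map_ltree g v)"
proof (induction rule: move_at.induct)
  case (here u v)
  then have "\<rho> (map_ltree g u) (map_ltree g v)"
    using assms by (auto elim!: move_kind.cases rotation.cases cork_removal.cases
        simp: map_raise_root
        intro: rotation.intros cork_removal.intros)
  then show ?case by (rule move_at.here)
qed (auto intro: move_at.intros)

lemma raise_root_rooted:
  "\<lbrakk>rooted v; a \<le> 1\<rbrakk> \<Longrightarrow> raise_root a v = v"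
  by (cases v) (auto simp: rooted_def)

text \<open>
  The only case that is not immediate is a leaf \<open>z\<close>. There \<open>a\<close> is forgotten on the left, and
  on the right it is absorbed by the root label 1 of \<open>v\<close>, as \<open>max a 1 = 1\<close>.
\<close>

lemma lgraft_raise_root:
  "\<lbrakk>rooted v; a \<le> 1\<rbrakk> \<Longrightarrow> lgraft (raise_root a z) j v = raise_root a (lgraft z j v)"
  by (cases z) (auto simp: raise_root_rooted)

lemma move_lgraft_left:
  assumes "move_kind \<rho>" "\<rho> u u'" "rooted v" "set_ltree u \<subseteq> {0..1}" "1 \<le> j" "j \<le> leaf_count u"
  shows "\<rho> (lgraft u j v) (lgraft u' j v)"
  using assms(1)
proof cases
  case 1
  then show ?thesis
    using assms(2) by (auto elim!: rotation.cases simp: diff_diff_add intro: rotation.intros)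
next
  case (2 d)
  then show ?thesis
    using assms(2-)
    by (auto elim!: cork_removal.cases simp: lgraft_raise_root
        intro: cork_removal.intros)
qed

text \<open>
  The address of the move survives, since grafting only changes the tree above a leaf.
\<close>

lemma move_at_lgraft_left:
  assumes \<rho>: "move_kind \<rho>" and v: "rooted v"
  shows "\<lbrakk>move_at \<rho> q u u'; set_ltree u \<subseteq> {0..1}; 1 \<le> j; j \<le> leaf_count u\<rbrakk> \<Longrightarrow>
    move_at \<rho> q (lgraft u j v) (lgraft u' j v)"
proof (induction arbitrary: j rule: move_at.induct)
  case (here u u')
  then show ?case
    using move_lgraft_left[OF \<rho>] v by (auto intro: move_at.here)
next
  case (left q l l' a r)
  then show ?case
    using move_at_leaf_count[OF \<rho> left.hyps] by (auto intro: move_at.left)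
next
  case (right q r r' a l)
  then show ?case
    using move_at.right[OF right.hyps] by (auto simp: move_at_Cons)
qed

lemma move_at_lgraft_right:
  "\<lbrakk>move_at \<rho> q v v'; 1 \<le> j; j \<le> leaf_count u\<rbrakk> \<Longrightarrow>
    \<exists>q'. move_at \<rho> q' (lgraft u j v) (lgraft u j v')"
proof (induction u arbitrary: j)
  case (LFork a l r)
  show ?case
  proof (cases "j \<le> leaf_count l")
    case True
    then obtain q' where "move_at \<rho> q' (lgraft l j v) (lgraft l j v')"
      using LFork by blast
    then show ?thesis
      using True by (auto intro: move_at.left)
  next
    case False
    then have "\<exists>q'. move_at \<rho> q' (lgraft r (j - leaf_count l) v) (lgraft r (j - leaf_count l) v')"
      using LFork.prems by (intro LFork.IH(2)) auto
    then obtain q' where "move_at \<rho> q' (lgraft r (j - leaf_count l) v) (lgraft r (j - leaf_count l) v')" ..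
    then show ?thesis
      using False by (auto intro: move_at.right)
  qed
qed auto

section \<open>Rotations on numbered trees\<close>

text \<open>
  The map \<open>face\<close> without the restriction to a cube, so that the label of the root edge can be
  carried along at index 0.
\<close>

definition insert_at :: "'a \<Rightarrow> nat \<Rightarrow> (nat \<Rightarrow> 'a) \<Rightarrow> nat \<Rightarrow> 'a" where
  "insert_at c i w = (\<lambda>l. if l < i then w l else if l = i then c else w (l - 1))"

lemma size_nodes_replace_at:
  "\<lbrakk>binary t; subtree_at t q = Some s; binary s; binary s'; size_nodes s' = size_nodes s\<rbrakk> \<Longrightarrow>
    size_nodes (replace_at t q s') = size_nodes t"
proof (induction t arbitrary: q rule: binary_induct)
  case Leaf
  then show ?case by (cases q) auto
next
  case cork
  then show ?case by (cases q) auto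
next
  case (fork l r)
  then show ?case
    by (cases q) (auto simp: binary_replace_at split: if_splits)
qed

lemma card_leaves_replace_at:
  "\<lbrakk>binary t; subtree_at t q = Some s; binary s; binary s'; card (leaves s') = card (leaves s)\<rbrakk> \<Longrightarrow>
    card (leaves (replace_at t q s')) = card (leaves t)"
proof (induction t arbitrary: q rule: binary_induct)
  case Leaf
  then show ?case by (cases q) auto
next
  case cork
  then show ?case by (cases q) auto
next
  case (fork l r)
  then show ?case
    by (cases q) (auto simp: binary_replace_at simp del: leaves_fork split: if_splits)
qed

lemma pos_replace_at:
  "\<lbrakk>binary t; subtree_at t q = Some s\<rbrakk> \<Longrightarrow> pos (replace_at t q s') (q @ p) = pos t q + pos s' p"
proof (induction t arbitrary: q rule: binary_induct)
  case Leaf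
  then show ?case by (cases q) auto
next
  case cork
  then show ?case by (cases q) auto
next
  case (fork l r)
  then show ?case
    by (cases q) (auto split: if_splits)
qed

text \<open>
  A rotation moves one entry of the preorder sequence, the label 0 of the contracted edge, past
  the labels of \<open>X\<close>, and keeps the order of all others. So both trees come from the same
  sequence \<open>w\<close> by inserting 0, which is how (R1) identifies points.
\<close>

lemma rotation_numbered:
  "\<lbrakk>binary t; subtree_at t q = Some (Node [Node [X, Y], Z]); i = Suc (k + pos t q); j = i + size_nodes X\<rbrakk> \<Longrightarrow>
    move_at rotation q (numbered t (insert_at 0 i w) k)
      (numbered (replace_at t q (Node [X, Node [Y, Z]])) (insert_at 0 j w) k)"
proof (induction t arbitrary: q k rule: binary_induct)
  case Leaf
  then show ?case by (cases q) auto
next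
  case cork
  then show ?case by (cases q) auto
next
  case (fork l r)
  let ?x = "insert_at 0 i w" and ?y = "insert_at 0 j w"
  let ?s' = "Node [X, Node [Y, Z]]"
  have XYZ: "binary X" "binary Y" "binary Z"
    using binary_subtree_at[OF _ fork.prems(1)] fork.hyps by auto
  have ij: "i \<le> j"
    using fork.prems by simp
  show ?case
  proof (cases q)
    case Nil
    then have lr: "l = Node [X, Y]" "r = Z"
      using fork.prems(1) by auto
    have i: "i = Suc k" "j = Suc (k + size_nodes X)"
      using Nil fork.prems by auto
    have "numbered X ?x (Suc i) = numbered X ?y i"
      using numbered_shift[OF XYZ(1), of ?x i 1] XYZ i
      by (simp, intro numbered_cong) (auto simp: insert_at_def)
    moreover have "numbered Y ?x (Suc (i + size_nodes X)) = numbered Y ?y (Suc (i + size_nodes X))"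
      using XYZ i by (intro numbered_cong) (auto simp: insert_at_def)
    moreover have "numbered Z ?x (Suc (i + size_nodes X + size_nodes Y))
        = numbered Z ?y (Suc (i + size_nodes X + size_nodes Y))"
      using XYZ i by (intro numbered_cong) (auto simp: insert_at_def)
    moreover have "?x k = ?y k" "?x i = 0" "?y j = 0"
      using i by (auto simp: insert_at_def)
    ultimately show ?thesis
      using Nil lr i XYZ by (auto simp: move_at_Nil add_ac intro!: rotation.intros)
  next
    case (Cons d q')
    have xy: "?x k = ?y k"
      using fork.prems Cons ij by (auto simp: insert_at_def split: if_splits)
    consider "d = 0" "subtree_at l q' = Some (Node [Node [X, Y], Z])"
      | "d = 1" "subtree_at r q' = Some (Node [Node [X, Y], Z])"
      using fork.prems(1) Cons by (auto split: if_splits)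
    then show ?thesis
    proof cases
      case 1
      have i: "i = Suc (Suc k + pos l q')"
        using 1 Cons fork.prems by simp
      have "j < Suc (k + size_nodes l)"
        using pos_subtree_le[OF fork.hyps(1) 1(2)] fork.prems(3) i XYZ by simp
      then have "numbered r ?x (Suc (k + size_nodes l)) = numbered r ?y (Suc (k + size_nodes l))"
        using fork.hyps ij by (intro numbered_cong) (auto simp: insert_at_def)
      moreover have "size_nodes (replace_at l q' ?s') = size_nodes l"
        by (rule size_nodes_replace_at[OF fork.hyps(1) 1(2)]) (use XYZ in auto)
      ultimately show ?thesis
        using Cons 1 xy fork.IH(1)[OF 1(2) i fork.prems(3)] by (simp add: move_at_Cons)
    next
      case 2
      have i: "i = Suc (Suc (k + size_nodes l) + pos r q')"
        using 2 Cons fork.prems by simp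
      have "numbered l ?x (Suc k) = numbered l ?y (Suc k)"
        using fork.hyps ij i by (intro numbered_cong) (auto simp: insert_at_def)
      then show ?thesis
        using Cons 2 xy fork.IH(2)[OF 2(2) i fork.prems(3)] by (simp add: move_at_Cons)
    qed
  qed
qed

lemma numbered_eq_LFork:
  "\<lbrakk>binary t; numbered t x k = LFork a u v\<rbrakk> \<Longrightarrow>
    \<exists>l r. t = Node [l, r] \<and> binary l \<and> binary r \<and> a = x k \<and> u = numbered l x (Suc k) \<and>
      v = numbered r x (Suc (k + size_nodes l))"
  by (erule binary_cases) auto

lemma rotation_numbered_inv:
  "\<lbrakk>binary t; move_at rotation q (numbered t x k) v\<rbrakk> \<Longrightarrow>
    \<exists>X Y Z. subtree_at t q = Some (Node [Node [X, Y], Z]) \<and> x (Suc (k + pos t q)) = 0"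
proof (induction q arbitrary: t k v)
  case Nil
  then have "rotation (numbered t x k) v"
    by (simp add: move_at_Nil)
  then obtain a u1 u2 u3 where "numbered t x k = LFork a (LFork 0 u1 u2) u3"
    by cases blast
  from numbered_eq_LFork[OF Nil.prems(1) this]
  obtain l r where t: "t = Node [l, r]" "binary l" "LFork 0 u1 u2 = numbered l x (Suc k)"
    by (elim exE conjE) (rule that)
  from numbered_eq_LFork[OF t(2) t(3)[symmetric]]
  obtain X Y where "l = Node [X, Y]" "0 = x (Suc k)"
    by (elim exE conjE) (rule that)
  then show ?case
    using t by simp
next
  case (Cons d q)
  then obtain a u1 u2 where u: "numbered t x k = LFork a u1 u2"
     and d: "d = 0 \<and> (\<exists>l'. v = LFork a l' u2 \<and> move_at rotation q u1 l') \<or>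
             d = 1 \<and> (\<exists>r'. v = LFork a u1 r' \<and> move_at rotation q u2 r')"
    unfolding move_at_Cons by (elim exE conjE) (rule that)
  from numbered_eq_LFork[OF Cons.prems(1) u] obtain l r where t: "t = Node [l, r]" "binary l" "binary r"
      "u1 = numbered l x (Suc k)" "u2 = numbered r x (Suc (k + size_nodes l))"
    by (elim exE conjE) (rule that)
  show ?case
    using d t Cons.IH[OF t(2), of "Suc k"] Cons.IH[OF t(3), of "Suc (k + size_nodes l)"]
    by (auto simp: add.assoc)
qed

section \<open>Cork removals on labelled trees\<close>

text \<open>
  The labels of \<open>prune_label\<close> for an arbitrary labelling of the edges, the root edge included.
\<close>

definition merged :: "nat list \<Rightarrow> (nat list \<Rightarrow> real) \<Rightarrow> nat list \<Rightarrow> real" where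
  "merged e F f =
    (let q = butlast e in
     if f = q then max (F q) (F (sibling e))
     else if take (length q) f = q then F (sibling e @ drop (length q) f)
     else F f)"

definition cork_fork :: "nat \<Rightarrow> ptree \<Rightarrow> ptree" where
  "cork_fork d Z = (if d = 0 then Node [Node [], Z] else Node [Z, Node []])"

lemma labelled_raise_root:
  "binary Z \<Longrightarrow> labelled Z (\<lambda>r. if r = [] then max a (F []) else F r) = raise_root a (labelled Z F)"
  by (erule binary_cases) auto

lemma cork_removal_labelled:
  "\<lbrakk>binary t; d \<in> {0, 1}; subtree_at t q = Some (cork_fork d Z); F (q @ [d]) = 0\<rbrakk> \<Longrightarrow>
    move_at (cork_removal d) q (labelled t F) (labelled (prune t (q @ [d])) (merged (q @ [d]) F))"
proof (induction t arbitrary: q F rule: binary_induct)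
  case Leaf
  then show ?case by (cases q) (auto simp: cork_fork_def split: if_splits)
next
  case cork
  then show ?case by (cases q) (auto simp: cork_fork_def split: if_splits)
next
  case (fork l r)
  show ?case
  proof (cases q)
    case Nil
    have Z: "binary Z"
      using fork.prems(2) Nil fork.hyps by (auto simp: cork_fork_def split: if_splits)
    have m: "merged [d] F = (\<lambda>r. if r = [] then max (F []) (F [1 - d]) else F ((1 - d) # r))"
      by (auto simp: merged_def sibling_def)
    have "prune (Node [l, r]) [d] = Z"
      using fork.prems(1,2) Nil by (auto simp: prune_def sibling_def cork_fork_def split: if_splits)
    then have "labelled (prune (Node [l, r]) [d]) (merged [d] F) =
        raise_root (F []) (labelled Z (\<lambda>r. F ((1 - d) # r)))"
      using labelled_raise_root[OF Z, of "F []" "\<lambda>r. F ((1 - d) # r)"] by (simp add: m)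
    then show ?thesis
      using Nil fork.prems
      by (auto simp: move_at_Nil cork_fork_def intro: cork_removal.intros
          split: if_splits)
  next
    case (Cons c q')
    have m: "merged (c # q' @ [d]) F [] = F []"
        "(\<lambda>p. merged (c # q' @ [d]) F (c # p)) = merged (q' @ [d]) (\<lambda>p. F (c # p))"
        "c' \<noteq> c \<Longrightarrow> (\<lambda>p. merged (c # q' @ [d]) F (c' # p)) = (\<lambda>p. F (c' # p))" for c'
      by (auto simp: merged_def sibling_def Let_def butlast_append)
    consider "c = 0" "subtree_at l q' = Some (cork_fork d Z)"
      | "c = 1" "subtree_at r q' = Some (cork_fork d Z)"
      using fork.prems(2) Cons by (auto split: if_splits)
    then show ?thesis
    proof cases
      case 1
      have p: "prune (Node [l, r]) (q @ [d]) = Node [prune l (q' @ [d]), r]"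
        using 1 Cons by (simp add: prune_def sibling_def butlast_append)
      show ?thesis
        using fork.IH(1)[OF fork.prems(1) 1(2), of "\<lambda>p. F (0 # p)"] 1 Cons fork.prems(3) m(1) m(2) m(3)[of 1]
        unfolding p by (simp add: move_at_Cons)
    next
      case 2
      have p: "prune (Node [l, r]) (q @ [d]) = Node [l, prune r (q' @ [d])]"
        using 2 Cons by (simp add: prune_def sibling_def butlast_append)
      show ?thesis
        using fork.IH(2)[OF fork.prems(1) 2(2), of "\<lambda>p. F (1 # p)"] 2 Cons fork.prems(3) m(1) m(2) m(3)[of 0]
        unfolding p by (simp add: move_at_Cons)
    qed
  qed
qed

lemma labelled_eq_LFork:
  "\<lbrakk>binary t; labelled t F = LFork a u v\<rbrakk> \<Longrightarrow>
    \<exists>l r. t = Node [l, r] \<and> binary l \<and> binary r \<and> a = F [] \<and> u = labelled l (\<lambda>p. F (0 # p)) \<and>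
      v = labelled r (\<lambda>p. F (1 # p))"
  by (erule binary_cases) auto

lemma labelled_eq_LCork:
  "\<lbrakk>binary t; labelled t F = LCork a\<rbrakk> \<Longrightarrow> t = Node [] \<and> a = F []"
  by (erule binary_cases) auto

lemma cork_removal_labelled_inv:
  "\<lbrakk>binary t; move_at (cork_removal d) q (labelled t F) v\<rbrakk> \<Longrightarrow>
    d \<in> {0, 1} \<and> (\<exists>Z. subtree_at t q = Some (cork_fork d Z)) \<and> F (q @ [d]) = 0"
proof (induction q arbitrary: t F v)
  case Nil
  then have "cork_removal d (labelled t F) v"
    by (simp add: move_at_Nil)
  then show ?case
  proof cases
    case (1 a z)
    obtain l r where t: "t = Node [l, r]" "binary l" "LCork 0 = labelled l (\<lambda>p. F (0 # p))"
      using labelled_eq_LFork[OF Nil.prems(1) 1(2)] by blast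
    then have "l = Node []" "F [0] = 0"
      using labelled_eq_LCork[OF t(2) t(3)[symmetric]] by auto
    then show ?thesis
      using t 1 by (simp add: cork_fork_def)
  next
    case (2 a z)
    obtain l r where t: "t = Node [l, r]" "binary r" "LCork 0 = labelled r (\<lambda>p. F (1 # p))"
      using labelled_eq_LFork[OF Nil.prems(1) 2(2)] by blast
    then have "r = Node []" "F [1] = 0"
      using labelled_eq_LCork[OF t(2) t(3)[symmetric]] by auto
    then show ?thesis
      using t 2 by (simp add: cork_fork_def)
  qed
next
  case (Cons c q)
  then obtain a u1 u2 where u: "labelled t F = LFork a u1 u2"
     and c: "c = 0 \<and> (\<exists>l'. v = LFork a l' u2 \<and> move_at (cork_removal d) q u1 l') \<or>
             c = 1 \<and> (\<exists>r'. v = LFork a u1 r' \<and> move_at (cork_removal d) q u2 r')"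
    unfolding move_at_Cons by (elim exE conjE) (rule that)
  from labelled_eq_LFork[OF Cons.prems(1) u] obtain l r where t: "t = Node [l, r]" "binary l" "binary r"
      "u1 = labelled l (\<lambda>p. F (0 # p))" "u2 = labelled r (\<lambda>p. F (1 # p))"
    by (elim exE conjE) (rule that)
  show ?case
    using c t Cons.IH[OF t(2), of "\<lambda>p. F (0 # p)"] Cons.IH[OF t(3), of "\<lambda>p. F (1 # p)"]
    by auto
qed

section \<open>The generating relations are the moves\<close>

lemma replace_at_replace_at [simp]:
  "replace_at (replace_at t q s) q s' = replace_at t q s'"
  by (induction t q s rule: replace_at.induct) auto

lemma replace_at_self: "subtree_at t q = Some s \<Longrightarrow> replace_at t q s = t"
  by (induction t q s rule: replace_at.induct) (auto simp: subtree_at.simps split: if_splits)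

lemma subtree_at_replace_at:
  "subtree_at t q \<noteq> None \<Longrightarrow> subtree_at (replace_at t q s) q = Some s"
  by (induction t q s rule: replace_at.induct) (auto simp: subtree_at.simps split: if_splits)

lemma subtree_at_appendD:
  "subtree_at t (q @ p) = Some s \<Longrightarrow> \<exists>u. subtree_at t q = Some u \<and> subtree_at u p = Some s"
  by (induction t q rule: subtree_at.induct) (auto simp: subtree_at.simps split: if_splits)

lemma pos_append:
  "\<lbrakk>binary t; subtree_at t q = Some s\<rbrakk> \<Longrightarrow> pos t (q @ p) = pos t q + pos s p"
  using pos_replace_at[of t q s s p] by (simp add: replace_at_self)

lemma inner_edge_cases:
  assumes "binary t" "e \<in> inner_edges t"
  obtains q d l r ts where "e = q @ [d]" "d \<in> {0, 1}" "subtree_at t q = Some (Node [l, r])"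
    "(if d = 0 then l else r) = Node ts" "subtree_at t e = Some (Node ts)"
proof -
  obtain ts where ts: "subtree_at t e = Some (Node ts)" and "e \<noteq> []"
    using assms by (auto simp: inner_edges_def)
  then obtain q d where e: "e = q @ [d]"
    by (metis append_butlast_last_id)
  obtain u where u: "subtree_at t q = Some u" "subtree_at u [d] = Some (Node ts)"
    using subtree_at_appendD ts e by blast
  have "binary u"
    using binary_subtree_at assms u by blast
  then show thesis
  proof (cases rule: binary_cases)
    case (fork l r)
    then show thesis
      using that[of q d l r ts] u e ts by (auto split: if_splits)
  qed (use u in auto)
qed

lemma number_in_range:
  assumes "binary t" "e \<in> inner_edges t"
  shows "number_in (inner_edges t) e \<in> {1..dim_cell t}"
proof -
  have "finite (inner_edges t)"
    using assms(1) by (simp add: inner_edges_eq)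
  from nth_of_number_in(2)[OF this assms(2)] show ?thesis
    using assms(1) by (simp only: card_inner_edges)
qed

lemma face_in_cube:
  assumes "x \<in> topspace (cube (n - 1))" "c \<in> {0..1}" "i \<in> {1..n}"
  shows "face c n i x \<in> topspace (cube n)"
  unfolding topspace_cube
proof (rule PiE_I)
  fix l assume l: "l \<in> {1..n}"
  then consider "l < i" "l \<in> {1..n - 1}" | "l = i" | "l > i" "l - 1 \<in> {1..n - 1}"
    using assms(3) by fastforce
  then show "face c n i x l \<in> {0..1}"
    using l assms by cases (auto simp: face_def topspace_cube PiE_iff)
qed (auto simp: face_def)

lemma face_exists:
  assumes y: "y \<in> topspace (cube n)" and i: "i \<in> {1..n}"
  obtains x where "x \<in> topspace (cube (n - 1))" "y = face (y i) n i x"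
proof
  define x where "x = (\<lambda>l\<in>{1..n - 1}. if l < i then y l else y (l + 1))"
  have yl: "y l \<in> {0..1}" if "l \<in> {1..n}" for l
    using y that by (auto simp: topspace_cube PiE_iff)
  show "x \<in> topspace (cube (n - 1))"
    unfolding topspace_cube
  proof (rule PiE_I)
    fix l assume "l \<in> {1..n - 1}"
    then show "x l \<in> {0..1}"
      using yl[of l] yl[of "l + 1"] i by (auto simp: x_def)
  qed (auto simp: x_def)
  show "y = face (y i) n i x"
  proof
    fix l
    show "y l = face (y i) n i x l"
    proof (cases "l \<in> {1..n}")
      case True
      then consider "l < i" "l \<in> {1..n - 1}" | "l = i" | "l > i" "l - 1 \<in> {1..n - 1}"
        using i by fastforce
      then show ?thesis
        using True by cases (auto simp: face_def x_def)
    next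
      case False
      then show ?thesis
        using y by (auto simp: face_def topspace_cube PiE_iff extensional_def)
    qed
  qed
qed

lemma encode_face:
  assumes "binary t" "1 \<le> i"
  shows "encode (t, face 0 (dim_cell t) i x) = numbered t (insert_at 0 i (x(0 := 1))) 0"
  unfolding encode_numbered[OF assms(1)]
proof (rule numbered_cong[OF assms(1)])
  fix l assume "l < 0 + size_nodes t"
  then have "l \<le> dim_cell t"
    using assms by (simp add: dim_cell_eq)
  then show "((face 0 (dim_cell t) i x)(0 := 1)) l = insert_at 0 i (x(0 := 1)) l"
    using assms(2) by (auto simp: insert_at_def face_def)
qed

text \<open>
  The two points of (R1) given by a rotation: they are linked both by a move and by the relation.
\<close>

lemma rotation_props:
  assumes t: "binary t" and sub: "subtree_at t q = Some (Node [Node [X, Y], Z])"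
    and x: "x \<in> topspace (cube (dim_cell t - 1))"
  defines "t' \<equiv> replace_at t q (Node [X, Node [Y, Z]])"
    and "i \<equiv> Suc (pos t q)" and "j \<equiv> Suc (pos t q + size_nodes X)"
  shows "(t, face 0 (dim_cell t) i x) \<in> cell_points"
    and "(t', face 0 (dim_cell t') j x) \<in> cell_points"
    and "move_at rotation q (encode (t, face 0 (dim_cell t) i x)) (encode (t', face 0 (dim_cell t') j x))"
    and "identified (t, face 0 (dim_cell t) i x) (t', face 0 (dim_cell t') j x)"
    and "number_in (inner_edges t) (q @ [0]) = i" "number_in (inner_edges t') (q @ [1]) = j"
    and "card (leaves t') = card (leaves t)"
proof -
  have XYZ: "binary X" "binary Y" "binary Z"
    using binary_subtree_at[OF t sub] by auto
  have t': "binary t'"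
    unfolding t'_def using t XYZ sub by (intro binary_replace_at) auto
  have size: "size_nodes t' = size_nodes t"
    unfolding t'_def by (rule size_nodes_replace_at[OF t sub]) (use XYZ in auto)
  show leaves: "card (leaves t') = card (leaves t)"
    unfolding t'_def
    by (rule card_leaves_replace_at[OF t sub]) (use XYZ in \<open>auto simp del: leaves_fork\<close>)
  have corks: "card (corks t) = card (corks t')"
    using size leaves size_nodes_corks_leaves[OF t] size_nodes_corks_leaves[OF t'] by linarith
  have sub': "subtree_at t' q = Some (Node [X, Node [Y, Z]])"
    unfolding t'_def using sub by (intro subtree_at_replace_at) auto
  have dim: "dim_cell t' = dim_cell t"
    using size t t' by (simp add: dim_cell_eq)
  have e: "subtree_at t (q @ [0]) = Some (Node [X, Y])"
      "subtree_at t' (q @ [1]) = Some (Node [Y, Z])"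
    using subtree_at_append[OF sub] subtree_at_append[OF sub'] by auto
  then have inner: "q @ [0] \<in> inner_edges t" "q @ [0] \<notin> corks t"
      "q @ [1] \<in> inner_edges t'" "q @ [1] \<notin> corks t'"
    by (auto simp: inner_edges_def corks_def)
  have "pos t' q = pos t q"
    unfolding t'_def using pos_replace_at[OF t sub, of _ "[]"] by simp
  then show i: "number_in (inner_edges t) (q @ [0]) = i"
    and j: "number_in (inner_edges t') (q @ [1]) = j"
    using number_in_inner_edges[OF t inner(1)] number_in_inner_edges[OF t' inner(3)]
      pos_append[OF t sub, of "[0]"] pos_append[OF t' sub', of "[1]"]
    by (simp_all add: i_def j_def)
  have ij: "i \<in> {1..dim_cell t}" "j \<in> {1..dim_cell t'}"
    using number_in_range[OF t inner(1)] number_in_range[OF t' inner(3)] i j by simp_all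
  show "(t, face 0 (dim_cell t) i x) \<in> cell_points"
    and "(t', face 0 (dim_cell t') j x) \<in> cell_points"
    using face_in_cube[OF x _ ij(1), of 0] face_in_cube[of x "dim_cell t'" 0 j] x t t' ij dim
    by (auto simp: cell_points_def)
  have "move_at rotation q (numbered t (insert_at 0 i (x(0 := 1))) 0)
      (numbered t' (insert_at 0 j (x(0 := 1))) 0)"
    unfolding t'_def by (rule rotation_numbered[OF t sub]) (simp_all add: i_def j_def)
  then show "move_at rotation q (encode (t, face 0 (dim_cell t) i x))
      (encode (t', face 0 (dim_cell t') j x))"
    using encode_face[OF t] encode_face[OF t'] ij by simp
  show "identified (t, face 0 (dim_cell t) i x) (t', face 0 (dim_cell t') j x)"
  proof (rule identified.R1)
    show "contract t (q @ [0]) = contract t' (q @ [1])"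
      using sub sub' by (simp add: contract_def t'_def)
  qed (use t t' leaves corks inner i j x in auto)
qed

text \<open>
  The two points of (R2). The labels after pruning lie in the unit interval because they are those
  of the labelled tree obtained by a move; in particular \<open>max 1 a\<close>, the label at the root when
  the cork is next to it, is 1, as it must be for an encoded point.
\<close>

lemma prune_props:
  assumes cp: "(t, y) \<in> cell_points" and d: "d \<in> {0, 1}"
    and sub: "subtree_at t q = Some (cork_fork d Z)" and zero: "label t y (q @ [d]) = 0"
  defines "e \<equiv> q @ [d]"
  shows "(prune t e, prune_point t e y) \<in> cell_points"
    and "move_at (cork_removal d) q (encode (t, y)) (encode (prune t e, prune_point t e y))"
    and "identified (t, y) (prune t e, prune_point t e y)"
proof -
  define F where "F = (\<lambda>p. if p = [] then 1 else label t y p)"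
  let ?P = "prune t e" and ?z = "prune_point t e y"
  have t: "binary t"
    using cp by (simp add: cell_points_def)
  have q: "butlast e = q" "sibling e = q @ [1 - d]"
    by (simp_all add: e_def sibling_def)
  have sib: "subtree_at t (sibling e) = Some Z"
    using subtree_at_append[OF sub] d unfolding q by (auto simp: cork_fork_def)
  then have P: "binary ?P"
    unfolding prune_def q(1) using binary_subtree_at[OF t sib] t sub by (auto intro: binary_replace_at)
  have enc: "encode (t, y) = labelled t F"
    by (simp add: encode.simps F_def)
  have move: "move_at (cork_removal d) q (encode (t, y)) (labelled ?P (merged e F))"
    unfolding enc e_def by (rule cork_removal_labelled[OF t d sub]) (use zero in \<open>simp add: F_def\<close>)
  have "set_ltree (labelled ?P (merged e F)) \<subseteq> {0..1}"
    using move_at_unit_interval[OF _ move] encode_unit_interval[OF cp] move_kind.intros by blast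
  then have unit: "merged e F p \<in> {0..1}" if "p \<in> nodes ?P" for p
    using that P by (auto simp: set_labelled)
  have merged: "prune_label t e y f = merged e F f" if "f \<noteq> []" for f
    using that unfolding prune_label_def merged_def F_def q by (auto simp: Let_def)
  have fin: "finite (inner_edges ?P)"
    using P by (simp add: inner_edges_eq)
  show cpP: "(?P, ?z) \<in> cell_points"
    unfolding cell_points_def topspace_cube
  proof (clarify, intro conjI PiE_I)
    fix l assume l: "l \<in> {1..dim_cell ?P}"
    let ?f = "nth_of (inner_edges ?P) l"
    have f: "?f \<in> inner_edges ?P"
    proof -
      have "l - 1 < length (sorted_list_of_set (inner_edges ?P))"
        using l P by (auto simp: card_inner_edges)
      from nth_mem[OF this] show ?thesis
        using fin by (simp add: nth_of_def)
    qed
    then show "?z l \<in> {0..1}"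
      using l unit[of ?f] merged[of ?f] by (auto simp: prune_point_def inner_edges_eq)
  qed (use P in \<open>auto simp: prune_point_def\<close>)
  have "encode (?P, ?z) = labelled ?P (merged e F)"
    unfolding encode.simps
  proof (rule labelled_cong[OF P])
    fix p assume p: "p \<in> nodes ?P"
    show "(if p = [] then 1 else label ?P ?z p) = merged e F p"
    proof (cases "p = []")
      case True
      then show ?thesis
        using unit[OF p] unfolding merged_def q by (cases "q = []") (auto simp: F_def max_def)
    next
      case False
      then have "p \<in> inner_edges ?P"
        using p by (simp add: inner_edges_eq)
      then have "label ?P ?z p = prune_label t e y p"
        using nth_of_number_in[OF fin] P by (simp add: label_def prune_point_def card_inner_edges)
      then show ?thesis
        using False merged by simp
    qed
  qed
  with move show "move_at (cork_removal d) q (encode (t, y)) (encode (?P, ?z))"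
    by simp
  have "subtree_at t e = Some (Node [])"
    using subtree_at_append[OF sub, of "[d]"] d unfolding e_def by (auto simp: cork_fork_def)
  then have inner: "e \<in> inner_edges t" "e \<in> corks t"
    by (auto simp: inner_edges_def corks_def e_def)
  let ?i = "number_in (inner_edges t) e"
  have "y ?i = 0"
    using zero by (simp add: label_def e_def)
  moreover have "?i \<in> {1..dim_cell t}"
    by (rule number_in_range[OF t inner(1)])
  ultimately obtain x where x: "x \<in> topspace (cube (dim_cell t - 1))" "y = face 0 (dim_cell t) ?i x"
    using face_exists[of y "dim_cell t" ?i] cp by (auto simp: cell_points_def)
  show "identified (t, y) (?P, ?z)"
    by (rule identified.R2[OF t inner refl x])
qed

text \<open>
  The shape and labels of the source allow the move to be performed inside the cells, by one of
  the two preceding lemmas; as a move has only one result, it leads to \<open>b\<close>.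
\<close>

lemma identified_if_move:
  assumes "move_kind \<rho>" "a \<in> cell_points" "b \<in> cell_points" "move_at \<rho> q (encode a) (encode b)"
  shows "identified a b"
proof -
  obtain t y where a: "a = (t, y)" by (cases a)
  have t: "binary t" and y: "y \<in> topspace (cube (dim_cell t))"
    using assms(2) a by (auto simp: cell_points_def)
  from assms(1) show ?thesis
  proof cases
    case 1
    then have "move_at rotation q (numbered t (y(0 := 1)) 0) (encode b)"
      using assms(4) a t by (simp add: encode_numbered)
    from rotation_numbered_inv[OF t this]
    obtain X Y Z where sub: "subtree_at t q = Some (Node [Node [X, Y], Z])"
        and zero: "y (Suc (pos t q)) = 0"
      by auto
    have e: "q @ [0] \<in> inner_edges t"
      using subtree_at_append[OF sub, of "[0]"] by (simp add: inner_edges_def)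
    have "number_in (inner_edges t) (q @ [0]) = Suc (pos t q)"
      using number_in_inner_edges[OF t e] pos_append[OF t sub, of "[0]"] by simp
    then have "Suc (pos t q) \<in> {1..dim_cell t}"
      using number_in_range[OF t e] by simp
    then obtain x where x: "x \<in> topspace (cube (dim_cell t - 1))"
        "y = face 0 (dim_cell t) (Suc (pos t q)) x"
      using face_exists[OF y] zero by metis
    note R = rotation_props[OF t sub x(1), folded x(2)]
    have "encode b = encode (replace_at t q (Node [X, Node [Y, Z]]),
        face 0 (dim_cell (replace_at t q (Node [X, Node [Y, Z]]))) (Suc (pos t q + size_nodes X)) x)"
    proof (rule move_at_unique[where \<rho> = rotation and q = q and u = "encode a"])
      show "move_at rotation q (encode a) (encode b)"
        using assms(4) 1 by simp
      show "move_at rotation q (encode a) (encode (replace_at t q (Node [X, Node [Y, Z]]),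
        face 0 (dim_cell (replace_at t q (Node [X, Node [Y, Z]]))) (Suc (pos t q + size_nodes X)) x))"
        unfolding a by (rule R(3))
    qed (rule rotation_unique)
    then have "b = (replace_at t q (Node [X, Node [Y, Z]]),
        face 0 (dim_cell (replace_at t q (Node [X, Node [Y, Z]]))) (Suc (pos t q + size_nodes X)) x)"
      using encode_inj R(2) assms(3) by (metis surj_pair)
    then show ?thesis
      using R(4) a by simp
  next
    case (2 d)
    then have m: "move_at (cork_removal d) q (labelled t (\<lambda>p. if p = [] then 1 else label t y p)) (encode b)"
      using assms(4) a by (simp add: encode.simps)
    obtain Z where d: "d \<in> {0, 1}" and sub: "subtree_at t q = Some (cork_fork d Z)"
        and zero: "label t y (q @ [d]) = 0"
      using cork_removal_labelled_inv[OF t m] by auto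
    note P = prune_props[OF assms(2)[unfolded a] d sub zero]
    have "encode b = encode (prune t (q @ [d]), prune_point t (q @ [d]) y)"
    proof (rule move_at_unique[where \<rho> = "cork_removal d" and q = q and u = "encode a"])
      show "move_at (cork_removal d) q (encode a) (encode b)"
        using assms(4) 2 by simp
      show "move_at (cork_removal d) q (encode a)
          (encode (prune t (q @ [d]), prune_point t (q @ [d]) y))"
        unfolding a by (rule P(2))
    qed (rule cork_removal_unique)
    then have "b = (prune t (q @ [d]), prune_point t (q @ [d]) y)"
      using encode_inj P(1) assms(3) by (metis surj_pair)
    then show ?thesis
      using P(3) a by simp
  qed
qed

text \<open>
  A contraction of a binary tree along an edge without corks has exactly one vertex with three
  children, so the address of that vertex and its three subtrees can be read off from the
  contraction, as can everything else in the tree.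
\<close>

lemma replace_at_ternary_eq:
  "\<lbrakk>binary t; binary t'; subtree_at t q \<noteq> None; subtree_at t' q' \<noteq> None;
    replace_at t q (Node [X, Y, Z]) = replace_at t' q' (Node [X', Y', Z'])\<rbrakk> \<Longrightarrow>
    q = q' \<and> X = X' \<and> Y = Y' \<and> Z = Z' \<and> (\<forall>s. replace_at t q s = replace_at t' q' s)"
proof (induction q arbitrary: t t' q')
  case Nil
  from Nil.prems(2) show ?case
  proof (cases rule: binary_cases)
    case (fork l r)
    then show ?thesis
      using Nil.prems by (cases q') (auto simp: less_Suc_eq split: if_splits)
  qed (use Nil.prems in \<open>cases q'; auto\<close>)+
next
  case (Cons k q)
  have nb: "\<not> binary (replace_at s p (Node [X, Y, Z]))" if "subtree_at s p \<noteq> None" for s p X Y Z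
  proof
    assume "binary (replace_at s p (Node [X, Y, Z]))"
    then have "binary (Node [X, Y, Z])"
      using subtree_at_replace_at[OF that] by (rule binary_subtree_at)
    then show False
      by (simp add: binary_Node)
  qed
  obtain l r where t: "t = Node [l, r]" "binary l" "binary r"
    using Cons.prems(1,3) by (cases rule: binary_cases) auto
  show ?case
  proof (cases q')
    case Nil
    then show ?thesis
      using Cons.prems t by (auto simp: less_Suc_eq split: if_splits)
  next
    case q': (Cons k' p')
    obtain l' r' where t': "t' = Node [l', r']" "binary l'" "binary r'"
      using Cons.prems(2,4) q' by (cases rule: binary_cases) auto
    consider "k = 0" "k' = 0" | "k = 0" "k' = 1" | "k = 1" "k' = 0" | "k = 1" "k' = 1"
      using Cons.prems(3,4) t t' q' by (auto split: if_splits)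
    then show ?thesis
    proof cases
      case 1
      then show ?thesis
        using Cons.prems(3-) t t' q' Cons.IH[of l l' p'] by auto
    next
      case 2
      then have "binary (replace_at l q (Node [X, Y, Z]))"
        using Cons.prems(5) t t' q' by simp
      then show ?thesis
        using nb[of l q] Cons.prems(3) t 2 by simp
    next
      case 3
      then have "binary (replace_at r q (Node [X, Y, Z]))"
        using Cons.prems(5) t t' q' by simp
      then show ?thesis
        using nb[of r q] Cons.prems(3) t 3 by simp
    next
      case 4
      then show ?thesis
        using Cons.prems(3-) t t' q' Cons.IH[of r r' p'] by auto
    qed
  qed
qed

lemma contract_eq:
  assumes "binary t" "e \<in> inner_edges t" "e \<notin> corks t"
  obtains (left) q X Y Z where "e = q @ [0]" "subtree_at t q = Some (Node [Node [X, Y], Z])"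
      "contract t e = replace_at t q (Node [X, Y, Z])"
    | (right) q X Y Z where "e = q @ [1]" "subtree_at t q = Some (Node [X, Node [Y, Z]])"
      "contract t e = replace_at t q (Node [X, Y, Z])"
proof -
  obtain q d l r ts where e: "e = q @ [d]" "d \<in> {0, 1}" "subtree_at t q = Some (Node [l, r])"
    "(if d = 0 then l else r) = Node ts" "subtree_at t e = Some (Node ts)"
    using inner_edge_cases[OF assms(1,2)] .
  have "binary (Node ts)" "ts \<noteq> []"
    using e(5) assms binary_subtree_at by (auto simp: corks_def)
  then obtain A B where "ts = [A, B]"
    by (cases rule: binary_cases) auto
  then show thesis
    using e left[of q A B r] right[of q l A B] by (auto simp: contract_def split: if_splits)
qed

text \<open>
  A vertex with three children has only two binary resolutions. So in (R1) either the two trees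
  and edges agree, and the points are equal, or the trees differ by a rotation in one of the two
  directions.
\<close>

lemma moves_if_identified:
  assumes "identified a b"
  shows "a \<in> cell_points \<and> b \<in> cell_points \<and>
    (a = b \<or> (\<exists>\<rho> q. move_kind \<rho> \<and> (move_at \<rho> q (encode a) (encode b) \<or> move_at \<rho> q (encode b) (encode a))))"
  using assms
proof cases
  case (R1 t t' e e' i j x)
  have size: "size_nodes t = size_nodes t'"
    using R1 size_nodes_corks_leaves[of t] size_nodes_corks_leaves[of t'] by simp
  then have dim: "dim_cell t = dim_cell t'"
    using R1 by (simp add: dim_cell_eq)
  have ij: "i \<in> {1..dim_cell t}" "j \<in> {1..dim_cell t'}"
    using number_in_range[of t e] number_in_range[of t' e'] R1 by simp_all
  then have cp: "a \<in> cell_points" "b \<in> cell_points"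
    using R1 dim face_in_cube[of x "dim_cell t" 0 i] face_in_cube[of x "dim_cell t'" 0 j]
    by (auto simp: cell_points_def)
  have uniq: "q = q' \<and> X = X' \<and> Y = Y' \<and> Z = Z' \<and> (\<forall>s. replace_at t q s = replace_at t' q' s)"
    if "subtree_at t q = Some u" "subtree_at t' q' = Some u'"
      "contract t e = replace_at t q (Node [X, Y, Z])"
      "contract t' e' = replace_at t' q' (Node [X', Y', Z'])" for q q' X Y Z X' Y' Z' u u'
    using that R1 by (intro replace_at_ternary_eq) auto
  have same: "a = b" if "t = t'" "e = e'"
    using R1 that by simp
  from \<open>binary t\<close> \<open>e \<in> inner_edges t\<close> \<open>e \<notin> corks t\<close> show ?thesis
  proof (cases rule: contract_eq)
    case L: (left q X Y Z)
    from \<open>binary t'\<close> \<open>e' \<in> inner_edges t'\<close> \<open>e' \<notin> corks t'\<close> show ?thesis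
    proof (cases rule: contract_eq)
      case L': (left q' X' Y' Z')
      have u: "q = q'" "X = X'" "Y = Y'" "Z = Z'" "\<forall>s. replace_at t q s = replace_at t' q' s"
        using uniq[OF L(2) L'(2) L(3) L'(3)] by auto
      have "t = t'"
        using replace_at_self[OF L(2)] replace_at_self[OF L'(2)] u by metis
      then show ?thesis
        using same L(1) L'(1) u cp by simp
    next
      case R': (right q' X' Y' Z')
      have u: "q = q'" "X = X'" "Y = Y'" "Z = Z'" "\<forall>s. replace_at t q s = replace_at t' q' s"
        using uniq[OF L(2) R'(2) L(3) R'(3)] by auto
      have t': "t' = replace_at t q (Node [X, Node [Y, Z]])"
        using replace_at_self[OF R'(2)] u by metis
      have "move_at rotation q (encode a) (encode b)"
        using rotation_props(3,5,6)[OF \<open>binary t\<close> L(2) \<open>x \<in> _\<close>] R1(1,2,12,13) L(1) R'(1) u(1) t'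
        by simp
      then show ?thesis
        using cp move_kind.intros(1) by blast
    qed
  next
    case R: (right q X Y Z)
    from \<open>binary t'\<close> \<open>e' \<in> inner_edges t'\<close> \<open>e' \<notin> corks t'\<close> show ?thesis
    proof (cases rule: contract_eq)
      case L': (left q' X' Y' Z')
      have u: "q = q'" "X = X'" "Y = Y'" "Z = Z'" "\<forall>s. replace_at t q s = replace_at t' q' s"
        using uniq[OF R(2) L'(2) R(3) L'(3)] by auto
      have t: "t = replace_at t' q (Node [X, Node [Y, Z]])"
        using replace_at_self[OF R(2)] u by metis
      have x': "x \<in> topspace (cube (dim_cell t' - 1))"
        using R1 dim by simp
      have "move_at rotation q (encode b) (encode a)"
        using rotation_props(3,5,6)[OF \<open>binary t'\<close> L'(2) x'] R1(1,2,12,13) R(1) L'(1) u t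
        by simp
      then show ?thesis
        using cp move_kind.intros(1) by blast
    next
      case R': (right q' X' Y' Z')
      have u: "q = q'" "X = X'" "Y = Y'" "Z = Z'" "\<forall>s. replace_at t q s = replace_at t' q' s"
        using uniq[OF R(2) R'(2) R(3) R'(3)] by auto
      have "t = t'"
        using replace_at_self[OF R(2)] replace_at_self[OF R'(2)] u by metis
      then show ?thesis
        using same R(1) R'(1) u cp by simp
    qed
  qed
next
  case (R2 t e i x y)
  obtain q d l r ts where e: "e = q @ [d]" "d \<in> {0, 1}" "subtree_at t q = Some (Node [l, r])"
    "(if d = 0 then l else r) = Node ts" "subtree_at t e = Some (Node ts)"
    using inner_edge_cases R2 by metis
  have "ts = []"
    using e(5) R2 by (simp add: corks_def)
  then have sub: "subtree_at t q = Some (cork_fork d (if d = 0 then r else l))"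
    using e by (auto simp: cork_fork_def split: if_splits)
  have i: "i \<in> {1..dim_cell t}"
    using number_in_range[of t e] R2 by simp
  then have cp: "(t, y) \<in> cell_points"
    using R2 face_in_cube[of x "dim_cell t" 0 i] by (auto simp: cell_points_def)
  have zero: "label t y (q @ [d]) = 0"
    using R2 i e(1) by (simp add: label_def face_def)
  show ?thesis
    using prune_props[OF cp e(2) sub zero] cp R2 e(1) move_kind.intros(2) by blast
qed

section \<open>Compact relations\<close>

text \<open>
  The composite is the image of the closed set of pairs of pairs whose middle entries agree.
\<close>

lemma compactin_relcomp:
  assumes X: "Hausdorff_space X"
    and A: "compactin (prod_topology X X) A" and B: "compactin (prod_topology X X) B"
  shows "compactin (prod_topology X X) (A O B)"
proof -
  let ?XX = "prod_topology X X"
  let ?D = "{z \<in> topspace (prod_topology ?XX ?XX). (snd (fst z), fst (snd z)) \<in> (\<lambda>x. (x, x)) ` topspace X}"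
  have "closedin (prod_topology ?XX ?XX) ?D"
    by (rule closedin_continuous_map_preimage[where Y = ?XX])
      (use X in \<open>auto simp: Hausdorff_space_closedin_diagonal[symmetric] intro!: continuous_intros
        continuous_map_compose[OF continuous_map_fst continuous_map_snd, unfolded o_def]
        continuous_map_compose[OF continuous_map_snd continuous_map_fst, unfolded o_def]\<close>)
  then have K: "compactin (prod_topology ?XX ?XX) ((A \<times> B) \<inter> ?D)"
    using A B by (intro compact_Int_closedin) (auto simp: compactin_Times)
  have "continuous_map (prod_topology ?XX ?XX) ?XX (\<lambda>z. (fst (fst z), snd (snd z)))"
    by (intro continuous_map_pairedI
        continuous_map_compose[OF continuous_map_fst continuous_map_fst, unfolded o_def]
        continuous_map_compose[OF continuous_map_snd continuous_map_snd, unfolded o_def])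
  from image_compactin[OF K this]
  have "compactin ?XX ((\<lambda>z. (fst (fst z), snd (snd z))) ` ((A \<times> B) \<inter> ?D))" .
  moreover have "(\<lambda>z. (fst (fst z), snd (snd z))) ` ((A \<times> B) \<inter> ?D) = A O B"
  proof (intro equalityI subsetI)
    fix z assume "z \<in> A O B"
    then obtain a b c where z: "z = (a, c)" "(a, b) \<in> A" "(b, c) \<in> B"
      by auto
    have "((a, b), (b, c)) \<in> (A \<times> B) \<inter> ?D"
      using z A B compactin_subset_topspace by fastforce
    then show "z \<in> (\<lambda>z. (fst (fst z), snd (snd z))) ` ((A \<times> B) \<inter> ?D)"
      unfolding z(1) by force
  qed auto
  ultimately show ?thesis
    by simp
qed

lemma compactin_relpow:
  assumes "Hausdorff_space X" "compactin (prod_topology X X) E"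
  shows "compactin (prod_topology X X) (E ^^ Suc k)"
  by (induction k) (use assms compactin_relcomp in auto)

text \<open>
  Every member of the chain is a union of classes of points with the same pattern, and each of the
  finitely many patterns enters at some index.
\<close>

lemma saturated_chain_stabilises:
  fixes A :: "nat \<Rightarrow> 'c set" and pat :: "'c \<Rightarrow> 'p"
  assumes mono: "incseq A" and fin: "finite (pat ` (\<Union>k. A k))"
    and sat: "\<And>k z z'. \<lbrakk>z \<in> A k; z' \<in> (\<Union>k. A k); pat z = pat z'\<rbrakk> \<Longrightarrow> z' \<in> A k"
  shows "\<exists>K. (\<Union>k. A k) = A K"
proof -
  define first where "first p = (LEAST k. p \<in> pat ` A k)" for p
  define K where "K = Max (insert 0 (first ` pat ` (\<Union>k. A k)))"
  have "z \<in> A K" if z: "z \<in> (\<Union>k. A k)" for z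
  proof -
    have "\<exists>k. pat z \<in> pat ` A k"
      using z by blast
    then have "pat z \<in> pat ` A (first (pat z))"
      unfolding first_def by (rule LeastI_ex)
    moreover have "first (pat z) \<le> K"
      unfolding K_def using z fin by (intro Max_ge) auto
    ultimately obtain z' where "z' \<in> A K" "pat z' = pat z"
      using mono by (metis imageE incseqD subsetD)
    then show ?thesis
      using sat z by blast
  qed
  then show ?thesis
    by blast
qed

text \<open>
  A step function interpolates: its value at \<open>s\<close> is the largest of the values prescribed at
  points up to \<open>s\<close>, or 0.
\<close>

lemma monotone_transport:
  fixes v v' :: "nat \<Rightarrow> real"
  assumes ord: "\<And>i j. \<lbrakk>i < n; j < n\<rbrakk> \<Longrightarrow> v i \<le> v j \<longleftrightarrow> v' i \<le> v' j"
    and pos: "\<And>i. i < n \<Longrightarrow> 0 \<le> v' i"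
  obtains g where "mono g" "\<And>i. i < n \<Longrightarrow> g (v i) = v' i"
proof
  define g where "g s = Max (insert 0 (v' ` {i. i < n \<and> v i \<le> s}))" for s
  show "mono g"
    unfolding g_def by (intro monoI Max_mono) auto
  show "g (v i) = v' i" if "i < n" for i
    unfolding g_def using that pos[OF that] ord by (intro Max_eqI) auto
qed

section \<open>Finitely many cells\<close>

definition trees :: "nat \<Rightarrow> nat \<Rightarrow> ptree set" where
  "trees n m = {t. binary t \<and> card (leaves t) = n \<and> card (corks t) \<le> m}"

definition piece :: "nat \<Rightarrow> nat \<Rightarrow> (ptree \<times> (nat \<Rightarrow> real)) set" where
  "piece n m = {a \<in> cell_points. fst a \<in> trees n m}"

lemma finite_binary_trees: "finite {t. binary t \<and> size_nodes t \<le> N}"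
proof (induction N)
  case 0
  have "{t. binary t \<and> size_nodes t \<le> 0} \<subseteq> {Leaf}"
    using size_nodes_pos by fastforce
  then show ?case
    by (rule finite_subset) simp
next
  case (Suc N)
  let ?T = "{t. binary t \<and> size_nodes t \<le> N}"
  have "{t. binary t \<and> size_nodes t \<le> Suc N} \<subseteq>
      {Leaf, Node []} \<union> (\<lambda>(l, r). Node [l, r]) ` (?T \<times> ?T)"
  proof
    fix t assume t: "t \<in> {t. binary t \<and> size_nodes t \<le> Suc N}"
    then have "binary t" by simp
    then show "t \<in> {Leaf, Node []} \<union> (\<lambda>(l, r). Node [l, r]) ` (?T \<times> ?T)"
      using t by (cases rule: binary_cases) auto
  qed
  then show ?case
    using Suc by (auto intro: finite_subset)
qed

lemma finite_trees: "finite (trees n m)"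
proof (rule finite_subset)
  show "trees n m \<subseteq> {t. binary t \<and> size_nodes t \<le> 2 * m + n}"
    unfolding trees_def using size_nodes_corks_leaves by fastforce
qed (rule finite_binary_trees)

lemma topspace_cells_piece: "topspace (cells n) = (\<Union>m. piece n m)"
  by (auto simp: topspace_cells piece_def trees_def cell_points_def)

lemma piece_mono: "m \<le> k \<Longrightarrow> piece n m \<subseteq> piece n k"
  by (auto simp: piece_def trees_def)

lemma Hausdorff_cube: "Hausdorff_space (cube n)"
  unfolding cube_def Hausdorff_space_product_topology
  by (simp add: Hausdorff_space_subtopology)

lemma compact_cube: "compact_space (cube n)"
  unfolding cube_def compact_space_product_topology
  by (simp add: compact_space_subtopology)

lemma openin_cell:
  assumes "binary t" "card (leaves t) = n" "openin (cube (dim_cell t)) U"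
  shows "openin (cells n) (Pair t ` U)"
  using open_map_component_injection[of t "{t. binary t \<and> card (leaves t) = n}" "\<lambda>t. cube (dim_cell t)"] assms
  unfolding cells_def open_map_def by simp

lemma continuous_map_cell:
  assumes "binary t" "card (leaves t) = n"
  shows "continuous_map (cube (dim_cell t)) (cells n) (Pair t)"
  using continuous_map_component_injection[of t "{t. binary t \<and> card (leaves t) = n}" "\<lambda>t. cube (dim_cell t)"] assms
  unfolding cells_def by simp

lemma Hausdorff_cells: "Hausdorff_space (cells n)"
  unfolding Hausdorff_space_def
proof (intro allI impI, elim conjE)
  fix a b assume a: "a \<in> topspace (cells n)" and b: "b \<in> topspace (cells n)" and "a \<noteq> b"
  obtain t x s y where ab: "a = (t, x)" "b = (s, y)"
    by (cases a, cases b)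
  have t: "binary t" "card (leaves t) = n" "x \<in> topspace (cube (dim_cell t))"
    and s: "binary s" "card (leaves s) = n" "y \<in> topspace (cube (dim_cell s))"
    using a b ab by (auto simp: topspace_cells cell_points_def)
  show "\<exists>U V. openin (cells n) U \<and> openin (cells n) V \<and> a \<in> U \<and> b \<in> V \<and> disjnt U V"
  proof (cases "t = s")
    case True
    then have "x \<noteq> y"
      using \<open>a \<noteq> b\<close> ab by simp
    then obtain U V where "openin (cube (dim_cell t)) U" "openin (cube (dim_cell t)) V"
        "x \<in> U" "y \<in> V" "disjnt U V"
      using Hausdorff_cube t s True unfolding Hausdorff_space_def by metis
    then show ?thesis
      using ab t s True
      by (intro exI[of _ "Pair t ` U"] exI[of _ "Pair t ` V"]) (auto simp: openin_cell disjnt_iff)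
  next
    case False
    then show ?thesis
      using ab t s
      by (intro exI[of _ "Pair t ` topspace (cube (dim_cell t))"]
          exI[of _ "Pair s ` topspace (cube (dim_cell s))"]) (auto simp: openin_cell disjnt_iff)
  qed
qed

lemma piece_eq: "piece n m = (\<Union>t\<in>trees n m. Pair t ` topspace (cube (dim_cell t)))"
  by (auto simp: piece_def cell_points_def trees_def)

lemma openin_piece: "openin (cells n) (piece n m)"
  unfolding piece_eq by (rule openin_Union) (auto simp: openin_cell trees_def)

lemma compactin_cell_image:
  assumes "continuous_map (cube k) X f"
  shows "compactin X (f ` topspace (cube k))"
  using compact_cube[of k] assms unfolding compact_space_def by (rule image_compactin)

lemma compactin_piece: "compactin (cells n) (piece n m)"
  unfolding piece_eq
proof (rule compactin_Union)
  show "finite ((\<lambda>t. Pair t ` topspace (cube (dim_cell t))) ` trees n m)"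
    using finite_trees by simp
qed (auto simp: trees_def intro!: compactin_cell_image continuous_map_cell)

section \<open>Continuity of the face maps and of pruning\<close>

lemma continuous_map_coordinate: "continuous_map (cube n) euclideanreal (\<lambda>x. x l)"
proof (cases "l \<in> {1..n}")
  case True
  then have "continuous_map (cube n) (top_of_set {0..1}) (\<lambda>x. x l)"
    unfolding cube_def by (rule continuous_map_product_projection)
  then show ?thesis
    by (rule continuous_map_into_fulltopology)
next
  case False
  have "continuous_map (cube n) euclideanreal (\<lambda>x. undefined)"
    by simp
  then show ?thesis
    by (rule continuous_map_eq) (use False in \<open>auto simp: topspace_cube PiE_iff extensional_def\<close>)
qed

lemma continuous_map_into_cube:
  assumes "\<And>z. z \<in> topspace X \<Longrightarrow> f z \<in> topspace (cube n)"
    and "\<And>l. l \<in> {1..n} \<Longrightarrow> continuous_map X euclideanreal (\<lambda>z. f z l)"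
  shows "continuous_map X (cube n) f"
  unfolding cube_def continuous_map_componentwise
proof (intro conjI ballI)
  show "f ` topspace X \<subseteq> extensional {1..n}"
    using assms(1) by (auto simp: topspace_cube PiE_iff)
  fix l assume l: "l \<in> {1..n}"
  then have "f z l \<in> {0..1}" if "z \<in> topspace X" for z
    using assms(1)[OF that] by (auto simp: topspace_cube PiE_iff)
  then show "continuous_map X (top_of_set {0..1}) (\<lambda>z. f z l)"
    using assms(2)[OF l] by (auto simp: continuous_map_in_subtopology)
qed

lemma continuous_map_face:
  assumes "c \<in> {0..1}" "i \<in> {1..n}"
  shows "continuous_map (cube (n - 1)) (cube n) (face c n i)"
proof (rule continuous_map_into_cube)
  show "face c n i x \<in> topspace (cube n)" if "x \<in> topspace (cube (n - 1))" for x
    using face_in_cube that assms .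
  show "continuous_map (cube (n - 1)) euclideanreal (\<lambda>x. face c n i x l)" if "l \<in> {1..n}" for l
    using that by (auto simp: face_def continuous_map_coordinate)
qed

lemma continuous_map_prune_label:
  "continuous_map (cube n) euclideanreal (\<lambda>y. prune_label t e y f)"
  unfolding prune_label_def label_def Let_def
  by (auto intro!: continuous_map_real_max continuous_map_coordinate)

section \<open>The relation on finitely many cells is closed\<close>

lemma identified_cells:
  assumes "identified a b"
  shows "a \<in> cell_points" "b \<in> cell_points" "card (leaves (fst a)) = card (leaves (fst b))"
proof -
  note m = moves_if_identified[OF assms]
  then show cp: "a \<in> cell_points" "b \<in> cell_points"
    by auto
  then have lc: "leaf_count (encode a) = card (leaves (fst a))" "leaf_count (encode b) = card (leaves (fst b))"
    by (auto simp: cell_points_def leaf_count_encode)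
  show "card (leaves (fst a)) = card (leaves (fst b))"
    using m move_at_leaf_count lc by metis
qed

definition identified_in :: "nat \<Rightarrow> nat \<Rightarrow> ((ptree \<times> (nat \<Rightarrow> real)) \<times> (ptree \<times> (nat \<Rightarrow> real))) set" where
  "identified_in n m = {(a, b). a \<in> piece n m \<and> b \<in> piece n m \<and> identified a b}"

definition linked_in :: "nat \<Rightarrow> nat \<Rightarrow> ((ptree \<times> (nat \<Rightarrow> real)) \<times> (ptree \<times> (nat \<Rightarrow> real))) set" where
  "linked_in n m = Id_on (piece n m) \<union> identified_in n m \<union> (identified_in n m)\<inverse>"

text \<open>
  A finite union of images of cubes, indexed by the combinatorial data of (R1) and (R2); this is
  the form in which compactness can be seen.
\<close>

lemma identified_in_eq:
  "identified_in n m =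
    (\<Union>(t, t', e, e') \<in> {(t, t', e, e'). t \<in> trees n m \<and> t' \<in> trees n m \<and>
          card (corks t) = card (corks t') \<and> e \<in> inner_edges t - corks t \<and> e' \<in> inner_edges t' - corks t' \<and>
          contract t e = contract t' e'}.
        (\<lambda>x. ((t, face 0 (dim_cell t) (number_in (inner_edges t) e) x),
              (t', face 0 (dim_cell t') (number_in (inner_edges t') e') x))) `
          topspace (cube (dim_cell t - 1))) \<union>
    (\<Union>(t, e) \<in> {(t, e). t \<in> trees n m \<and> e \<in> inner_edges t \<inter> corks t \<and> prune t e \<in> trees n m}.
        (\<lambda>x. ((t, face 0 (dim_cell t) (number_in (inner_edges t) e) x),
              (prune t e, prune_point t e (face 0 (dim_cell t) (number_in (inner_edges t) e) x)))) `
          topspace (cube (dim_cell t - 1)))" (is "_ = ?A \<union> ?B")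
proof (intro equalityI subsetI)
  fix z assume "z \<in> identified_in n m"
  then obtain a b where z: "z = (a, b)" "a \<in> piece n m" "b \<in> piece n m" "identified a b"
    by (auto simp: identified_in_def)
  from z(4) show "z \<in> ?A \<union> ?B"
  proof cases
    case (R1 t t' e e' i j x)
    then have "((t, t', e, e'), x) \<in> (SIGMA (t, t', e, e') : {(t, t', e, e'). t \<in> trees n m \<and> t' \<in> trees n m \<and>
          card (corks t) = card (corks t') \<and> e \<in> inner_edges t - corks t \<and> e' \<in> inner_edges t' - corks t' \<and>
          contract t e = contract t' e'}. topspace (cube (dim_cell t - 1)))"
      using z by (auto simp: piece_def)
    then show ?thesis
      using R1(1,2,12,13) z(1) by (intro UnI1 UN_I[of "(t, t', e, e')"]) auto
  next
    case (R2 t e i x y)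
    then show ?thesis
      using z by (intro UnI2 UN_I[of "(t, e)"]) (auto simp: piece_def)
  qed
next
  fix z assume "z \<in> ?A \<union> ?B"
  then show "z \<in> identified_in n m"
  proof
    assume "z \<in> ?A"
    then obtain t t' e e' x where tx: "t \<in> trees n m" "t' \<in> trees n m"
        "card (corks t) = card (corks t')" "e \<in> inner_edges t - corks t" "e' \<in> inner_edges t' - corks t'"
        "contract t e = contract t' e'" "x \<in> topspace (cube (dim_cell t - 1))"
        "z = ((t, face 0 (dim_cell t) (number_in (inner_edges t) e) x),
              (t', face 0 (dim_cell t') (number_in (inner_edges t') e') x))"
      by auto
    then have "identified (fst z) (snd z)"
      using identified.R1[OF _ _ _ tx(3) _ _ _ _ tx(6) refl refl tx(7)] by (simp add: trees_def)
    then show ?thesis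
      using identified_cells tx by (auto simp: identified_in_def piece_def)
  next
    assume "z \<in> ?B"
    then obtain t e x where tx: "t \<in> trees n m" "e \<in> inner_edges t \<inter> corks t" "prune t e \<in> trees n m"
        "x \<in> topspace (cube (dim_cell t - 1))"
        "z = ((t, face 0 (dim_cell t) (number_in (inner_edges t) e) x),
              (prune t e, prune_point t e (face 0 (dim_cell t) (number_in (inner_edges t) e) x)))"
      by auto
    then have "identified (fst z) (snd z)"
      using identified.R2[OF _ _ _ refl tx(4) refl] by (simp add: trees_def)
    then show ?thesis
      using identified_cells tx by (auto simp: identified_in_def piece_def)
  qed
qed

lemma continuous_map_identified:
  assumes t: "binary t" "card (leaves t) = n" "e \<in> inner_edges t"
    and t': "binary t'" "card (leaves t') = n" and k: "k = dim_cell t - 1"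
    and f: "continuous_map (cube k) (cube (dim_cell t')) f"
  shows "continuous_map (cube k) (prod_topology (cells n) (cells n))
    (\<lambda>x. ((t, face 0 (dim_cell t) (number_in (inner_edges t) e) x), (t', f x)))"
proof (rule continuous_map_pairedI)
  show "continuous_map (cube k) (cells n) (\<lambda>x. (t, face 0 (dim_cell t) (number_in (inner_edges t) e) x))"
    using continuous_map_compose[OF continuous_map_face continuous_map_cell[OF t(1,2)],
        of 0 "number_in (inner_edges t) e"] number_in_range[OF t(1,3)]
    by (simp add: o_def k)
  show "continuous_map (cube k) (cells n) (\<lambda>x. (t', f x))"
    using continuous_map_compose[OF f continuous_map_cell[OF t']] by (simp add: o_def)
qed

lemma finite_inner_edges: "t \<in> trees n m \<Longrightarrow> finite (inner_edges t)"
  by (simp add: trees_def inner_edges_eq)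

lemma compactin_identified_in:
  "compactin (prod_topology (cells n) (cells n)) (identified_in n m)"
proof -
  have fin1: "finite {(t, t', e, e'). t \<in> trees n m \<and> t' \<in> trees n m \<and>
          card (corks t) = card (corks t') \<and> e \<in> inner_edges t - corks t \<and> e' \<in> inner_edges t' - corks t' \<and>
          contract t e = contract t' e'}" (is "finite ?I")
  proof (rule finite_subset)
    let ?E = "\<Union>t\<in>trees n m. inner_edges t"
    show "?I \<subseteq> trees n m \<times> trees n m \<times> ?E \<times> ?E"
      by auto
    show "finite (trees n m \<times> trees n m \<times> ?E \<times> ?E)"
      using finite_trees finite_inner_edges by (intro finite_cartesian_product finite_UN_I) auto
  qed
  have fin2: "finite {(t, e). t \<in> trees n m \<and> e \<in> inner_edges t \<inter> corks t \<and> prune t e \<in> trees n m}" (is "finite ?J")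
  proof (rule finite_subset)
    let ?E = "\<Union>t\<in>trees n m. inner_edges t"
    show "?J \<subseteq> trees n m \<times> ?E"
      by auto
    show "finite (trees n m \<times> ?E)"
      using finite_trees finite_inner_edges by (intro finite_cartesian_product finite_UN_I) auto
  qed
  show ?thesis
    unfolding identified_in_eq
  proof (intro compactin_Un compactin_Union)
    fix S assume "S \<in> (\<lambda>(t, t', e, e').
        (\<lambda>x. ((t, face 0 (dim_cell t) (number_in (inner_edges t) e) x),
              (t', face 0 (dim_cell t') (number_in (inner_edges t') e') x))) `
          topspace (cube (dim_cell t - 1))) ` ?I"
    then obtain t t' e e' where t: "t \<in> trees n m" "t' \<in> trees n m"
          "card (corks t) = card (corks t')" "e \<in> inner_edges t" "e' \<in> inner_edges t'"
        and S: "S = (\<lambda>x. ((t, face 0 (dim_cell t) (number_in (inner_edges t) e) x),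
              (t', face 0 (dim_cell t') (number_in (inner_edges t') e') x))) `
          topspace (cube (dim_cell t - 1))"
      by auto
    have "dim_cell t = dim_cell t'"
      using t by (simp add: dim_cell_def trees_def)
    then have "continuous_map (cube (dim_cell t - 1)) (cube (dim_cell t'))
        (face 0 (dim_cell t') (number_in (inner_edges t') e'))"
      using continuous_map_face[of 0 "number_in (inner_edges t') e'" "dim_cell t'"]
        number_in_range[of t' e'] t by (simp add: trees_def)
    then show "compactin (prod_topology (cells n) (cells n)) S"
      unfolding S using t
      by (intro compactin_cell_image continuous_map_identified) (auto simp: trees_def)
  next
    fix S assume "S \<in> (\<lambda>(t, e).
        (\<lambda>x. ((t, face 0 (dim_cell t) (number_in (inner_edges t) e) x),
              (prune t e, prune_point t e (face 0 (dim_cell t) (number_in (inner_edges t) e) x)))) `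
          topspace (cube (dim_cell t - 1))) ` ?J"
    then obtain t e where t: "t \<in> trees n m" "e \<in> inner_edges t" "e \<in> corks t" "prune t e \<in> trees n m"
        and S: "S = (\<lambda>x. ((t, face 0 (dim_cell t) (number_in (inner_edges t) e) x),
              (prune t e, prune_point t e (face 0 (dim_cell t) (number_in (inner_edges t) e) x)))) `
          topspace (cube (dim_cell t - 1))"
      by auto
    let ?face = "face 0 (dim_cell t) (number_in (inner_edges t) e)"
    have face: "continuous_map (cube (dim_cell t - 1)) (cube (dim_cell t)) ?face"
      using t by (intro continuous_map_face number_in_range) (auto simp: trees_def)
    have "continuous_map (cube (dim_cell t - 1)) (cube (dim_cell (prune t e))) (\<lambda>x. prune_point t e (?face x))"
    proof (rule continuous_map_into_cube)
      fix x assume "x \<in> topspace (cube (dim_cell t - 1))"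
      then have "identified (t, ?face x) (prune t e, prune_point t e (?face x))"
        using identified.R2[OF _ t(2,3) refl _ refl] t by (simp add: trees_def)
      then show "prune_point t e (?face x) \<in> topspace (cube (dim_cell (prune t e)))"
        using identified_cells(2) by (fastforce simp: cell_points_def)
    next
      fix l assume l: "l \<in> {1..dim_cell (prune t e)}"
      have "continuous_map (cube (dim_cell t - 1)) euclideanreal
          (\<lambda>x. prune_label t e (?face x) (nth_of (inner_edges (prune t e)) l))"
        using continuous_map_compose[OF face continuous_map_prune_label] by (simp add: o_def)
      then show "continuous_map (cube (dim_cell t - 1)) euclideanreal (\<lambda>x. prune_point t e (?face x) l)"
        using l by (simp add: prune_point_def)
    qed
    then show "compactin (prod_topology (cells n) (cells n)) S"
      unfolding S using t
      by (intro compactin_cell_image continuous_map_identified) (auto simp: trees_def)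
  qed (use fin1 fin2 in auto)
qed

lemma compactin_linked_in:
  "compactin (prod_topology (cells n) (cells n)) (linked_in n m)"
  unfolding linked_in_def
proof (intro compactin_Un compactin_identified_in)
  have "continuous_map (cells n) (prod_topology (cells n) (cells n)) (\<lambda>a. (a, a))"
    by (intro continuous_map_pairedI) auto
  from image_compactin[OF compactin_piece this, of m]
  show "compactin (prod_topology (cells n) (cells n)) (Id_on (piece n m))"
    by (rule back_subst[of "compactin _"]) (auto simp: Id_on_def)
  have "continuous_map (prod_topology (cells n) (cells n)) (prod_topology (cells n) (cells n)) (\<lambda>z. (snd z, fst z))"
    by (intro continuous_map_pairedI continuous_map_fst continuous_map_snd)
  from image_compactin[OF compactin_identified_in this, of m]
  show "compactin (prod_topology (cells n) (cells n)) ((identified_in n m)\<inverse>)"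
    by (rule back_subst[of "compactin _"]) force
qed

fun relabel :: "(real \<Rightarrow> real) \<Rightarrow> ptree \<times> (nat \<Rightarrow> real) \<Rightarrow> ptree \<times> (nat \<Rightarrow> real)" where
  "relabel g (t, x) = (t, \<lambda>l\<in>{1..dim_cell t}. g (x l))"

lemma map_numbered: "binary t \<Longrightarrow> map_ltree g (numbered t x k) = numbered t (\<lambda>i. g (x i)) k"
  by (induction t arbitrary: k rule: binary_induct) simp_all

lemma relabel_props:
  assumes "mono g" "g 0 = 0" "g 1 = 1" "a \<in> cell_points"
  shows "relabel g a \<in> cell_points" "encode (relabel g a) = map_ltree g (encode a)"
    and "fst (relabel g a) = fst a"
proof -
  obtain t x where a: "a = (t, x)" by (cases a)
  have t: "binary t" and x: "x \<in> {1..dim_cell t} \<rightarrow>\<^sub>E {0..1}"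
    using assms(4) a by (auto simp: cell_points_def topspace_cube)
  have "g (x l) \<in> {0..1}" if "l \<in> {1..dim_cell t}" for l
    using monoD[OF assms(1), of 0 "x l"] monoD[OF assms(1), of "x l" 1] x that assms(2,3)
    by (auto simp: PiE_iff)
  then show "relabel g a \<in> cell_points"
    using a t by (auto simp: cell_points_def topspace_cube)
  show "encode (relabel g a) = map_ltree g (encode a)"
    unfolding a relabel.simps encode_numbered[OF t] map_numbered[OF t]
  proof (rule numbered_cong[OF t])
    fix i assume "i < 0 + size_nodes t"
    then show "((\<lambda>l\<in>{1..dim_cell t}. g (x l))(0 := 1)) i = g ((x(0 := 1)) i)"
      using assms(3) t by (auto simp: dim_cell_eq)
  qed
  show "fst (relabel g a) = fst a"
    by (simp add: a)
qed

text \<open>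
  The relation has the same symmetry as the moves to which it is equivalent.
\<close>

lemma linked_in_relabel:
  assumes g: "mono g" "g 0 = 0" "g 1 = 1" and ab: "(a, b) \<in> linked_in n m"
  shows "(relabel g a, relabel g b) \<in> linked_in n m"
proof -
  have id: "(relabel g a, relabel g b) \<in> linked_in n m" if ab: "(a, b) \<in> identified_in n m" for a b
  proof -
    have i: "identified a b" and p: "a \<in> piece n m" "b \<in> piece n m"
      using ab by (auto simp: identified_in_def)
    have cp: "a \<in> cell_points" "b \<in> cell_points"
      using p by (auto simp: piece_def)
    note ra = relabel_props[OF g cp(1)] and rb = relabel_props[OF g cp(2)]
    have pr: "relabel g a \<in> piece n m" "relabel g b \<in> piece n m"
      using p ra rb by (auto simp: piece_def)
    from moves_if_identified[OF i] consider "a = b"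
      | \<rho> q where "move_kind \<rho>" "move_at \<rho> q (encode a) (encode b)"
      | \<rho> q where "move_kind \<rho>" "move_at \<rho> q (encode b) (encode a)"
      by blast
    then show ?thesis
    proof cases
      case 1
      then show ?thesis
        using pr by (auto simp: linked_in_def)
    next
      case 2
      then have "identified (relabel g a) (relabel g b)"
        using identified_if_move[OF 2(1) ra(1) rb(1)] move_at_map[OF 2(1) g(1,2) 2(2)] ra(2) rb(2) by simp
      then show ?thesis
        using pr by (auto simp: linked_in_def identified_in_def)
    next
      case 3
      then have "identified (relabel g b) (relabel g a)"
        using identified_if_move[OF 3(1) rb(1) ra(1)] move_at_map[OF 3(1) g(1,2) 3(2)] ra(2) rb(2) by simp
      then show ?thesis
        using pr by (auto simp: linked_in_def identified_in_def)
    qed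
  qed
  have sym: "(b, a) \<in> linked_in n m" if "(a, b) \<in> linked_in n m" for a b
    using that by (auto simp: linked_in_def)
  consider "a = b" "a \<in> piece n m" | "(a, b) \<in> identified_in n m" | "(b, a) \<in> identified_in n m"
    using ab by (auto simp: linked_in_def)
  then show ?thesis
  proof cases
    case 1
    then have "relabel g a \<in> piece n m"
      using relabel_props[OF g, of a] by (simp add: piece_def)
    then show ?thesis
      using 1 by (auto simp: linked_in_def)
  qed (use id sym in blast)+
qed

lemma linked_in_relpow_relabel:
  assumes g: "mono g" "g 0 = 0" "g 1 = 1"
  shows "(a, b) \<in> linked_in n m ^^ Suc k \<Longrightarrow> (relabel g a, relabel g b) \<in> linked_in n m ^^ Suc k"
proof (induction k arbitrary: b)
  case 0
  then show ?case
    using linked_in_relabel[OF g] by simp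
next
  case (Suc k)
  then obtain c where "(a, c) \<in> linked_in n m ^^ Suc k" "(c, b) \<in> linked_in n m"
    by (metis relpow_Suc_E)
  then show ?case
    using Suc.IH linked_in_relabel[OF g] by (metis relpow_Suc_I)
qed

text \<open>
  The constants 0 and 1 followed by all labels of two points. The constants are included so that a
  function that matches up two such lists fixes them.
\<close>

fun pair_labels :: "(ptree \<times> (nat \<Rightarrow> real)) \<times> (ptree \<times> (nat \<Rightarrow> real)) \<Rightarrow> nat \<Rightarrow> real" where
  "pair_labels ((t, x), (s, y)) i =
    (if i = 0 then 0 else if i = 1 then 1
     else if i < dim_cell t + 2 then x (i - 1) else y (i - 1 - dim_cell t))"

definition pair_size :: "(ptree \<times> (nat \<Rightarrow> real)) \<times> (ptree \<times> (nat \<Rightarrow> real)) \<Rightarrow> nat" where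
  "pair_size z = dim_cell (fst (fst z)) + dim_cell (fst (snd z)) + 2"

definition order_pattern ::
  "(ptree \<times> (nat \<Rightarrow> real)) \<times> (ptree \<times> (nat \<Rightarrow> real)) \<Rightarrow> ptree \<times> ptree \<times> (nat \<times> nat) set" where
  "order_pattern z = (fst (fst z), fst (snd z),
     {(i, j). i < pair_size z \<and> j < pair_size z \<and> pair_labels z i \<le> pair_labels z j})"

text \<open>
  Any two pairs with the same pattern differ by a monotone change of labels fixing 0 and 1.
\<close>

lemma same_pattern_relabel:
  assumes cp: "a \<in> cell_points" "b \<in> cell_points" "a' \<in> cell_points" "b' \<in> cell_points"
    and pat: "order_pattern (a, b) = order_pattern (a', b')"
  obtains g where "mono g" "g 0 = 0" "g 1 = 1" "relabel g a = a'" "relabel g b = b'"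
proof -
  obtain t x s y where ab: "a = (t, x)" "b = (s, y)"
    by (cases a, cases b)
  obtain x' y' where ab': "a' = (t, x')" "b' = (s, y')"
    using pat ab by (cases a', cases b') (auto simp: order_pattern_def)
  let ?v = "pair_labels (a, b)" and ?v' = "pair_labels (a', b')"
  let ?n = "dim_cell t + dim_cell s + 2"
  have cubes: "x \<in> {1..dim_cell t} \<rightarrow>\<^sub>E {0..1}" "x' \<in> {1..dim_cell t} \<rightarrow>\<^sub>E {0..1}"
     "y \<in> {1..dim_cell s} \<rightarrow>\<^sub>E {0..1}" "y' \<in> {1..dim_cell s} \<rightarrow>\<^sub>E {0..1}"
    using cp ab ab' by (auto simp: cell_points_def topspace_cube)
  have "?v i \<le> ?v j \<longleftrightarrow> ?v' i \<le> ?v' j" if ij: "i < ?n" "j < ?n" for i j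
  proof -
    have "{(i, j). i < ?n \<and> j < ?n \<and> ?v i \<le> ?v j} = {(i, j). i < ?n \<and> j < ?n \<and> ?v' i \<le> ?v' j}"
      using pat by (simp add: order_pattern_def pair_size_def ab ab')
    then have "(i, j) \<in> {(i, j). i < ?n \<and> j < ?n \<and> ?v i \<le> ?v j} \<longleftrightarrow>
        (i, j) \<in> {(i, j). i < ?n \<and> j < ?n \<and> ?v' i \<le> ?v' j}"
      by (rule arg_cong)
    then show ?thesis
      using ij by simp
  qed
  moreover have "0 \<le> ?v' i" if i: "i < ?n" for i
  proof -
    have "0 \<le> x' l" if "1 \<le> l" "l \<le> dim_cell t" for l
      using cubes(2) that by (auto simp: PiE_iff)
    moreover have "0 \<le> y' l" if "1 \<le> l" "l \<le> dim_cell s" for l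
      using cubes(4) that by (auto simp: PiE_iff)
    ultimately show ?thesis
      using i by (auto simp: ab')
  qed
  ultimately obtain g where g: "mono g" "\<And>i. i < ?n \<Longrightarrow> g (?v i) = ?v' i"
    using monotone_transport[of ?n ?v ?v'] by blast
  have "g 0 = 0" "g 1 = 1"
    using g(2)[of 0] g(2)[of 1] by (simp_all add: ab ab')
  moreover have "(\<lambda>l\<in>{1..dim_cell t}. g (x l)) = x'"
  proof
    show "(\<lambda>l\<in>{1..dim_cell t}. g (x l)) l = x' l" for l
      using g(2)[of "l + 1"] cubes(2)
      by (cases "l \<in> {1..dim_cell t}") (auto simp: ab ab' PiE_iff extensional_def)
  qed
  moreover have "(\<lambda>l\<in>{1..dim_cell s}. g (y l)) = y'"
  proof
    show "(\<lambda>l\<in>{1..dim_cell s}. g (y l)) l = y' l" for l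
      using g(2)[of "l + 1 + dim_cell t"] cubes(4)
      by (cases "l \<in> {1..dim_cell s}") (auto simp: ab ab' PiE_iff extensional_def)
  qed
  ultimately show thesis
    using g(1) by (intro that[of g]) (simp_all add: ab ab')
qed

lemma linked_in_subset: "linked_in n m \<subseteq> piece n m \<times> piece n m"
  by (auto simp: linked_in_def identified_in_def)

lemma relpow_Suc_subset:
  assumes "E \<subseteq> A \<times> A"
  shows "E ^^ Suc k \<subseteq> A \<times> A"
  by (induction k) (use assms in auto)

text \<open>
  Since membership in a power of \<open>linked_in n m\<close> only depends on the pattern, the increasing
  sequence of powers becomes constant, so that its union is one of these compact powers.
\<close>

lemma closedin_trancl_linked_in:
  "closedin (prod_topology (cells n) (cells n)) ((linked_in n m)\<^sup>+)"
proof -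
  let ?E = "linked_in n m" and ?P = "piece n m"
  have "\<exists>K. (\<Union>k. ?E ^^ Suc k) = ?E ^^ Suc K"
  proof (rule saturated_chain_stabilises[where pat = order_pattern])
    show "incseq (\<lambda>k. ?E ^^ Suc k)"
    proof (rule incseq_SucI, rule subrelI)
      fix k a b assume ab: "(a, b) \<in> ?E ^^ Suc k"
      then have "b \<in> ?P"
        using relpow_Suc_subset[OF linked_in_subset] by blast
      then have "(b, b) \<in> ?E"
        by (auto simp: linked_in_def)
      with ab show "(a, b) \<in> ?E ^^ Suc (Suc k)"
        by (rule relpow_Suc_I)
    qed
    let ?S = "\<lambda>t s. Pow ({..<dim_cell t + dim_cell s + 2} \<times> {..<dim_cell t + dim_cell s + 2})"
    have "order_pattern z \<in> (SIGMA t:trees n m. SIGMA s:trees n m. ?S t s)" if "z \<in> ?P \<times> ?P" for z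
      using that by (auto simp: order_pattern_def pair_size_def piece_def)
    then have "order_pattern ` (\<Union>k. ?E ^^ Suc k) \<subseteq> (SIGMA t:trees n m. SIGMA s:trees n m. ?S t s)"
      using relpow_Suc_subset[OF linked_in_subset] by blast
    moreover have "finite (SIGMA t:trees n m. SIGMA s:trees n m. ?S t s)"
      using finite_trees by (intro finite_SigmaI) auto
    ultimately show "finite (order_pattern ` (\<Union>k. ?E ^^ Suc k))"
      by (rule finite_subset)
    fix k z z' assume z: "z \<in> ?E ^^ Suc k" "z' \<in> (\<Union>k. ?E ^^ Suc k)" "order_pattern z = order_pattern z'"
    obtain a b a' b' where ab: "z = (a, b)" "z' = (a', b')"
      by (cases z, cases z')
    have "a \<in> ?P" "b \<in> ?P" "a' \<in> ?P" "b' \<in> ?P"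
      using z ab relpow_Suc_subset[OF linked_in_subset] by blast+
    then have "a \<in> cell_points" "b \<in> cell_points" "a' \<in> cell_points" "b' \<in> cell_points"
      by (auto simp: piece_def)
    then obtain g where "mono g" "g 0 = 0" "g 1 = 1" "relabel g a = a'" "relabel g b = b'"
      using same_pattern_relabel z(3) ab by metis
    then show "z' \<in> ?E ^^ Suc k"
      using linked_in_relpow_relabel z(1) ab by metis
  qed
  then obtain K where K: "(\<Union>k. ?E ^^ Suc k) = ?E ^^ Suc K" ..
  have "?E\<^sup>+ = (\<Union>k. ?E ^^ Suc k)"
  proof (intro equalityI subsetI)
    fix z assume "z \<in> ?E\<^sup>+"
    then obtain k where "0 < k" "z \<in> ?E ^^ k"
      by (auto simp only: trancl_power)
    then show "z \<in> (\<Union>k. ?E ^^ Suc k)"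
      by (cases k) (simp, blast)
  next
    fix z assume "z \<in> (\<Union>k. ?E ^^ Suc k)"
    then obtain k where "z \<in> ?E ^^ Suc k"
      by blast
    then show "z \<in> ?E\<^sup>+"
      unfolding trancl_power by blast
  qed
  then have "?E\<^sup>+ = ?E ^^ Suc K"
    by (simp only: K)
  moreover have "compactin (prod_topology (cells n) (cells n)) (?E ^^ Suc K)"
    by (rule compactin_relpow[OF Hausdorff_cells compactin_linked_in])
  moreover have "Hausdorff_space (prod_topology (cells n) (cells n))"
    using Hausdorff_cells by (simp add: Hausdorff_space_prod_topology)
  ultimately show ?thesis
    by (simp add: compactin_imp_closedin)
qed

lemma exhausted_cells: "exhausted_quotient (cells n) (piece n) (\<lambda>m. (linked_in n m)\<^sup>+)"
proof
  fix m
  show "equiv (piece n m) ((linked_in n m)\<^sup>+)"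
  proof (rule equivI)
    show "(linked_in n m)\<^sup>+ \<subseteq> piece n m \<times> piece n m"
      by (rule trancl_subset_Sigma[OF linked_in_subset])
    show "refl_on (piece n m) ((linked_in n m)\<^sup>+)"
      by (auto simp: refl_on_def linked_in_def)
    show "sym ((linked_in n m)\<^sup>+)"
      by (rule sym_trancl) (auto simp: sym_def linked_in_def)
  qed (rule trans_trancl)
  have "linked_in n m \<subseteq> linked_in n (Suc m)"
    using piece_mono[of m "Suc m" n] by (auto simp: linked_in_def identified_in_def)
  then show "(linked_in n m)\<^sup>+ \<subseteq> (linked_in n (Suc m))\<^sup>+"
    using trancl_mono by blast
qed (rule Hausdorff_cells openin_piece compactin_piece closedin_trancl_linked_in topspace_cells_piece[symmetric])+

lemma identified_topspace_iff:
  "identified a b \<Longrightarrow> a \<in> topspace (cells n) \<longleftrightarrow> b \<in> topspace (cells n)"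
  using identified_cells[of a b] by (auto simp: topspace_cells)

text \<open>
  A chain of identifications visits finitely many cells, so it lives in some piece.
\<close>

lemma cell_rel_eq: "(\<Union>m. (linked_in n m)\<^sup>+) = cell_rel n"
proof (intro equalityI subrelI)
  fix a b assume "(a, b) \<in> (\<Union>m. (linked_in n m)\<^sup>+)"
  then obtain m where "(a, b) \<in> (linked_in n m)\<^sup>+"
    by auto
  then have ab: "a \<in> piece n m" "b \<in> piece n m" "equivclp identified a b"
  proof (induction rule: trancl.induct)
    case (r_into_trancl a b)
    {
      case 1 show ?case using r_into_trancl linked_in_subset by blast
    next
      case 2 show ?case using r_into_trancl linked_in_subset by blast
    next
      case 3 show ?case
        using r_into_trancl by (auto simp: linked_in_def identified_in_def intro: equivclp_sym)
    }
  next
    case (trancl_into_trancl a b c)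
    {
      case 1 show ?case using trancl_into_trancl by blast
    next
      case 2 show ?case using trancl_into_trancl linked_in_subset by blast
    next
      case 3
      have "equivclp identified b c"
        using trancl_into_trancl by (auto simp: linked_in_def identified_in_def intro: equivclp_sym)
      then show ?case
        using trancl_into_trancl equivclp_trans by metis
    }
  qed
  then show "(a, b) \<in> cell_rel n"
    unfolding cell_rel_def topspace_cells_piece by blast
next
  fix a b assume "(a, b) \<in> cell_rel n"
  then have a: "a \<in> topspace (cells n)" and "equivclp identified a b"
    by (auto simp: cell_rel_def)
  from this(2) show "(a, b) \<in> (\<Union>m. (linked_in n m)\<^sup>+)"
  proof (induction rule: equivclp_induct)
    case base
    then show ?case
      using a exhausted_quotient.equiv_R[OF exhausted_cells[of n]] by (simp add: equiv_def refl_on_def)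
  next
    case (step y z)
    have "y \<in> topspace (cells n)"
      using step.IH exhausted_quotient.equiv_R[OF exhausted_cells[of n]] by (meson equiv_class_eq_iff)
    then obtain i where i: "y \<in> piece n i"
      by (auto simp: topspace_cells_piece)
    have "z \<in> topspace (cells n)"
      using step.hyps identified_topspace_iff \<open>y \<in> topspace (cells n)\<close> by blast
    then obtain j where j: "z \<in> piece n j"
      by (auto simp: topspace_cells_piece)
    have "y \<in> piece n (max i j)" "z \<in> piece n (max i j)"
      using i j piece_mono[of i "max i j" n] piece_mono[of j "max i j" n] by auto
    then have "(y, z) \<in> linked_in n (max i j)"
      using step.hyps by (auto simp: linked_in_def identified_in_def)
    then have "(y, z) \<in> (\<Union>m. (linked_in n m)\<^sup>+)"
      by blast
    then show ?case
      using step.IH exhausted_quotient.equiv_R[OF exhausted_cells[of n]] by (meson equiv_def transD)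
  qed
qed

section \<open>Grafting of classes\<close>

lemma cell_points_arity: "a \<in> topspace (cells n) \<longleftrightarrow> a \<in> cell_points \<and> leaf_count (encode a) = n"
  by (cases a) (auto simp: topspace_cells cell_points_def leaf_count_encode)

lemma graft_point_props:
  assumes "1 \<le> j" "j \<le> p" "a \<in> topspace (cells p)" "b \<in> topspace (cells q)"
  shows "graft_point j a b \<in> topspace (cells (p + q - 1))"
    and "encode (graft_point j a b) = lgraft (encode a) j (encode b)"
  using assms encode_graft_point[of a b j]
  by (cases a; cases b; cases "graft_point j a b"; auto simp: topspace_cells)+

lemma identified_move_cases:
  assumes "identified a b"
  obtains "a = b" | \<rho> q where "move_kind \<rho>" "move_at \<rho> q (encode a) (encode b)"
    | \<rho> q where "move_kind \<rho>" "move_at \<rho> q (encode b) (encode a)"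
  using moves_if_identified[OF assms] by blast

lemma identified_graft_left:
  assumes id: "identified a a'" and j: "1 \<le> j" "j \<le> p"
    and a: "a \<in> topspace (cells p)" and b: "b \<in> topspace (cells q)"
  shows "equivclp identified (graft_point j a b) (graft_point j a' b)"
proof -
  have a': "a' \<in> topspace (cells p)"
    using identified_topspace_iff[OF id] a by blast
  note g = graft_point_props[OF j a b] and g' = graft_point_props[OF j a' b]
  have cp: "graft_point j a b \<in> cell_points" "graft_point j a' b \<in> cell_points"
    using g(1) g'(1) by (auto simp: cell_points_arity)
  have set: "set_ltree (encode a) \<subseteq> {0..1}" "set_ltree (encode a') \<subseteq> {0..1}"
    using a a' encode_unit_interval by (auto simp: cell_points_arity)
  have lc: "j \<le> leaf_count (encode a)" "j \<le> leaf_count (encode a')"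
    using a a' j by (auto simp: cell_points_arity)
  have rb: "rooted (encode b)"
    using b rooted_encode by (cases b) (auto simp: cell_points_arity cell_points_def)
  from id show ?thesis
  proof (cases rule: identified_move_cases)
    case 1
    then show ?thesis by simp
  next
    case (2 \<rho> q)
    have "move_at \<rho> q (encode (graft_point j a b)) (encode (graft_point j a' b))"
      unfolding g(2) g'(2) by (rule move_at_lgraft_left[OF 2(1) rb 2(2) set(1) j(1) lc(1)])
    then have "identified (graft_point j a b) (graft_point j a' b)"
      by (rule identified_if_move[OF 2(1) cp])
    then show ?thesis
      by (rule r_into_equivclp)
  next
    case (3 \<rho> q)
    have "move_at \<rho> q (encode (graft_point j a' b)) (encode (graft_point j a b))"
      unfolding g(2) g'(2) by (rule move_at_lgraft_left[OF 3(1) rb 3(2) set(2) j(1) lc(2)])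
    then have "identified (graft_point j a' b) (graft_point j a b)"
      by (rule identified_if_move[OF 3(1) cp(2,1)])
    then show ?thesis
      by (meson equivclp_sym r_into_equivclp)
  qed
qed

lemma identified_graft_right:
  assumes id: "identified b b'" and j: "1 \<le> j" "j \<le> p"
    and a: "a \<in> topspace (cells p)" and b: "b \<in> topspace (cells q)"
  shows "equivclp identified (graft_point j a b) (graft_point j a b')"
proof -
  have b': "b' \<in> topspace (cells q)"
    using identified_topspace_iff[OF id] b by blast
  note g = graft_point_props[OF j a b] and g' = graft_point_props[OF j a b']
  have cp: "graft_point j a b \<in> cell_points" "graft_point j a b' \<in> cell_points"
    using g(1) g'(1) by (auto simp: cell_points_arity)
  have lc: "j \<le> leaf_count (encode a)"
    using a j by (auto simp: cell_points_arity)
  from id show ?thesis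
  proof (cases rule: identified_move_cases)
    case 1
    then show ?thesis by simp
  next
    case (2 \<rho> q)
    obtain q' where "move_at \<rho> q' (encode (graft_point j a b)) (encode (graft_point j a b'))"
      unfolding g(2) g'(2) using move_at_lgraft_right[OF 2(2) j(1) lc] by blast
    then have "identified (graft_point j a b) (graft_point j a b')"
      by (rule identified_if_move[OF 2(1) cp])
    then show ?thesis
      by (rule r_into_equivclp)
  next
    case (3 \<rho> q)
    obtain q' where "move_at \<rho> q' (encode (graft_point j a b')) (encode (graft_point j a b))"
      unfolding g(2) g'(2) using move_at_lgraft_right[OF 3(2) j(1) lc] by blast
    then have "identified (graft_point j a b') (graft_point j a b)"
      by (rule identified_if_move[OF 3(1) cp(2,1)])
    then show ?thesis
      by (meson equivclp_sym r_into_equivclp)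
  qed
qed

lemma equivclp_topspace:
  assumes "equivclp identified a b" "a \<in> topspace (cells n)"
  shows "b \<in> topspace (cells n)"
  using assms by (induction rule: equivclp_induct) (use identified_topspace_iff in blast)+

lemma equivclp_graft:
  assumes j: "1 \<le> j" "j \<le> p" and a: "a \<in> topspace (cells p)" and b: "b \<in> topspace (cells q)"
    and aa': "equivclp identified a a'" and bb': "equivclp identified b b'"
  shows "equivclp identified (graft_point j a b) (graft_point j a' b')"
proof -
  have "equivclp identified (graft_point j a b) (graft_point j a' b)"
    using aa'
  proof (induction rule: equivclp_induct)
    case (step y z)
    have y: "y \<in> topspace (cells p)"
      using equivclp_topspace step.hyps(1) a .
    have "equivclp identified (graft_point j y b) (graft_point j z b)"
      using step.hyps(2)
    proof
      assume "identified y z"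
      then show ?thesis
        using identified_graft_left j y b by blast
    next
      assume zy: "identified z y"
      then have "z \<in> topspace (cells p)"
        using identified_topspace_iff y by blast
      then show ?thesis
        by (rule equivclp_sym[OF identified_graft_left[OF zy j _ b]])
    qed
    with step.IH show ?case
      by (rule equivclp_trans)
  qed simp
  moreover have a': "a' \<in> topspace (cells p)"
    using equivclp_topspace aa' a .
  have "equivclp identified (graft_point j a' b) (graft_point j a' b')"
    using bb'
  proof (induction rule: equivclp_induct)
    case (step y z)
    have y: "y \<in> topspace (cells q)"
      using equivclp_topspace step.hyps(1) b .
    have "equivclp identified (graft_point j a' y) (graft_point j a' z)"
      using step.hyps(2)
    proof
      assume "identified y z"
      then show ?thesis
        using identified_graft_right j y a' by blast
    next
      assume zy: "identified z y"
      then have "z \<in> topspace (cells q)"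
        using identified_topspace_iff y by blast
      then show ?thesis
        by (rule equivclp_sym[OF identified_graft_right[OF zy j a']])
    qed
    with step.IH show ?case
      by (rule equivclp_trans)
  qed simp
  ultimately show ?thesis
    by (rule equivclp_trans)
qed

lemma cell_class_eq_iff:
  assumes "a \<in> topspace (cells n)" "b \<in> topspace (cells n)"
  shows "cell_class n a = cell_class n b \<longleftrightarrow> equivclp identified a b"
proof
  assume "cell_class n a = cell_class n b"
  then have "b \<in> cell_class n a"
    using assms by (simp add: cell_class_def cell_rel_def)
  then show "equivclp identified a b"
    by (simp add: cell_class_def cell_rel_def)
next
  assume "equivclp identified a b"
  then show "cell_class n a = cell_class n b"
    using assms unfolding cell_class_def cell_rel_def by (auto intro: equivclp_trans equivclp_sym)
qed

text \<open>
  All composites of representatives are equivalent, so the union in \<open>uA_circ\<close> is a union of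
  equal classes.
\<close>

lemma uA_circ_cell_class:
  assumes j: "1 \<le> j" "j \<le> p" and a: "a \<in> topspace (cells p)" and b: "b \<in> topspace (cells q)"
  shows "uA_circ p q j (cell_class p a) (cell_class q b) = cell_class (p + q - 1) (graft_point j a b)"
proof -
  have "cell_class (p + q - 1) (graft_point j a' b') = cell_class (p + q - 1) (graft_point j a b)"
    if "a' \<in> cell_class p a" "b' \<in> cell_class q b" for a' b'
  proof -
    have a': "a' \<in> topspace (cells p)" "equivclp identified a a'"
      and b': "b' \<in> topspace (cells q)" "equivclp identified b b'"
      using that by (auto simp: cell_class_def cell_rel_def)
    have "equivclp identified (graft_point j a' b') (graft_point j a b)"
      using equivclp_graft[OF j a b a'(2) b'(2)] by (rule equivclp_sym)
    then show ?thesis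
      by (subst cell_class_eq_iff) (use graft_point_props j a b a' b' in auto)
  qed
  moreover have "a \<in> cell_class p a" "b \<in> cell_class q b"
    using a b by (auto simp: cell_class_def cell_rel_def)
  ultimately show ?thesis
    unfolding uA_circ_def by blast
qed

lemma topspace_unital_associahedron: 
  "topspace (unital_associahedron n) = cell_class n ` topspace (cells n)"
  by (auto simp: unital_associahedron_def topspace_quotient_topology quotient_def cell_class_def)

section \<open>Continuity of the composition laws\<close>

text \<open>
  Products of cells are open in the product of the disjoint unions.
\<close>

lemma continuous_map_prod_cells:
  assumes f: "\<And>t s. \<lbrakk>binary t; card (leaves t) = p; binary s; card (leaves s) = q\<rbrakk> \<Longrightarrow>
      continuous_map (prod_topology (cube (dim_cell t)) (cube (dim_cell s))) Y (\<lambda>z. f ((t, fst z), (s, snd z)))"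
  shows "continuous_map (prod_topology (cells p) (cells q)) Y f"
  unfolding continuous_map_def
proof (intro conjI allI impI)
  have cell: "\<exists>t x. a = (t, x) \<and> binary t \<and> card (leaves t) = n \<and> x \<in> topspace (cube (dim_cell t))"
    if "a \<in> topspace (cells n)" for a n
    using that by (cases a) (auto simp: topspace_cells cell_points_def)
  show "f \<in> topspace (prod_topology (cells p) (cells q)) \<rightarrow> topspace Y"
  proof
    fix z assume "z \<in> topspace (prod_topology (cells p) (cells q))"
    then obtain t x s y where z: "z = ((t, x), (s, y))"
        and t: "binary t" "card (leaves t) = p" "x \<in> topspace (cube (dim_cell t))"
        and s: "binary s" "card (leaves s) = q" "y \<in> topspace (cube (dim_cell s))"
      using cell[of "fst z" p] cell[of "snd z" q] by (cases z) auto
    have "f ((t, fst (x, y)), (s, snd (x, y))) \<in> topspace Y"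
      using continuous_map_image_subset_topspace[OF f[OF t(1,2) s(1,2)]] t s
      by (metis (no_types, lifting) SigmaI image_subset_iff topspace_prod_topology)
    then show "f z \<in> topspace Y"
      by (simp add: z)
  qed
  fix U assume U: "openin Y U"
  show "openin (prod_topology (cells p) (cells q)) {z \<in> topspace (prod_topology (cells p) (cells q)). f z \<in> U}"
    unfolding openin_prod_topology_alt
  proof (intro allI impI)
    fix a b assume ab: "(a, b) \<in> {z \<in> topspace (prod_topology (cells p) (cells q)). f z \<in> U}"
    then obtain t x s y where z: "a = (t, x)" "b = (s, y)"
        and t: "binary t" "card (leaves t) = p" "x \<in> topspace (cube (dim_cell t))"
        and s: "binary s" "card (leaves s) = q" "y \<in> topspace (cube (dim_cell s))"
      using cell[of a p] cell[of b q] by auto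
    let ?Z = "prod_topology (cube (dim_cell t)) (cube (dim_cell s))"
    have o: "openin ?Z {z \<in> topspace ?Z. f ((t, fst z), (s, snd z)) \<in> U}"
      by (rule openin_continuous_map_preimage[OF f[OF t(1,2) s(1,2)] U])
    have m: "(x, y) \<in> {z \<in> topspace ?Z. f ((t, fst z), (s, snd z)) \<in> U}"
      using ab t s by (simp add: z)
    from o[unfolded openin_prod_topology_alt, rule_format, OF m]
    obtain A B where AB: "openin (cube (dim_cell t)) A" "openin (cube (dim_cell s)) B"
        "x \<in> A" "y \<in> B" "A \<times> B \<subseteq> {z \<in> topspace ?Z. f ((t, fst z), (s, snd z)) \<in> U}"
      by (elim exE conjE) (rule that)
    have op: "openin (cells p) (Pair t ` A)" "openin (cells q) (Pair s ` B)"
      by (rule openin_cell[OF t(1,2) AB(1)], rule openin_cell[OF s(1,2) AB(2)])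
    have "Pair t ` A \<times> Pair s ` B \<subseteq> {z \<in> topspace (prod_topology (cells p) (cells q)). f z \<in> U}"
    proof
      fix w assume w: "w \<in> Pair t ` A \<times> Pair s ` B"
      then obtain x' y' where w': "w = ((t, x'), (s, y'))" "(x', y') \<in> A \<times> B"
        by auto
      have "f w \<in> U"
        using AB(5) w' by (auto simp: subset_iff)
      then show "w \<in> {z \<in> topspace (prod_topology (cells p) (cells q)). f z \<in> U}"
        using openin_subset[OF op(1)] openin_subset[OF op(2)] w by auto
    qed
    then show "\<exists>U' V. openin (cells p) U' \<and> openin (cells q) V \<and> a \<in> U' \<and> b \<in> V \<and>
        U' \<times> V \<subseteq> {z \<in> topspace (prod_topology (cells p) (cells q)). f z \<in> U}"
      using op imageI[OF AB(3), of "Pair t"] imageI[OF AB(4), of "Pair s"] z by blast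
  qed
qed

text \<open>
  On a product of two cells, each coordinate of the composite is a coordinate of one of the two
  points or the constant 1.
\<close>

lemma continuous_map_graft_point:
  assumes j: "1 \<le> j" "j \<le> p"
  shows "continuous_map (prod_topology (cells p) (cells q)) (cells (p + q - 1)) (\<lambda>(a, b). graft_point j a b)"
proof (rule continuous_map_prod_cells)
  fix t s assume t: "binary t" "card (leaves t) = p" and s: "binary s" "card (leaves s) = q"
  let ?Z = "prod_topology (cube (dim_cell t)) (cube (dim_cell s))"
  let ?f = "\<lambda>z. graft_point j (t, fst z) (s, snd z)"
  have mem: "?f z \<in> topspace (cells (p + q - 1))" if "z \<in> topspace ?Z" for z
    using that t s by (intro graft_point_props j) (auto simp: topspace_cells cell_points_def)
  consider "t = Leaf" | "t \<noteq> Leaf" "s = Leaf" | "t \<noteq> Leaf" "s \<noteq> Leaf"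
    by blast
  then have "continuous_map ?Z (cells (p + q - 1)) ?f"
  proof cases
    case 1
    have "p + q - 1 = q"
      using 1 t by simp
    then show ?thesis
      using continuous_map_compose[OF continuous_map_snd continuous_map_cell[OF s]] 1 by (simp add: o_def)
  next
    case 2
    have "p + q - 1 = p"
      using 2 s by simp
    then show ?thesis
      using continuous_map_compose[OF continuous_map_fst continuous_map_cell[OF t]] 2 by (simp add: o_def)
  next
    case 3
    let ?g = "graft t j s"
    define k where "k = number_in (inner_edges ?g) (nth_of (leaves t) j)"
    define h where "h z = face 1 (dim_cell t + dim_cell s + 1) k (insert_cube (dim_cell t) (dim_cell s) k (fst z) (snd z))" for z
    have f: "?f z = (?g, h z)" for z
      using 3 by (simp add: Let_def h_def k_def)
    have g: "binary ?g" "card (leaves ?g) = p + q - 1"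
      using graft_props[OF t(1) s(1)] j t s by auto
    have x: "continuous_map ?Z euclideanreal (\<lambda>z. fst z l)" and y: "continuous_map ?Z euclideanreal (\<lambda>z. snd z l)" for l
      using continuous_map_compose[OF continuous_map_fst continuous_map_coordinate]
        continuous_map_compose[OF continuous_map_snd continuous_map_coordinate] by (simp_all add: o_def)
    have "continuous_map ?Z (cube (dim_cell ?g)) h"
    proof (rule continuous_map_into_cube)
      show "h z \<in> topspace (cube (dim_cell ?g))" if "z \<in> topspace ?Z" for z
        using mem[OF that] unfolding f by (simp add: topspace_cells cell_points_def)
      fix l
      consider "l \<notin> {1..dim_cell t + dim_cell s + 1}" | "l \<in> {1..dim_cell t + dim_cell s + 1}" by blast
      then show "continuous_map ?Z euclideanreal (\<lambda>z. h z l)"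
        using x y by cases (auto simp: h_def face_def insert_cube_def restrict_def)
    qed
    from continuous_map_compose[OF this continuous_map_cell[OF g]] show ?thesis
      unfolding f o_def .
  qed
  then show "continuous_map ?Z (cells (p + q - 1)) (\<lambda>z. case ((t, fst z), (s, snd z)) of (a, b) \<Rightarrow> graft_point j a b)"
    by simp
qed

lemma quotient_map_prod_cell_class:
  "quotient_map (prod_topology (cells p) (cells q))
     (prod_topology (unital_associahedron p) (unital_associahedron q))
     (\<lambda>(a, b). (cell_class p a, cell_class q b))"
  using quotient_map_prod_exhausted[OF exhausted_cells[of p] exhausted_cells[of q]]
  unfolding cell_rel_eq unital_associahedron_def cell_class_def .

lemma continuous_map_uA_circ:
  assumes j: "1 \<le> j" "j \<le> p"
  shows "continuous_map (prod_topology (unital_associahedron p) (unital_associahedron q))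
    (unital_associahedron (p + q - 1)) (\<lambda>(A, B). uA_circ p q j A B)"
proof (rule continuous_compose_quotient_map[OF quotient_map_prod_cell_class])
  have "continuous_map (cells (p + q - 1)) (unital_associahedron (p + q - 1)) (cell_class (p + q - 1))"
    using quotient_imp_continuous_map[OF quotient_map_quotient_topology]
    unfolding unital_associahedron_def cell_class_def .
  from continuous_map_compose[OF continuous_map_graft_point[OF j] this]
  have "continuous_map (prod_topology (cells p) (cells q)) (unital_associahedron (p + q - 1))
      (\<lambda>(a, b). cell_class (p + q - 1) (graft_point j a b))"
    by (simp add: o_def case_prod_unfold)
  then show "continuous_map (prod_topology (cells p) (cells q)) (unital_associahedron (p + q - 1))
      ((\<lambda>(A, B). uA_circ p q j A B) \<circ> (\<lambda>(a, b). (cell_class p a, cell_class q b)))"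
    by (rule continuous_map_eq) (use uA_circ_cell_class[OF j] in auto)
qed

section \<open>The operad axioms\<close>

lemma encode_eqD:
  "\<lbrakk>a \<in> topspace (cells n); b \<in> topspace (cells n); encode a = encode b\<rbrakk> \<Longrightarrow> a = b"
  using encode_inj[of "fst a" "snd a" "fst b" "snd b"] by (simp add: cell_points_arity)

text \<open>
  Like the other identities, this holds for points of cells and not only for their classes.
\<close>

lemma graft_point_parallel:
  assumes "a \<in> topspace (cells l)" "b \<in> topspace (cells m)" "c \<in> topspace (cells n)" "1 \<le> j" "j < i" "i \<le> l"
  shows "graft_point j (graft_point i a b) c = graft_point (i + n - 1) (graft_point j a c) b"
proof (rule encode_eqD)
  have ab: "graft_point i a b \<in> topspace (cells (l + m - 1))"
      "encode (graft_point i a b) = lgraft (encode a) i (encode b)"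
    using graft_point_props[of i l a b m] assms by auto
  have ac: "graft_point j a c \<in> topspace (cells (l + n - 1))"
      "encode (graft_point j a c) = lgraft (encode a) j (encode c)"
    using graft_point_props[of j l a c n] assms by auto
  have i: "1 \<le> j" "j \<le> l + m - 1" "1 \<le> i + n - 1" "i + n - 1 \<le> l + n - 1" and
     "l + m - 1 + n - 1 = l + n - 1 + m - 1"
    using assms by auto
  note L = graft_point_props[OF i(1,2) ab(1) assms(3)] and R = graft_point_props[OF i(3,4) ac(1) assms(2)]
  show "graft_point j (graft_point i a b) c \<in> topspace (cells (l + m - 1 + n - 1))"
    by (rule L(1))
  show "graft_point (i + n - 1) (graft_point j a c) b \<in> topspace (cells (l + m - 1 + n - 1))"
    using R(1) \<open>l + m - 1 + n - 1 = _\<close> by simp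
  show "encode (graft_point j (graft_point i a b) c) = encode (graft_point (i + n - 1) (graft_point j a c) b)"
    unfolding L(2) R(2) ab(2) ac(2)
    using lgraft_parallel[of j i "encode a" "encode b" "encode c"] assms by (simp add: cell_points_arity)
qed

lemma graft_point_sequential:
  assumes "a \<in> topspace (cells l)" "b \<in> topspace (cells m)" "c \<in> topspace (cells n)"
    "1 \<le> i" "i \<le> l" "i \<le> j" "j < m + i"
  shows "graft_point j (graft_point i a b) c = graft_point i a (graft_point (j - i + 1) b c)"
proof (rule encode_eqD)
  have ab: "graft_point i a b \<in> topspace (cells (l + m - 1))"
      "encode (graft_point i a b) = lgraft (encode a) i (encode b)"
    using graft_point_props[of i l a b m] assms by auto
  have bc: "graft_point (j - i + 1) b c \<in> topspace (cells (m + n - 1))"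
      "encode (graft_point (j - i + 1) b c) = lgraft (encode b) (j - i + 1) (encode c)"
    using graft_point_props[of "j - i + 1" m b c n] assms by auto
  have i: "1 \<le> j" "j \<le> l + m - 1" and
     "l + m - 1 + n - 1 = l + (m + n - 1) - 1"
    using assms by auto
  note L = graft_point_props[OF i(1,2) ab(1) assms(3)] and R = graft_point_props[OF assms(4,5) assms(1) bc(1)]
  show "graft_point j (graft_point i a b) c \<in> topspace (cells (l + m - 1 + n - 1))"
    by (rule L(1))
  show "graft_point i a (graft_point (j - i + 1) b c) \<in> topspace (cells (l + m - 1 + n - 1))"
    using R(1) \<open>l + m - 1 + n - 1 = _\<close> by simp
  show "encode (graft_point j (graft_point i a b) c) = encode (graft_point i a (graft_point (j - i + 1) b c))"
    unfolding L(2) R(2) ab(2) bc(2)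
    using lgraft_sequential[of i "encode a" j "encode b" "encode c"] assms by (simp add: cell_points_arity)
qed

lemma unit_point: "(Leaf, \<lambda>_. undefined) \<in> topspace (cells 1)"
  by (simp add: topspace_cells cell_points_def topspace_cube dim_cell_eq)

lemma topological_operad_uA: "topological_operad unital_associahedron uA_circ uA_unit"
proof
  fix m n i :: nat assume "1 \<le> i" "i \<le> m"
  then show "continuous_map (prod_topology (unital_associahedron m) (unital_associahedron n))
      (unital_associahedron (m + n - 1)) (\<lambda>(a, b). uA_circ m n i a b)"
    by (rule continuous_map_uA_circ)
next
  show "uA_unit \<in> topspace (unital_associahedron 1)"
    using unit_point by (simp add: uA_unit_def topspace_unital_associahedron)
next
  fix l m n i j :: nat and A B C
  assume "A \<in> topspace (unital_associahedron l)" "B \<in> topspace (unital_associahedron m)"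
    "C \<in> topspace (unital_associahedron n)" and ij: "1 \<le> j" "j < i" "i \<le> l"
  then obtain a b c where a: "a \<in> topspace (cells l)" "A = cell_class l a"
    and b: "b \<in> topspace (cells m)" "B = cell_class m b"
    and c: "c \<in> topspace (cells n)" "C = cell_class n c"
    by (auto simp: topspace_unital_associahedron)
  have i: "1 \<le> i" "j \<le> l" "j \<le> l + m - 1" "1 \<le> i + n - 1" "i + n - 1 \<le> l + n - 1"
    and e: "l + m - 1 + n - 1 = l + n - 1 + m - 1"
    using ij by auto
  have "uA_circ (l + m - 1) n j (uA_circ l m i A B) C
      = cell_class (l + m - 1 + n - 1) (graft_point j (graft_point i a b) c)"
    using a b c ij i graft_point_props(1)[OF i(1) ij(3) a(1) b(1)] by (simp add: uA_circ_cell_class)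
  also have "\<dots> = cell_class (l + n - 1 + m - 1) (graft_point (i + n - 1) (graft_point j a c) b)"
    unfolding e using graft_point_parallel[OF a(1) b(1) c(1) ij] by simp
  also have "\<dots> = uA_circ (l + n - 1) m (i + n - 1) (uA_circ l n j A C) B"
    using a b c ij i graft_point_props(1)[OF ij(1) i(2) a(1) c(1)] by (simp add: uA_circ_cell_class)
  finally show "uA_circ (l + m - 1) n j (uA_circ l m i A B) C
      = uA_circ (l + n - 1) m (i + n - 1) (uA_circ l n j A C) B" .
next
  fix l m n i j :: nat and A B C
  assume "A \<in> topspace (unital_associahedron l)" "B \<in> topspace (unital_associahedron m)"
    "C \<in> topspace (unital_associahedron n)" and ij: "1 \<le> i" "i \<le> l" "i \<le> j" "j < m + i"
  then obtain a b c where a: "a \<in> topspace (cells l)" "A = cell_class l a"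
    and b: "b \<in> topspace (cells m)" "B = cell_class m b"
    and c: "c \<in> topspace (cells n)" "C = cell_class n c"
    by (auto simp: topspace_unital_associahedron)
  have i: "1 \<le> j" "j \<le> l + m - 1" "1 \<le> j - i + 1" "j - i + 1 \<le> m"
    and e: "l + m - 1 + n - 1 = l + (m + n - 1) - 1"
    using ij by auto
  have "uA_circ (l + m - 1) n j (uA_circ l m i A B) C
      = cell_class (l + m - 1 + n - 1) (graft_point j (graft_point i a b) c)"
    using a b c ij i graft_point_props(1)[OF ij(1,2) a(1) b(1)] by (simp add: uA_circ_cell_class)
  also have "\<dots> = cell_class (l + (m + n - 1) - 1) (graft_point i a (graft_point (j - i + 1) b c))"
    unfolding e using graft_point_sequential[OF a(1) b(1) c(1) ij] by simp
  also have "\<dots> = uA_circ l (m + n - 1) i A (uA_circ m n (j - i + 1) B C)"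
    using uA_circ_cell_class[OF i(3,4) b(1) c(1)]
      uA_circ_cell_class[OF ij(1,2) a(1) graft_point_props(1)[OF i(3,4) b(1) c(1)]] a b c by simp
  finally show "uA_circ (l + m - 1) n j (uA_circ l m i A B) C
      = uA_circ l (m + n - 1) i A (uA_circ m n (j - i + 1) B C)" .
next
  fix n A assume "A \<in> topspace (unital_associahedron n)"
  then obtain a where a: "a \<in> topspace (cells n)" "A = cell_class n a"
    by (auto simp: topspace_unital_associahedron)
  have "graft_point 1 (Leaf, \<lambda>_. undefined) a = a"
    by (cases a) simp
  then show "uA_circ 1 n 1 uA_unit A = A"
    using uA_circ_cell_class[of 1 1 "(Leaf, \<lambda>_. undefined)" a n] unit_point a by (simp add: uA_unit_def)
next
  fix m i :: nat and A assume "A \<in> topspace (unital_associahedron m)" and i: "1 \<le> i" "i \<le> m"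
  then obtain a where a: "a \<in> topspace (cells m)" "A = cell_class m a"
    by (auto simp: topspace_unital_associahedron)
  have "graft_point i a (Leaf, \<lambda>_. undefined) = a"
  proof (rule encode_eqD)
    note G = graft_point_props[OF i a(1) unit_point]
    show "graft_point i a (Leaf, \<lambda>_. undefined) \<in> topspace (cells m)"
      using G(1) by simp
    show "encode (graft_point i a (Leaf, \<lambda>_. undefined)) = encode a"
      unfolding G(2) by (simp add: encode.simps lgraft_LLeaf)
  qed (rule a(1))
  then show "uA_circ m 1 i A uA_unit = A"
    using uA_circ_cell_class[OF i a(1) unit_point] a by (simp add: uA_unit_def)
qed

theorem theorem4p2:
  shows "(\<forall>p q j. 1 \<le> j \<and> j \<le> p \<longrightarrow>
            (\<forall>a \<in> topspace (cells p). \<forall>b \<in> topspace (cells q).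
               graft_point j a b \<in> topspace (cells (p + q - 1)) \<and>
               uA_circ p q j (cell_class p a) (cell_class q b)
                 = cell_class (p + q - 1) (graft_point j a b)))
         \<and> topological_operad unital_associahedron uA_circ uA_unit"
  using graft_point_props(1) uA_circ_cell_class topological_operad_uA by blast

end
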